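(* The only reduced equitable $2$-partitions of $H(n,q)$ with eigenvalue $\lambda_2(n,q)=(q-1)n-2q$ are: 1. reduced equitable $2$-partitions of $H(2,q)$ and $H(3,q)$ (with eigenvalue $\lambda_2(2,q)$ and $\lambda_2(3,q)$ respectively); 2. if $q$ is even, the equitable $2$-partition of $H(4,q)$ from alphabet liftings of two induced $8$-cycles in $H(4,2)$ (Construction B); 3. equitable $2$-partitions of $H(n,q)$ obtained by the permutation switchings (Construction A).
   Context: **Hamming graph.** $\mathcal A$ is a set of size $q$; $H(n,q)$ has vertex set $\mathcal A^n$, two tuples being adjacent iff they differ in exactly one coordinate. Its eigenvalues are $\lambda_i(n,q)=(q-1)n-qi$, $0\le i\le n$. **Equitable 2-partition.** A partition $(C_1,C_2)=(C,\overline C)$ of the vertex set of a graph is equitable with quotient matrix $S=(S_{ij})$ if every vertex of $C_i$ has exactly $S_{ij}$ neighbours in $C_j$, for all $i,j\in\{1,2\}$. An eigenvalue of the partition is an eigenvalue of $S$. **Reduced.** A coordinate $i\in\{1,\dots,n\}$ is essential for the partition $(C,\overline C)$ if there are two vertices differing only in the $i$th coordinate at which the characteristic function of $C$ takes different values. The partition is reduced if all coordinates $1,\dots,n$ are essential. **Construction A.** Let $A_1,\dots,A_{n-1}$ be a partition of $\mathcal A$. Let $(C,\overline C)$ be a $2$-partition of the vertex set $\mathcal A^2$ of $H(2,q)$ such that $|C\cap K|/|K|$ is the same for any maximal clique $K$ of any of the subgraphs of $H(2,q)$ induced by $A_i\times\mathcal A$, $i=1,\dots,n-1$. Let $C^+=\{(x_1,x_2,y_3,\dots,y_n):(x_1,x_2)\in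 C,\ y_3,\dots,y_n\in\mathcal A\}$. For a permutation $\pi$ of $\{1,\dots,n\}$ and $x\in\mathcal A^n$ let $\pi(x)=(x_{\pi(1)},\dots,x_{\pi(n)})$, and for $M\subseteq\mathcal A^n$ let $\pi(M)=\{\pi(x):x\in M\}$. Let $\pi_1$ be the identity permutation and $\pi_i$ the transposition $(2,i+1)$ for $2\le i\le n-1$, and put $C^+_\pi=\bigcup_{i=1}^{n-1}\pi_i\big((A_i\times\mathcal A^{n-1})\cap C^+\big)$. The partition obtained is the partition $(C^+_\pi,\overline{C^+_\pi})$ of the vertex set of $H(n,q)$. **Construction B.** Let $\mathcal A=A_0\cup A_1$ with $A_1=\overline{A_0}$ and $|A_0|=|A_1|=q/2$. Let $(C,\overline C)$ be a partition of the vertex set $\{0,1\}^4$ of $H(4,2)$ into two induced cycles of length $8$, for example $C=\{0001,0011,0010,0110,1110,1100,1101,1001\}$. Put $D=\bigcup_{(x_1,x_2,x_3,x_4)\in C}A_{x_1}\times A_{x_2}\times A_{x_3}\times A_{x_4}$. The partition obtained is the partition $(D,\overline D)$ of the vertex set of $H(4,q)$.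
   Formalization: Constructions A and B are taken up to automorphisms of H(n,q) (permuting coordinates, and the alphabet in each coordinate); read literally the claim fails, e.g. for an 8-cycle lifting that uses different halves of the alphabet in different coordinates. *)

theory Defs
  imports
    "HOL-Library.FuncSet"
    "HOL-Library.Disjoint_Sets"
    "HOL-Combinatorics.Permutations"
    "Jordan_Normal_Form.Char_Poly"
begin

text \<open>
  A simple graph is given by a vertex set and a symmetric irreflexive adjacency relation;
  the subgraph induced by a set \<open>W\<close> of vertices is \<open>W\<close> with the same relation.
\<close>

definition clique :: "('v \<Rightarrow> 'v \<Rightarrow> bool) \<Rightarrow> 'v set \<Rightarrow> bool" where
  "clique adj K \<longleftrightarrow> (\<forall>x\<in>K. \<forall>y\<in>K. x \<noteq> y \<longrightarrow> adj x y)"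

definition maximal_clique_in :: "('v \<Rightarrow> 'v \<Rightarrow> bool) \<Rightarrow> 'v set \<Rightarrow> 'v set \<Rightarrow> bool" where
  "maximal_clique_in adj W K \<longleftrightarrow>
     K \<subseteq> W \<and> clique adj K \<and> (\<forall>L. K \<subseteq> L \<and> L \<subseteq> W \<and> clique adj L \<longrightarrow> L = K)"

definition induces_cycle :: "('v \<Rightarrow> 'v \<Rightarrow> bool) \<Rightarrow> 'v set \<Rightarrow> nat \<Rightarrow> bool" where
  "induces_cycle adj W m \<longleftrightarrow> 3 \<le> m \<and>
     (\<exists>c. bij_betw c {..<m} W \<and>
        (\<forall>i<m. \<forall>j<m. adj (c i) (c j) \<longleftrightarrow> j = (i + 1) mod m \<or> i = (j + 1) mod m))"

text \<open>
  The 2-partition \<open>(C, V - C)\<close> is represented by its first part \<open>C\<close>. As usual, parts of a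
  partition are nonempty. Matrices of the library are indexed from \<open>0\<close>, so the two parts carry
  the indices \<open>0\<close> and \<open>1\<close>.
\<close>

definition two_partition :: "'v set \<Rightarrow> 'v set \<Rightarrow> bool" where
  "two_partition V C \<longleftrightarrow> C \<subseteq> V \<and> C \<noteq> {} \<and> V - C \<noteq> {}"

definition cell :: "'v set \<Rightarrow> 'v set \<Rightarrow> nat \<Rightarrow> 'v set" where
  "cell V C i = (if i = 0 then C else V - C)"

definition equitable_2_partition ::
    "'v set \<Rightarrow> ('v \<Rightarrow> 'v \<Rightarrow> bool) \<Rightarrow> 'v set \<Rightarrow> real mat \<Rightarrow> bool" where
  "equitable_2_partition V adj C S \<longleftrightarrow>
     two_partition V C \<and> S \<in> carrier_mat 2 2 \<and>
     (\<forall>i<2. \<forall>j<2. \<forall>x\<in>cell V C i. real (card {y \<in> cell V C j. adj x y}) = S $$ (i, j))"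

definition equitable_2_partition_with_eigenvalue ::
    "'v set \<Rightarrow> ('v \<Rightarrow> 'v \<Rightarrow> bool) \<Rightarrow> 'v set \<Rightarrow> real \<Rightarrow> bool" where
  "equitable_2_partition_with_eigenvalue V adj C \<theta> \<longleftrightarrow>
     (\<exists>S. equitable_2_partition V adj C S \<and> eigenvalue S \<theta>)"

text \<open>Tuples of length \<open>n\<close> are extensional functions on \<open>{1..n}\<close>.\<close>

definition words :: "nat \<Rightarrow> 'a set \<Rightarrow> (nat \<Rightarrow> 'a) set" where
  "words n A = {1..n} \<rightarrow>\<^sub>E A"

definition hamming_adj :: "nat \<Rightarrow> (nat \<Rightarrow> 'a) \<Rightarrow> (nat \<Rightarrow> 'a) \<Rightarrow> bool" where
  "hamming_adj n x y \<longleftrightarrow> card {i \<in> {1..n}. x i \<noteq> y i} = 1"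

definition hamming_eigenvalue :: "nat \<Rightarrow> nat \<Rightarrow> nat \<Rightarrow> real" where
  "hamming_eigenvalue i n q = (real q - 1) * real n - real q * real i"

definition essential :: "nat \<Rightarrow> 'a set \<Rightarrow> (nat \<Rightarrow> 'a) set \<Rightarrow> nat \<Rightarrow> bool" where
  "essential n A C i \<longleftrightarrow>
     (\<exists>x\<in>words n A. \<exists>y\<in>words n A.
        {j \<in> {1..n}. x j \<noteq> y j} = {i} \<and> (x \<in> C) \<noteq> (y \<in> C))"

definition reduced :: "nat \<Rightarrow> 'a set \<Rightarrow> (nat \<Rightarrow> 'a) set \<Rightarrow> bool" where
  "reduced n A C \<longleftrightarrow> (\<forall>i\<in>{1..n}. essential n A C i)"

definition permute_word :: "nat \<Rightarrow> (nat \<Rightarrow> nat) \<Rightarrow> (nat \<Rightarrow> 'a) \<Rightarrow> (nat \<Rightarrow> 'a)" where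
  "permute_word n \<pi> x = (\<lambda>i\<in>{1..n}. x (\<pi> i))"

text \<open>
  Sets that agree up to an automorphism of the Hamming graph, i.e. up to a permutation of the
  coordinates followed by a permutation of the alphabet in each coordinate.
\<close>

definition hamming_equivalent ::
    "nat \<Rightarrow> 'a set \<Rightarrow> (nat \<Rightarrow> 'a) set \<Rightarrow> (nat \<Rightarrow> 'a) set \<Rightarrow> bool" where
  "hamming_equivalent n A C D \<longleftrightarrow>
     (\<exists>\<sigma> \<tau>. \<sigma> permutes {1..n} \<and> (\<forall>i\<in>{1..n}. bij_betw (\<tau> i) A A) \<and>
        D = (\<lambda>x. \<lambda>i\<in>{1..n}. \<tau> i (permute_word n \<sigma> x i)) ` C)"

definition cylinder :: "nat \<Rightarrow> 'a set \<Rightarrow> (nat \<Rightarrow> 'a) set \<Rightarrow> (nat \<Rightarrow> 'a) set" where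
  "cylinder n A C = {x \<in> words n A. restrict x {1, 2} \<in> C}"

definition switching_perm :: "nat \<Rightarrow> nat \<Rightarrow> nat" where
  "switching_perm i = (if i = 1 then id else Transposition.transpose 2 (i + 1))"

text \<open>
  If \<open>P i\<close> is a singleton \<open>{a}\<close> (and \<open>A\<close> has at least two elements), the induced subgraph on
  \<open>P i \<times> A\<close> is complete, so its only maximal clique is \<open>{a} \<times> A\<close>.
\<close>

definition permutation_switching :: "nat \<Rightarrow> 'a set \<Rightarrow> (nat \<Rightarrow> 'a) set \<Rightarrow> bool" where
  "permutation_switching n A M \<longleftrightarrow> 2 \<le> n \<and>
     (\<exists>P C. (\<Union>i\<in>{1..n - 1}. P i) = A \<and> disjoint_family_on P {1..n - 1} \<and>
        (\<forall>i\<in>{1..n - 1}. P i \<noteq> {}) \<and>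
        two_partition (words 2 A) C \<and>
        (\<exists>\<rho>::real. \<forall>i\<in>{1..n - 1}. \<forall>K.
           maximal_clique_in (hamming_adj 2) {x \<in> words 2 A. x 1 \<in> P i} K \<longrightarrow>
           real (card (C \<inter> K)) / real (card K) = \<rho>) \<and>
        M = (\<Union>i\<in>{1..n - 1}.
           permute_word n (switching_perm i) ` ({x \<in> words n A. x 1 \<in> P i} \<inter> cylinder n A C)))"

definition alphabet_lifting_8_cycles :: "'a set \<Rightarrow> (nat \<Rightarrow> 'a) set \<Rightarrow> bool" where
  "alphabet_lifting_8_cycles A D \<longleftrightarrow>
     (\<exists>(B :: nat \<Rightarrow> 'a set) (C :: (nat \<Rightarrow> nat) set).
        B 0 \<union> B 1 = A \<and> B 0 \<inter> B 1 = {} \<and> card (B 0) = card (B 1) \<and>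
        C \<subseteq> words 4 {0, 1} \<and>
        induces_cycle (hamming_adj 4) C 8 \<and>
        induces_cycle (hamming_adj 4) (words 4 {0, 1} - C) 8 \<and>
        D = (\<Union>x\<in>C. (\<Pi>\<^sub>E i\<in>{1..4}. B (x i))))"

end

theory Submission
  imports Defs
begin

text \<open>
  The indicator function of a part, shifted by a constant \<open>\<rho>\<close>, is an eigenfunction for the second
  eigenvalue, so it is a sum of functions \<open>f i j (x i) (x j)\<close> all of whose row and column sums vanish.
  Replacing the letter \<open>a\<close> at coordinate \<open>i\<close> by \<open>b\<close> changes the indicator by a sum of univariate
  functions with mean zero, and this change lies in \<open>{-1, 0, 1}\<close>; hence it depends on at most two
  further coordinates. If it takes the value \<open>1\<close> or \<open>-1\<close>, then the indicator is constant on a subcube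
  fixing \<open>i\<close> and these coordinates, and a constant restriction kills every interaction between the free
  coordinates. If fixing two coordinates can make the indicator constant and \<open>n \<ge> 4\<close>, then all
  interactions share one coordinate, and the partition is a permutation switching. Otherwise every change
  depends on exactly two further coordinates, which is impossible for \<open>n \<ge> 5\<close> and leaves only the lifted
  8-cycles for \<open>n = 4\<close>.
\<close>

section \<open>Eigenfunctions for the second eigenvalue\<close>

text \<open>Adding \<open>n\<close> times the identity to the adjacency operator gives the sum of
  the commuting operators \<open>coord_sum\<close>, and the second eigenvalue turns into
  \<open>q * (n - 2)\<close>. Averaging over all but two coordinates then recovers each interaction,
  and no part of higher or lower degree is left over except the constant \<rho>. The analysis runs
  on total functions, where letters can be overwritten freely; extensional words enter through
  \<open>word_indicator\<close>. The obstacle in the converse is a class of the switching with a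
  single letter. Its only maximal clique is a row, so nothing is said about columns, and the
  switched set then fails to be equitable. The third alternative of the theorem therefore demands
  equitability, and the converse uses this to rule singleton classes out before it counts
  neighbours. In the exceptional case \<open>n = 4\<close> the four interactions form a cycle, and
  the sign pattern of their product form is exactly that of an 8-cycle in the binary 4-cube.\<close>

definition coord_sum :: "'a set \<Rightarrow> 'i \<Rightarrow> (('i \<Rightarrow> 'a) \<Rightarrow> real) \<Rightarrow> ('i \<Rightarrow> 'a) \<Rightarrow> real" where
  "coord_sum A i f x = (\<Sum>a\<in>A. f (x(i := a)))"

text \<open>Folding over a set is legitimate because coordinate sums commute
  (\<open>coord_sum_commute\<close>).\<close>

definition coord_sums :: "'a set \<Rightarrow> 'i set \<Rightarrow> (('i \<Rightarrow> 'a) \<Rightarrow> real) \<Rightarrow> ('i \<Rightarrow> 'a) \<Rightarrow> real" where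
  "coord_sums A S f = Finite_Set.fold (coord_sum A) f S"

text \<open>Values outside \<open>I\<close> are left free, unlike in \<open>words\<close>, so any
  coordinate can be overwritten by a letter without leaving the domain.\<close>

definition cube :: "'i set \<Rightarrow> 'a set \<Rightarrow> ('i \<Rightarrow> 'a) set" where
  "cube I A = {x. \<forall>i\<in>I. x i \<in> A}"

section \<open>Algebra of coordinate sums\<close>

lemma cube_upd: "x \<in> cube I A \<Longrightarrow> a \<in> A \<Longrightarrow> x(i := a) \<in> cube I A"
  by (auto simp: cube_def)

lemma coord_sum_commute: "coord_sum A i (coord_sum A j f) = coord_sum A j (coord_sum A i f)"
proof (cases "i = j")
  case False
  then show ?thesis
    unfolding coord_sum_def
    by (intro ext, subst sum.swap) (simp add: fun_upd_twist)
qed simp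

lemma coord_sum_twice: "coord_sum A i (coord_sum A i f) = (\<lambda>x. real (card A) * coord_sum A i f x)"
  by (simp add: coord_sum_def fun_eq_iff)

lemma coord_sum_scale: "coord_sum A i (\<lambda>x. c * f x) = (\<lambda>x. c * coord_sum A i f x)"
  by (intro ext) (simp add: coord_sum_def sum_distrib_left)

lemma coord_sum_diff: "coord_sum A i (\<lambda>x. f x - g x) = (\<lambda>x. coord_sum A i f x - coord_sum A i g x)"
  by (intro ext) (simp add: coord_sum_def sum_subtractf)

lemma coord_sum_sum: "coord_sum A i (\<lambda>x. \<Sum>k\<in>K. f k x) = (\<lambda>x. \<Sum>k\<in>K. coord_sum A i (f k) x)"
  unfolding coord_sum_def by (intro ext sum.swap)

lemma coord_sums_empty [simp]: "coord_sums A {} f = f"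
  by (simp add: coord_sums_def)

lemma coord_sums_insert:
  assumes "finite S" "i \<notin> S"
  shows "coord_sums A (insert i S) f = coord_sum A i (coord_sums A S f)"
proof -
  interpret comp_fun_commute "coord_sum A"
    by standard (simp add: fun_eq_iff coord_sum_commute)
  show ?thesis using assms by (simp add: coord_sums_def)
qed

lemma coord_sums_coord_sum:
  "finite S \<Longrightarrow> coord_sums A S (coord_sum A i f) = coord_sum A i (coord_sums A S f)"
  by (induction S rule: finite_induct) (simp_all add: coord_sums_insert coord_sum_commute)

lemma coord_sums_coord_sum_mem:
  assumes "finite S" "i \<in> S"
  shows "coord_sums A S (coord_sum A i f) = (\<lambda>x. real (card A) * coord_sums A S f x)"
proof -
  obtain T where "S = insert i T" "i \<notin> T" using assms(2) by (meson mk_disjoint_insert)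
  then show ?thesis
    using assms(1) by (simp add: coord_sums_coord_sum coord_sums_insert coord_sum_twice)
qed

lemma coord_sums_scale:
  "finite S \<Longrightarrow> coord_sums A S (\<lambda>x. c * f x) = (\<lambda>x. c * coord_sums A S f x)"
  by (induction S rule: finite_induct) (simp_all add: coord_sums_insert coord_sum_scale)

lemma coord_sums_diff:
  "finite S \<Longrightarrow> coord_sums A S (\<lambda>x. f x - g x) = (\<lambda>x. coord_sums A S f x - coord_sums A S g x)"
  by (induction S rule: finite_induct) (simp_all add: coord_sums_insert coord_sum_diff)

lemma coord_sums_sum:
  "finite S \<Longrightarrow> coord_sums A S (\<lambda>x. \<Sum>k\<in>K. f k x) = (\<lambda>x. \<Sum>k\<in>K. coord_sums A S (f k) x)"
  by (induction S rule: finite_induct) (simp_all add: coord_sums_insert coord_sum_sum)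

text \<open>Summation only inserts letters of \<open>A\<close>, so agreement on the cube is enough;
  the eigenvalue equation is known only there.\<close>

lemma coord_sums_cong_cube:
  assumes "finite S" "\<And>x. x \<in> cube I A \<Longrightarrow> f x = g x" "x \<in> cube I A"
  shows "coord_sums A S f x = coord_sums A S g x"
  using assms(1,3)
proof (induction S arbitrary: x rule: finite_induct)
  case empty
  then show ?case using assms(2) by simp
next
  case (insert i S)
  have "coord_sums A S f (x(i := a)) = coord_sums A S g (x(i := a))" if "a \<in> A" for a
    using insert.prems that by (intro insert.IH cube_upd)
  then show ?case
    by (simp only: coord_sums_insert[OF insert.hyps(1,2)] coord_sum_def cong: sum.cong)
qed

text \<open>Coordinates that have been summed out no longer matter, so summing over all but two
  coordinates leaves a function of two letters.\<close>

lemma coord_sums_depends: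
  assumes "finite S" "\<And>x y. (\<And>i. i \<in> I \<Longrightarrow> x i = y i) \<Longrightarrow> f x = f y"
    and "\<And>i. i \<in> I - S \<Longrightarrow> x i = y i"
  shows "coord_sums A S f x = coord_sums A S f y"
  using assms(1,3)
proof (induction S arbitrary: x y rule: finite_induct)
  case empty
  then have "f x = f y" by (intro assms(2)) auto
  then show ?case by simp
next
  case (insert i S)
  have "coord_sums A S f (x(i := a)) = coord_sums A S f (y(i := a))" for a
    by (rule insert.IH) (use insert.prems in auto)
  then show ?case
    by (simp only: coord_sums_insert[OF insert.hyps(1,2)] coord_sum_def)
qed

text \<open>The sum of all coordinate sums is the adjacency operator plus \<open>n\<close> times the
  identity, and \<open>(q - 1) * n - 2 * q + n = q * (n - 2)\<close>.\<close>

definition second_eigenfunction :: "'i set \<Rightarrow> 'a set \<Rightarrow> (('i \<Rightarrow> 'a) \<Rightarrow> real) \<Rightarrow> bool" where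
  "second_eigenfunction I A f \<longleftrightarrow>
     (\<forall>x\<in>cube I A. (\<Sum>i\<in>I. coord_sum A i f x) = real (card A) * (real (card I) - 2) * f x)"

text \<open>
  Summing the eigenvalue equation over the coordinates in \<open>S\<close> gives
  \<open>(card I - 2 - card S) * coord_sums A S f = 0\<close> once all larger coordinate sums vanish.
\<close>

lemma second_eigenfunction_coord_sums_eq_0:
  assumes fin: "finite I" "finite A" "A \<noteq> {}" and eig: "second_eigenfunction I A f"
    and S: "S \<subseteq> I"
    and base: "\<And>T y. \<lbrakk>card S + 2 \<le> card I; T \<subseteq> I; card T + 2 = card I; y \<in> cube I A\<rbrakk>
                \<Longrightarrow> coord_sums A T f y = 0"
    and x: "x \<in> cube I A"
  shows "coord_sums A S f x = 0"
  using S base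
proof (induction "card (I - S)" arbitrary: S rule: less_induct)
  case less
  have finS: "finite S" using less.prems(1) fin(1) by (rule finite_subset)
  have cardI: "card I = card S + card (I - S)"
    using card_Diff_subset[OF finS less.prems(1)] card_mono[OF fin(1) less.prems(1)] by simp
  show ?case
  proof (cases "card S + 2 = card I")
    case True
    \<comment> \<open>At \<open>card S = card I - 2\<close> the factor vanishes and the equation
      says nothing, hence the assumption \<open>base\<close>. Its guard makes it vacuous for
      \<open>S = I - {i}\<close>.\<close>
    then show ?thesis using less.prems x by simp
  next
    case False
    have up: "coord_sums A (insert i S) f x = 0" if i: "i \<in> I - S" for i
    proof (rule less.hyps)
      show "card (I - insert i S) < card (I - S)"
        using i fin(1) by (intro psubset_card_mono) auto
      show "insert i S \<subseteq> I" using i less.prems(1) by auto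
      show "coord_sums A T f y = 0"
        if "card (insert i S) + 2 \<le> card I" "T \<subseteq> I" "card T + 2 = card I" "y \<in> cube I A" for T y
        using that i finS by (intro less.prems(2)) auto
    qed
    have "(\<Sum>i\<in>I. coord_sums A S (coord_sum A i f) x)
        = (\<Sum>i\<in>S. coord_sums A S (coord_sum A i f) x)
          + (\<Sum>i\<in>I - S. coord_sums A S (coord_sum A i f) x)"
      using fin(1) less.prems(1) by (metis add.commute sum.subset_diff)
    also have "(\<Sum>i\<in>I - S. coord_sums A S (coord_sum A i f) x) = 0"
      using up finS by (intro sum.neutral) (auto simp: coord_sums_coord_sum coord_sums_insert)
    also have "(\<Sum>i\<in>S. coord_sums A S (coord_sum A i f) x)
        = real (card S) * (real (card A) * coord_sums A S f x)"
      using finS by (simp add: coord_sums_coord_sum_mem)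
    finally have 1: "(\<Sum>i\<in>I. coord_sums A S (coord_sum A i f) x)
        = real (card S) * (real (card A) * coord_sums A S f x)" by simp
    have "(\<Sum>i\<in>I. coord_sums A S (coord_sum A i f) x)
        = coord_sums A S (\<lambda>x. real (card A) * (real (card I) - 2) * f x) x"
      unfolding coord_sums_sum[OF finS, symmetric, THEN fun_cong]
      using eig x by (intro coord_sums_cong_cube[OF finS]) (auto simp: second_eigenfunction_def)
    also have "\<dots> = real (card A) * (real (card I) - 2) * coord_sums A S f x"
      by (simp add: coord_sums_scale finS)
    finally have "real (card A) * (real (card I) - 2 - real (card S)) * coord_sums A S f x = 0"
      using 1 by (simp add: algebra_simps)
    moreover have "real (card I) - 2 - real (card S) \<noteq> 0" using False by linarith
    moreover have "real (card A) \<noteq> 0" using fin by simp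
    ultimately show ?thesis by simp
  qed
qed

text \<open>\<open>p i j\<close> averages \<open>f\<close> over the other coordinates. Its margins
  are sums over all but one coordinate and so vanish. What remains after subtracting all
  interactions is again an eigenfunction, but now its sums over all but two coordinates vanish as
  well, and the preceding lemma with the empty set makes it zero.\<close>

lemma second_eigenfunction_decomposition:
  fixes I :: "'i set" and A :: "'a set"
  assumes fin: "finite I" "finite A" "A \<noteq> {}" and eig: "second_eigenfunction I A f"
    and dep: "\<And>x y. (\<And>i. i \<in> I \<Longrightarrow> x i = y i) \<Longrightarrow> f x = f y"
  obtains p :: "'i \<Rightarrow> 'i \<Rightarrow> 'a \<Rightarrow> 'a \<Rightarrow> real"
  where "\<And>i j s t. p i j s t = p j i t s" and "\<And>i s t. p i i s t = 0"
    and "\<And>i j s. i \<in> I \<Longrightarrow> j \<in> I \<Longrightarrow> s \<in> A \<Longrightarrow> (\<Sum>t\<in>A. p i j s t) = 0"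
    and "\<And>x. x \<in> cube I A \<Longrightarrow> f x = (\<Sum>i\<in>I. \<Sum>j\<in>I. p i j (x i) (x j)) / 2"
proof -
  define q where "q = real (card A)"
  have q: "q > 0" using fin by (simp add: q_def card_gt_0_iff)
  \<comment> \<open>\<open>undefined\<close> fills coordinates that are summed out anyway; the
    divisor counts the assignments to those \<open>card I - 2\<close> coordinates.\<close>
  define p where "p i j s t = (if i = j \<or> i \<notin> I \<or> j \<notin> I then 0
      else coord_sums A (I - {i, j}) f ((\<lambda>_. undefined)(i := s, j := t)) / q ^ (card I - 2))" for i j s t
  have p_sym: "p i j s t = p j i t s" for i j s t
    unfolding p_def by (simp add: insert_commute fun_upd_twist)
  have p_refl: "p i i s t = 0" for i s t by (simp add: p_def)
  have p_eq: "p i j (x i) (x j) = coord_sums A (I - {i, j}) f x / q ^ (card I - 2)"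
    if "i \<in> I" "j \<in> I" "i \<noteq> j" for i j x
  proof -
    have "coord_sums A (I - {i, j}) f ((\<lambda>_. undefined)(i := x i, j := x j))
        = coord_sums A (I - {i, j}) f x"
      using that fin by (intro coord_sums_depends[where I = I] dep) auto
    then show ?thesis using that by (simp add: p_def)
  qed
  have p_zero: "(\<Sum>t\<in>A. p i j s t) = 0" if ij: "i \<in> I" "j \<in> I" and s: "s \<in> A" for i j s
  proof (cases "i = j")
    case False
    define x :: "'i \<Rightarrow> 'a" where "x = (\<lambda>_. s)"
    have x: "x \<in> cube I A" using s by (simp add: x_def cube_def)
    have "p i j s t = coord_sums A (I - {i, j}) f (x(j := t)) / q ^ (card I - 2)" for t
      using p_eq[OF ij False, of "x(j := t)"] False by (simp add: x_def)
    then have "(\<Sum>t\<in>A. p i j s t) = coord_sum A j (coord_sums A (I - {i, j}) f) x / q ^ (card I - 2)"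
      by (simp add: coord_sum_def sum_divide_distrib)
    also have "coord_sum A j (coord_sums A (I - {i, j}) f) = coord_sums A (insert j (I - {i, j})) f"
      using fin by (intro coord_sums_insert[symmetric]) auto
    also have "insert j (I - {i, j}) = I - {i}" using ij False by auto
    also have "coord_sums A (I - {i}) f x = 0"
      using ij fin by (intro second_eigenfunction_coord_sums_eq_0[OF fin eig _ _ x]) auto
    finally show ?thesis by simp
  qed (simp add: p_refl)
  define h where "h i j x = p i j (x i) (x j)" for i j x
  have h_sum: "coord_sum A k (h i j) x = (if k = i \<or> k = j then 0 else q * h i j x)"
    if "i \<in> I" "j \<in> I" "x \<in> cube I A" for i j k x
  proof (cases "i = j")
    case True
    then show ?thesis by (simp add: h_def p_refl coord_sum_def)
  next
    case False
    have "x i \<in> A" "x j \<in> A" using that by (auto simp: cube_def)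
    then show ?thesis
      using False p_zero[of i j "x i"] p_zero[of j i "x j"] that
      by (auto simp: h_def coord_sum_def q_def p_sym[of i j])
  qed
  \<comment> \<open>The half compensates for counting each unordered pair twice.\<close>
  define g where "g x = f x - (1/2) * (\<Sum>i\<in>I. \<Sum>j\<in>I. h i j x)" for x
  have eig_h: "(\<Sum>k\<in>I. coord_sum A k (h i j) x) = q * (real (card I) - 2) * h i j x"
    if "i \<in> I" "j \<in> I" "x \<in> cube I A" for i j x
  proof (cases "i = j")
    case True
    then show ?thesis by (simp add: h_def p_refl coord_sum_def)
  next
    case False
    have "(\<Sum>k\<in>I. coord_sum A k (h i j) x) = (\<Sum>k\<in>I. if k = i \<or> k = j then 0 else q * h i j x)"
      using that by (simp add: h_sum)
    also have "\<dots> = (\<Sum>k\<in>I - {i, j}. q * h i j x)"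
      using fin by (intro sum.mono_neutral_cong_right) auto
    also have "\<dots> = (real (card I) - 2) * (q * h i j x)"
    proof -
      have "card {i, j} = 2" using False by simp
      moreover have "card {i, j} \<le> card I" using that fin by (intro card_mono) auto
      ultimately have "real (card (I - {i, j})) = real (card I) - 2"
        using that fin by (subst card_Diff_subset) auto
      then show ?thesis by simp
    qed
    finally show ?thesis by simp
  qed
  have eig_g: "second_eigenfunction I A g"
    unfolding second_eigenfunction_def
  proof
    fix x assume x: "x \<in> cube I A"
    have "(\<Sum>k\<in>I. coord_sum A k g x) = (\<Sum>k\<in>I. coord_sum A k f x)
        - (1/2) * (\<Sum>k\<in>I. \<Sum>i\<in>I. \<Sum>j\<in>I. coord_sum A k (h i j) x)"
      unfolding g_def coord_sum_diff coord_sum_scale coord_sum_sum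
      by (simp add: sum_subtractf sum_distrib_left)
    also have "(\<Sum>k\<in>I. \<Sum>i\<in>I. \<Sum>j\<in>I. coord_sum A k (h i j) x)
        = (\<Sum>i\<in>I. \<Sum>j\<in>I. \<Sum>k\<in>I. coord_sum A k (h i j) x)"
      by (subst sum.swap) (intro sum.cong refl sum.swap)
    also have "\<dots> = q * (real (card I) - 2) * (\<Sum>i\<in>I. \<Sum>j\<in>I. h i j x)"
      using x by (simp add: eig_h sum_distrib_left)
    also have "(\<Sum>k\<in>I. coord_sum A k f x) = q * (real (card I) - 2) * f x"
      using eig x by (simp add: second_eigenfunction_def q_def)
    also have "q * (real (card I) - 2) * f x - 1 / 2 * (q * (real (card I) - 2) *
        (\<Sum>i\<in>I. \<Sum>j\<in>I. h i j x)) = real (card A) * (real (card I) - 2) * g x"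
      by (simp add: g_def q_def algebra_simps)
    finally show "(\<Sum>i\<in>I. coord_sum A i g x) = real (card A) * (real (card I) - 2) * g x" .
  qed
  \<comment> \<open>An interaction is annihilated as soon as one of its own coordinates is summed,
    and multiplied by \<open>q\<close> by every other coordinate.\<close>
  have cs_h: "coord_sums A S (h i j) x = (if i \<in> S \<or> j \<in> S then 0 else q ^ card S * h i j x)"
    if ij: "i \<in> I" "j \<in> I" and x: "x \<in> cube I A" and S: "finite S" for i j x S
    using S x
  proof (induction S arbitrary: x rule: finite_induct)
    case (insert k S)
    have "coord_sum A k (coord_sums A S (h i j)) x
        = (\<Sum>a\<in>A. if i \<in> S \<or> j \<in> S then 0 else q ^ card S * h i j (x(k := a)))"
      unfolding coord_sum_def
    proof (rule sum.cong)
      fix a assume "a \<in> A"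
      then have "x(k := a) \<in> cube I A" using insert.prems by (simp add: cube_upd)
      then show "coord_sums A S (h i j) (x(k := a))
          = (if i \<in> S \<or> j \<in> S then 0 else q ^ card S * h i j (x(k := a)))"
        by (rule insert.IH)
    qed simp
    also have "\<dots> = (if i \<in> S \<or> j \<in> S then 0 else q ^ card S * coord_sum A k (h i j) x)"
      by (simp add: coord_sum_def sum_distrib_left)
    finally show ?case using insert ij by (auto simp: coord_sums_insert h_sum)
  qed simp
  have g0: "g x = 0" if x: "x \<in> cube I A" for x
  proof -
    have base: "coord_sums A T g y = 0"
      if T: "T \<subseteq> I" "card T + 2 = card I" and y: "y \<in> cube I A" for T y
    proof -
      have finT: "finite T" using T fin by (auto intro: finite_subset)
      have "card (I - T) = 2" using T finT by (simp add: card_Diff_subset)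
      then obtain k l where kl: "I - T = {k, l}" "k \<noteq> l" by (auto simp: card_2_iff)
      have klI: "k \<in> I" "l \<in> I" "k \<notin> T" "l \<notin> T" using kl by auto
      have Teq: "T = I - {k, l}" using kl T by auto
      have cs0: "coord_sums A T (h i j) y = 0" if "i \<in> I" "j \<in> I" "i \<notin> {k, l} \<or> j \<notin> {k, l}" for i j
        using that by (subst cs_h[OF that(1,2) y finT]) (auto simp: Teq)
      have "coord_sums A T g y = coord_sums A T f y
          - (1/2) * (\<Sum>i\<in>I. \<Sum>j\<in>I. coord_sums A T (h i j) y)"
        unfolding g_def coord_sums_diff[OF finT] coord_sums_scale[OF finT] coord_sums_sum[OF finT] ..
      also have "(\<Sum>i\<in>I. \<Sum>j\<in>I. coord_sums A T (h i j) y)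
          = (\<Sum>i\<in>{k, l}. \<Sum>j\<in>I. coord_sums A T (h i j) y)"
        using fin(1) klI cs0 by (intro sum.mono_neutral_right) auto
      also have "\<dots> = (\<Sum>i\<in>{k, l}. \<Sum>j\<in>{k, l}. coord_sums A T (h i j) y)"
        using fin(1) klI cs0 by (intro sum.cong refl sum.mono_neutral_right) auto
      \<comment> \<open>Only the ordered pairs \<open>(k, l)\<close> and \<open>(l, k)\<close>
        survive. The factor 2 cancels the half in \<open>g\<close>, and \<open>q ^ card T\<close>
        the normalization of \<open>p\<close>.\<close>
      also have "\<dots> = 2 * (q ^ card T * h k l y)"
        using kl y finT klI p_sym[of l k]
        by (simp add: cs_h) (simp add: h_def p_refl)
      also have "h k l y = coord_sums A T f y / q ^ card T"
        using p_eq[OF klI(1,2) kl(2)] T Teq by (simp add: h_def flip: T(2))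
      finally show ?thesis using q by simp
    qed
    show ?thesis
      using second_eigenfunction_coord_sums_eq_0[OF fin eig_g _ base x, of "{}"] by simp
  qed
  show ?thesis
    using that[of p] p_sym p_refl p_zero g0 by (auto simp: g_def h_def)
qed

section \<open>Boolean functions of degree two\<close>

text \<open>Indicator minus density. For \<open>U \<subseteq> A\<close> with \<open>A\<close> finite
  and nonempty it has zero sum over \<open>A\<close>; it is the shape forced on a zero-sum function
  with two values at distance 1.\<close>

definition centered :: "'a set \<Rightarrow> 'a set \<Rightarrow> 'a \<Rightarrow> real" where
  "centered A U t = of_bool (t \<in> U) - real (card U) / real (card A)"

section \<open>Zero-sum functions on the alphabet\<close>

lemma zero_sum_const:
  fixes c :: real
  assumes "finite A" "A \<noteq> {}" "\<And>t. t \<in> A \<Longrightarrow> g t = c" "sum g A = 0"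
  shows "c = 0"
  using assms by simp

lemma zero_sum_signs:
  fixes g :: "'a \<Rightarrow> real"
  assumes "finite A" "sum g A = 0" "t \<in> A" "g t \<noteq> 0"
  obtains s s' where "s \<in> A" "g s > 0" "s' \<in> A" "g s' < 0"
proof -
  have "\<exists>s\<in>A. g s > 0"
  proof (rule ccontr)
    assume "\<not> ?thesis"
    then have "\<And>s. s \<in> A \<Longrightarrow> g s \<le> 0" by force
    then show False using sum_nonneg_eq_0_iff[of A "\<lambda>s. - g s"] assms by (auto simp: sum_negf)
  qed
  moreover have "\<exists>s\<in>A. g s < 0"
  proof (rule ccontr)
    assume "\<not> ?thesis"
    then have "\<And>s. s \<in> A \<Longrightarrow> g s \<ge> 0" by force
    then show False using sum_nonneg_eq_0_iff[of A g] assms by auto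
  qed
  ultimately show thesis using that by blast
qed

lemma two_valued_centered:
  assumes A: "finite A" "A \<noteq> {}" and zero: "sum g A = 0"
    and vals: "\<And>t. t \<in> A \<Longrightarrow> g t = m \<or> g t = m + 1"
  shows "\<forall>t\<in>A. g t = centered A {t \<in> A. g t = m + 1} t" "m = - real (card {t \<in> A. g t = m + 1}) / real (card A)"
proof -
  let ?U = "{t \<in> A. g t = m + 1}"
  have g: "g t = of_bool (t \<in> ?U) + m" if "t \<in> A" for t
    using vals[OF that] that by auto
  have "0 = (\<Sum>t\<in>A. of_bool (t \<in> ?U) + m)" using g zero by simp
  also have "\<dots> = real (card ?U) + real (card A) * m"
    using A by (simp add: sum.distrib Int_def)
  finally show m: "m = - real (card ?U) / real (card A)"
    using A by (simp add: field_simps)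
  show "\<forall>t\<in>A. g t = centered A ?U t"
  proof
    fix t assume "t \<in> A"
    then show "g t = centered A ?U t" using g[OF \<open>t \<in> A\<close>] m by (simp add: centered_def)
  qed
qed

text \<open>
  Each nonconstant summand has spread at least \<open>1\<close>, while the spread of the sum, at most \<open>2\<close>, is the
  sum of the spreads.
\<close>

lemma bounded_univariate_sum_cases:
  fixes g :: "'i \<Rightarrow> 'a \<Rightarrow> real"
  assumes J: "finite J" and A: "finite A" "A \<noteq> {}"
    and zero: "\<And>j. j \<in> J \<Longrightarrow> sum (g j) A = 0"
    and vals: "\<And>x. x \<in> cube J A \<Longrightarrow> (\<Sum>j\<in>J. g j (x j)) \<in> {-1, 0, 1}"
  obtains (none) "\<forall>j\<in>J. \<forall>t\<in>A. g j t = 0"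
  | (one) j s t where "j \<in> J" "\<forall>k\<in>J - {j}. \<forall>t\<in>A. g k t = 0" "s \<in> A" "t \<in> A" "g j s = 1" "g j t = - 1"
  | (two) j k U V where "j \<in> J" "k \<in> J" "j \<noteq> k" "\<forall>l\<in>J - {j, k}. \<forall>t\<in>A. g l t = 0"
    "U \<subseteq> A" "V \<subseteq> A" "U \<noteq> {}" "V \<noteq> {}" "U \<noteq> A" "V \<noteq> A" "card U + card V = card A"
    "\<forall>t\<in>A. g j t = centered A U t" "\<forall>t\<in>A. g k t = centered A V t"
proof -
  define G where "G x = (\<Sum>j\<in>J. g j (x j))" for x
  have G_upd: "G (x(j := t)) = G x - g j (x j) + g j t" if "j \<in> J" for x j t
  proof -
    have "G (x(j := t)) = g j t + (\<Sum>k\<in>J - {j}. g k ((x(j := t)) k))"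
      unfolding G_def using that J by (simp add: sum.remove)
    also have "(\<Sum>k\<in>J - {j}. g k ((x(j := t)) k)) = (\<Sum>k\<in>J - {j}. g k (x k))"
      by (intro sum.cong) auto
    also have "G x = g j (x j) + (\<Sum>k\<in>J - {j}. g k (x k))"
      unfolding G_def using that J by (simp add: sum.remove)
    ultimately show ?thesis by linarith
  qed
  obtain a0 where a0: "a0 \<in> A" using A by auto
  define x0 :: "'i \<Rightarrow> 'a" where "x0 = (\<lambda>_. a0)"
  have x0: "x0 \<in> cube J A" using a0 by (simp add: x0_def cube_def)
  have G: "G x \<in> {-1, 0, 1}" if "x \<in> cube J A" for x
    using vals[OF that] by (simp add: G_def)
  \<comment> \<open>The gap is the difference of two values of the integer-valued \<open>G\<close>
    at points that differ in \<open>j\<close> only, so if positive it is at least 1.\<close>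
  have step: "g j s - g j t \<ge> 1" if "j \<in> J" "s \<in> A" "t \<in> A" "g j s > g j t" for j s t
    using G[of "x0(j := s)"] G[of "x0(j := t)"] that x0 G_upd[of j x0]
    by (auto simp: cube_upd)
  define N where "N = {j \<in> J. \<exists>t\<in>A. g j t \<noteq> 0}"
  have signs: "\<exists>s\<in>A. \<exists>s'\<in>A. g j s > 0 \<and> g j s' < 0" if "j \<in> N" for j
    using that zero[of j] A(1) zero_sum_signs[of A "g j"] unfolding N_def by blast
  \<comment> \<open>Moving three nonconstant summands from a negative to a positive value would
    raise \<open>G\<close> by at least 3, while its values span at most 2.\<close>
  have three: False if N: "j \<in> N" "k \<in> N" "l \<in> N" "j \<noteq> k" "j \<noteq> l" "k \<noteq> l" for j k l
  proof -
    obtain s s' where s: "s \<in> A" "s' \<in> A" "g j s > 0" "g j s' < 0" using signs[OF N(1)] by auto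
    obtain t t' where t: "t \<in> A" "t' \<in> A" "g k t > 0" "g k t' < 0" using signs[OF N(2)] by auto
    obtain u u' where u: "u \<in> A" "u' \<in> A" "g l u > 0" "g l u' < 0" using signs[OF N(3)] by auto
    have jkl: "j \<in> J" "k \<in> J" "l \<in> J" using N by (auto simp: N_def)
    have "G (x0(j := s, k := t, l := u)) \<in> {-1, 0, 1}"
      using s t u x0 by (intro G cube_upd)
    moreover have "G (x0(j := s', k := t', l := u')) \<in> {-1, 0, 1}"
      using s t u x0 by (intro G cube_upd)
    ultimately show False
      using step[of j s s'] step[of k t t'] step[of l u u'] s t u jkl N
      by (auto simp: G_upd)
  qed
  consider "N = {}" | j where "N = {j}" | j k where "j \<in> N" "k \<in> N" "j \<noteq> k"
    by blast
  then show thesis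
  proof cases
    case 1
    then show thesis by (intro none) (auto simp: N_def)
  next
    case (2 j)
    then have j: "j \<in> J" and others: "\<forall>k\<in>J - {j}. \<forall>t\<in>A. g k t = 0" by (auto simp: N_def)
    have "G (x0(j := s)) = g j s" if "s \<in> A" for s
      unfolding G_def sum.remove[OF J j] using others x0
      by (subst sum.neutral) (auto simp: cube_def)
    then have "g j s \<in> {-1, 0, 1}" if "s \<in> A" for s
      using G[of "x0(j := s)"] x0 that by (auto simp: cube_upd)
    moreover obtain s s' where "s \<in> A" "s' \<in> A" "g j s > 0" "g j s' < 0" using signs[of j] 2 by auto
    \<comment> \<open>A positive and a negative value in \<open>{-1, 0, 1}\<close> can only be 1 and
      -1.\<close>
    ultimately show thesis using j others by (intro one[of j s s']) force+
  next
    case (3 j k)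
    then have jk: "j \<in> J" "k \<in> J" and others: "\<forall>l\<in>J - {j, k}. \<forall>t\<in>A. g l t = 0"
      using three by (auto simp: N_def)
    have Gjk: "g j s + g k t \<in> {-1, 0, 1}" if "s \<in> A" "t \<in> A" for s t
    proof -
      have "G (x0(j := s, k := t)) = g j s + g k t"
        unfolding G_def sum.remove[OF J jk(1)] using others x0 3 jk J
        by (subst sum.remove[of _ k]) (auto simp: cube_def intro!: sum.neutral)
      then show ?thesis using G[of "x0(j := s, k := t)"] that x0 by (simp add: cube_upd)
    qed
    obtain s s' where s: "s \<in> A" "s' \<in> A" "g j s > 0" "g j s' < 0" using signs[OF 3(1)] by auto
    obtain t t' where t: "t \<in> A" "t' \<in> A" "g k t > 0" "g k t' < 0" using signs[OF 3(2)] by auto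
    \<comment> \<open>Two gaps of at least 1 share a total of at most 2, so both equal 1 and the sum
      runs from -1 to 1.\<close>
    have sum1: "g j s + g k t = 1" "g j s' + g k t' = - 1" "g j s = g j s' + 1" "g k t = g k t' + 1"
      using Gjk[of s t] Gjk[of s' t'] step[of j s s'] step[of k t t'] s t jk by auto
    have vj: "g j u = g j s' \<or> g j u = g j s' + 1" if "u \<in> A" for u
      using step[of j u s'] step[of j s' u] step[of j u s] step[of j s u] Gjk[OF that t(1)]
        Gjk[OF that t(2)] s t jk that sum1 by (auto simp: linorder_neq_iff)
    have vk: "g k u = g k t' \<or> g k u = g k t' + 1" if "u \<in> A" for u
      using step[of k u t'] step[of k t' u] step[of k u t] step[of k t u] Gjk[OF s(1) that]
        Gjk[OF s(2) that] s t jk that sum1 by (auto simp: linorder_neq_iff)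
    define U where "U = {u \<in> A. g j u = g j s' + 1}"
    define V where "V = {u \<in> A. g k u = g k t' + 1}"
    have U: "\<forall>u\<in>A. g j u = centered A U u" "g j s' = - real (card U) / real (card A)"
      unfolding U_def using two_valued_centered[OF A zero[OF jk(1)] vj] by simp_all
    have V: "\<forall>u\<in>A. g k u = centered A V u" "g k t' = - real (card V) / real (card A)"
      unfolding V_def using two_valued_centered[OF A zero[OF jk(2)] vk] by simp_all
    \<comment> \<open>The two offsets add up to the minimum -1 of the sum; this is the origin of
      \<open>card U + card V = card A\<close>.\<close>
    have "real (card U) / real (card A) + real (card V) / real (card A) = 1"
      using sum1 U(2) V(2) by simp
    then have "real (card U) + real (card V) = real (card A)"
      using A by (simp add: field_simps)
    then have "card U + card V = card A" by linarith
    moreover have "U \<subseteq> A" "V \<subseteq> A" "s \<in> U" "t \<in> V" "s' \<notin> U" "t' \<notin> V"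
      using s t sum1 by (auto simp: U_def V_def)
    ultimately show thesis
      using two[of j k U V] jk 3 others U(1) V(1) s t by blast
  qed
qed

text \<open>\<open>F\<close> stands for the indicator of a part, \<rho> for its constant term and
  \<open>f i j\<close> for the interaction of two coordinates, stored in both orders and therefore
  halved in \<open>F_eq\<close>. The assumption \<open>ess\<close> is what remains of
  reducedness.\<close>

locale boolean_degree_two =
  fixes I :: "'i set" and A :: "'a set" and f :: "'i \<Rightarrow> 'i \<Rightarrow> 'a \<Rightarrow> 'a \<Rightarrow> real"
    and \<rho> :: real and F :: "('i \<Rightarrow> 'a) \<Rightarrow> real"
  assumes finI: "finite I" and finA: "finite A" and A_ne: "A \<noteq> {}"
    and sym: "f i j s t = f j i t s" and diag: "f i i s t = 0"
    and zero: "i \<in> I \<Longrightarrow> j \<in> I \<Longrightarrow> s \<in> A \<Longrightarrow> (\<Sum>t\<in>A. f i j s t) = 0"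
    and F_eq: "x \<in> cube I A \<Longrightarrow> F x = \<rho> + (\<Sum>i\<in>I. \<Sum>j\<in>I. f i j (x i) (x j)) / 2"
    and F01: "x \<in> cube I A \<Longrightarrow> F x \<in> {0, 1}"
    and ess: "i \<in> I \<Longrightarrow> \<exists>j\<in>I. \<exists>s\<in>A. \<exists>t\<in>A. f i j s t \<noteq> 0"
begin

section \<open>Interactions and subcubes on which the function is constant\<close>

lemma zero': "i \<in> I \<Longrightarrow> j \<in> I \<Longrightarrow> t \<in> A \<Longrightarrow> (\<Sum>s\<in>A. f i j s t) = 0"
  by (subst sym) (rule zero)

text \<open>Symmetry merges the row and the column of \<open>i\<close>, which removes the half from
  the terms that involve \<open>i\<close>.\<close>

lemma quadratic_form_insert:
  assumes "finite J" "i \<notin> J"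
  shows "(\<Sum>k\<in>insert i J. \<Sum>l\<in>insert i J. f k l (x k) (x l)) / 2
    = (\<Sum>j\<in>J. f i j (x i) (x j)) + (\<Sum>k\<in>J. \<Sum>l\<in>J. f k l (x k) (x l)) / 2"
proof -
  have "(\<Sum>k\<in>J. f k i (x k) (x i)) = (\<Sum>j\<in>J. f i j (x i) (x j))"
    by (intro sum.cong refl sym)
  then show ?thesis
    using assms by (simp add: sum.distrib diag add_divide_distrib)
qed

lemma F_expand:
  assumes "x \<in> cube I A" "i \<in> I"
  shows "F x = \<rho> + (\<Sum>j\<in>I - {i}. f i j (x i) (x j))
    + (\<Sum>k\<in>I - {i}. \<Sum>l\<in>I - {i}. f k l (x k) (x l)) / 2"
  using quadratic_form_insert[of "I - {i}" i x] assms finI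
  by (simp add: F_eq insert_absorb)

text \<open>Interactions among the other coordinates cancel. A letter change is thus a sum of
  univariate functions, the form required by \<open>bounded_univariate_sum_cases\<close>.\<close>

lemma F_diff:
  assumes x: "x \<in> cube I A" and i: "i \<in> I" and ab: "a \<in> A" "b \<in> A"
  shows "F (x(i := a)) - F (x(i := b)) = (\<Sum>j\<in>I - {i}. f i j a (x j) - f i j b (x j))"
proof -
  have *: "F (x(i := a)) = \<rho> + (\<Sum>j\<in>I - {i}. f i j a (x j))
    + (\<Sum>k\<in>I - {i}. \<Sum>l\<in>I - {i}. f k l (x k) (x l)) / 2" if "a \<in> A" for a
    unfolding F_expand[OF cube_upd[OF x that] i]
    by (intro arg_cong2[of _ _ _ _ "(+)"] arg_cong2[of _ _ _ _ "(/)"] refl sum.cong) auto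
  show ?thesis using ab by (simp add: * sum_subtractf)
qed

text \<open>Non-adjacency in the interaction graph on \<open>I\<close>.\<close>

definition flat :: "'i \<Rightarrow> 'i \<Rightarrow> bool" where
  "flat i j \<longleftrightarrow> (\<forall>s\<in>A. \<forall>t\<in>A. f i j s t = 0)"

lemma flat_sym: "flat i j \<Longrightarrow> flat j i"
  unfolding flat_def using sym by metis

lemma flat_refl: "flat i i"
  by (simp add: flat_def diag)

lemma flat_if_const:
  assumes "i \<in> I" "j \<in> I" "\<And>s s' t. s \<in> A \<Longrightarrow> s' \<in> A \<Longrightarrow> t \<in> A \<Longrightarrow> f i j s t = f i j s' t"
  shows "flat i j"
  unfolding flat_def
proof (intro ballI)
  fix s t assume "s \<in> A" "t \<in> A"
  then show "f i j s t = 0"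
    using zero_sum_const[OF finA A_ne, of "\<lambda>s'. f i j s' t" "f i j s t"] assms zero'[of i j t] by blast
qed

text \<open>In the language of Boolean functions, the letters of \<open>x\<close> on
  \<open>Z\<close> are a certificate for the value \<open>F x\<close>.\<close>

definition fixes_F :: "'i set \<Rightarrow> ('i \<Rightarrow> 'a) \<Rightarrow> bool" where
  "fixes_F Z x \<longleftrightarrow> x \<in> cube I A \<and> (\<forall>y\<in>cube I A. (\<forall>z\<in>Z. y z = x z) \<longrightarrow> F y = F x)"

lemma fixes_F_upd:
  assumes "fixes_F Z x" "k \<notin> Z" "s \<in> A"
  shows "F (x(k := s)) = F x"
proof -
  have "x(k := s) \<in> cube I A" "\<forall>z\<in>Z. (x(k := s)) z = x z"
    using assms by (auto simp: fixes_F_def cube_upd)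
  then show ?thesis using assms(1) unfolding fixes_F_def by blast
qed

lemma fixes_F_upd2:
  assumes "fixes_F Z x" "k \<notin> Z" "l \<notin> Z" "s \<in> A" "t \<in> A"
  shows "F (x(k := s, l := t)) = F x"
proof -
  have "x(k := s, l := t) \<in> cube I A" "\<forall>z\<in>Z. (x(k := s, l := t)) z = x z"
    using assms by (auto simp: fixes_F_def cube_upd)
  then show ?thesis using assms(1) unfolding fixes_F_def by blast
qed

text \<open>The mixed second difference of \<open>F\<close> in two free directions is that of
  \<open>f k l\<close>. It vanishes on the subcube, and zero row and column sums then force
  \<open>f k l\<close> itself to vanish.\<close>

lemma fixes_F_flat:
  assumes Z: "Z \<subseteq> I" "fixes_F Z x" and kl: "k \<in> I - Z" "l \<in> I - Z"
  shows "flat k l"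
proof (cases "k = l")
  case False
  have x: "x \<in> cube I A" using Z by (simp add: fixes_F_def)
  have c: "f k l s t - f k l s' t = f k l s t' - f k l s' t'"
    if A: "s \<in> A" "s' \<in> A" "t \<in> A" "t' \<in> A" for s s' t t'
  proof -
    have D: "(\<Sum>j\<in>I - {k}. f k j s ((x(l := t)) j) - f k j s' ((x(l := t)) j)) = 0" if "t \<in> A" for t
    proof -
      have "F (x(l := t, k := s)) = F x" "F (x(l := t, k := s')) = F x"
        using fixes_F_upd2[OF Z(2)] kl A that by auto
      then show ?thesis using F_diff[of "x(l := t)" k s s'] that A kl x by (simp add: cube_upd)
    qed
    have E: "(\<Sum>j\<in>I - {k}. f k j s ((x(l := t)) j) - f k j s' ((x(l := t)) j))
        = f k l s t - f k l s' t + (\<Sum>j\<in>I - {k} - {l}. f k j s (x j) - f k j s' (x j))" for t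
    proof -
      have "(\<Sum>j\<in>I - {k} - {l}. f k j s ((x(l := t)) j) - f k j s' ((x(l := t)) j))
          = (\<Sum>j\<in>I - {k} - {l}. f k j s (x j) - f k j s' (x j))"
        by (intro sum.cong) auto
      then show ?thesis
        using finI kl False by (subst sum.remove[of _ l]) auto
    qed
    show ?thesis using D[OF A(3)] D[OF A(4)] unfolding E by simp
  qed
  show ?thesis
  proof (rule flat_if_const)
    show "k \<in> I" "l \<in> I" using kl by auto
    fix s s' t assume A: "s \<in> A" "s' \<in> A" "t \<in> A"
    have "(\<Sum>t\<in>A. f k l s t - f k l s' t) = 0"
      using zero A kl by (simp add: sum_subtractf)
    then have "f k l s t - f k l s' t = 0"
      using zero_sum_const[OF finA A_ne, of "\<lambda>u. f k l s u - f k l s' u" "f k l s t - f k l s' t"] c A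
      by blast
    then show "f k l s t = f k l s' t" by simp
  qed
qed (simp add: flat_refl)

text \<open>Free coordinates do not interact, so on the subcube \<open>F\<close> depends on the
  letter at \<open>k\<close> only through this sum. It is therefore constant in \<open>s\<close>,
  and its zero sum over \<open>s\<close> makes it 0.\<close>

lemma fixes_F_cancel:
  assumes Z: "Z \<subseteq> I" "fixes_F Z x" and k: "k \<in> I - Z" and s: "s \<in> A"
  shows "(\<Sum>z\<in>Z. f k z s (x z)) = 0"
proof -
  have x: "x \<in> cube I A" using Z by (simp add: fixes_F_def)
  have finZ: "finite Z" using Z finI by (auto intro: finite_subset)
  have c: "(\<Sum>z\<in>Z. f k z s (x z)) = (\<Sum>z\<in>Z. f k z s' (x z))" if A: "s' \<in> A" for s'
  proof -
    have "F (x(k := s)) = F x" "F (x(k := s')) = F x"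
      using fixes_F_upd[OF Z(2)] k A s by auto
    then have "(\<Sum>j\<in>I - {k}. f k j s (x j) - f k j s' (x j)) = 0"
      using F_diff[of x k s s'] x k s A by simp
    moreover have "(\<Sum>j\<in>I - {k}. f k j s (x j) - f k j s' (x j))
        = (\<Sum>j\<in>Z. f k j s (x j) - f k j s' (x j))"
      using finI Z(1) k s A x fixes_F_flat[OF Z k]
      by (intro sum.mono_neutral_right) (auto simp: flat_def cube_def)
    ultimately show ?thesis by (simp add: sum_subtractf)
  qed
  have "(\<Sum>s'\<in>A. \<Sum>z\<in>Z. f k z s' (x z)) = (\<Sum>z\<in>Z. \<Sum>s'\<in>A. f k z s' (x z))" by (rule sum.swap)
  also have "\<dots> = 0" using zero' Z(1) k x by (intro sum.neutral) (auto simp: cube_def)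
  finally show ?thesis
    using zero_sum_const[OF finA A_ne, of "\<lambda>s'. \<Sum>z\<in>Z. f k z s' (x z)"] c by metis
qed

text \<open>With the letters on \<open>Z\<close> held and no interaction among the free coordinates,
  \<open>F\<close> is a constant plus univariate functions, and two nonconstant ones cannot stay
  within \<open>{0, 1}\<close>. It applies to every choice of letters on \<open>Z\<close>, including
  those that leave \<open>F\<close> nonconstant.\<close>

lemma at_most_one_active:
  assumes Z: "Z \<subseteq> I" "x \<in> cube I A" and indep: "\<And>k l. k \<in> I - Z \<Longrightarrow> l \<in> I - Z \<Longrightarrow> flat k l"
    and kl: "k \<in> I - Z" "l \<in> I - Z" "k \<noteq> l"
  shows "(\<forall>t\<in>A. (\<Sum>z\<in>Z. f k z t (x z)) = 0) \<or> (\<forall>t\<in>A. (\<Sum>z\<in>Z. f l z t (x z)) = 0)"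
proof (rule ccontr)
  assume neg: "\<not> ?thesis"
  define h where "h k t = (\<Sum>z\<in>Z. f k z t (x z))" for k t
  have D: "F (y(m := s)) - F (y(m := s')) = h m s - h m s'"
    if "m \<in> I - Z" "s \<in> A" "s' \<in> A" "y \<in> cube I A" "\<forall>z\<in>Z. y z = x z" for m s s' y
  proof -
    have "F (y(m := s)) - F (y(m := s')) = (\<Sum>j\<in>I - {m}. f m j s (y j) - f m j s' (y j))"
      using that by (intro F_diff) auto
    also have "\<dots> = (\<Sum>j\<in>Z. f m j s (y j) - f m j s' (y j))"
      using finI Z(1) indep that by (intro sum.mono_neutral_right) (auto simp: flat_def cube_def)
    also have "\<dots> = h m s - h m s'" using that(5) by (simp add: h_def sum_subtractf)
    finally show ?thesis .
  qed
  have "sum (h m) A = 0" if "m \<in> I - Z" for m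
  proof -
    have "sum (h m) A = (\<Sum>z\<in>Z. \<Sum>t\<in>A. f m z t (x z))" unfolding h_def by (rule sum.swap)
    also have "\<dots> = 0" using zero' Z that by (intro sum.neutral) (auto simp: cube_def)
    finally show ?thesis .
  qed
  note sum_h = this
  obtain u where u: "u \<in> A" "h k u \<noteq> 0" using neg by (auto simp: h_def)
  obtain v where v: "v \<in> A" "h l v \<noteq> 0" using neg by (auto simp: h_def)
  obtain s s' where s: "s \<in> A" "s' \<in> A" "h k s > 0" "h k s' < 0"
    using zero_sum_signs[OF finA sum_h[OF kl(1)] u] by metis
  obtain t t' where t: "t \<in> A" "t' \<in> A" "h l t > 0" "h l t' < 0"
    using zero_sum_signs[OF finA sum_h[OF kl(2)] v] by metis
  have F01_upd2: "F (x(c := u, d := v)) \<in> {0, 1}" if "u \<in> A" "v \<in> A" for c d u v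
    using Z that by (intro F01 cube_upd)
  have "F (x(l := t, k := s)) - F (x(l := t, k := s')) = h k s - h k s'"
    using s t kl Z by (intro D) (auto simp: cube_upd)
  moreover have "F (x(k := s', l := t)) - F (x(k := s', l := t')) = h l t - h l t'"
    using s t kl Z by (intro D) (auto simp: cube_upd)
  \<comment> \<open>This common point would have to carry 0, as the lower end of the move at
    \<open>k\<close>, and 1, as the upper end of the move at \<open>l\<close>.\<close>
  moreover have "x(k := s', l := t) = x(l := t, k := s')" using kl by (simp add: fun_upd_twist)
  moreover have "F (x(l := t, k := s)) \<in> {0, 1}" "F (x(l := t, k := s')) \<in> {0, 1}"
    "F (x(k := s', l := t')) \<in> {0, 1}"
    using s t F01_upd2 by blast+
  ultimately show False using s t by auto
qed


text \<open>At the letters \<open>(x i, x j)\<close> both \<open>k\<close> and \<open>l\<close> are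
  inactive. Moving the first letter to some \<open>s\<close> activates \<open>l\<close>, so
  \<open>k\<close> stays inactive there. If moving the second letter activated \<open>k\<close>, it
  would do so both with \<open>x i\<close> and with \<open>s\<close>; then \<open>l\<close> would be
  inactive in both positions, against the choice of \<open>s\<close>.\<close>

lemma flat_if_fixes_pair:
  assumes ij: "i \<in> I" "j \<in> I" "i \<noteq> j" and fixed: "fixes_F {i, j} x"
    and l: "l \<in> I - {i, j}" "\<not> flat l i" and k: "k \<in> I - {i, j}" "k \<noteq> l"
  shows "flat k j"
proof -
  have x: "x i \<in> A" "x j \<in> A" using fixed ij by (auto simp: fixes_F_def cube_def)
  have indep: "flat k l" if "k \<in> I - {i, j}" "l \<in> I - {i, j}" for k l
    using fixes_F_flat[OF _ fixed that] ij by auto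
  have active: "(\<forall>t\<in>A. f k i t s + f k j t s' = 0) \<or> (\<forall>t\<in>A. f l i t s + f l j t s' = 0)"
    if "k \<in> I - {i, j}" "l \<in> I - {i, j}" "k \<noteq> l" "s \<in> A" "s' \<in> A" for k l s s'
  proof -
    have "x(i := s, j := s') \<in> cube I A"
      using fixed that by (auto simp: fixes_F_def cube_upd)
    from at_most_one_active[OF _ this indep that(1,2,3)]
    show ?thesis using ij by simp
  qed
  have base: "f k i t (x i) + f k j t (x j) = 0" if "k \<in> I - {i, j}" "t \<in> A" for k t
    using fixes_F_cancel[OF _ fixed that] ij by simp
  have "\<exists>s\<in>A. \<exists>t\<in>A. f l i t s \<noteq> f l i t (x i)"
  proof (rule ccontr)
    assume "\<not> ?thesis"
    then have "flat i l"
      using flat_if_const[of i l] ij l sym[of l i] by (metis Diff_iff)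
    then show False using l flat_sym by blast
  qed
  then obtain s t where st: "s \<in> A" "t \<in> A" "f l i t s \<noteq> f l i t (x i)" by auto
  have s_l: "\<not> (\<forall>t\<in>A. f l i t s + f l j t (x j) = 0)"
    using st base[OF l(1), of t] by force
  then have s_k: "\<forall>t\<in>A. f k i t s + f k j t (x j) = 0"
    using active[of l k s "x j"] l k st x by blast
  have "f k j u s' = f k j u (x j)" if s': "s' \<in> A" and u: "u \<in> A" for s' u
  proof (rule ccontr)
    assume neq: "f k j u s' \<noteq> f k j u (x j)"
    then have "\<not> (\<forall>t\<in>A. f k i t (x i) + f k j t s' = 0)" "\<not> (\<forall>t\<in>A. f k i t s + f k j t s' = 0)"
      using base[OF k(1) u] s_k u by force+
    then have "\<forall>t\<in>A. f l i t (x i) + f l j t s' = 0" "\<forall>t\<in>A. f l i t s + f l j t s' = 0"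
      using active[of l k] l k st x s' by blast+
    then show False using st by force
  qed
  then have "flat j k"
    using flat_if_const[of j k] ij k sym[of k j] x by (metis Diff_iff)
  then show ?thesis by (rule flat_sym)
qed

text \<open>Every interaction touches \<open>i\<close> or \<open>j\<close>. If some free coordinate
  interacted with \<open>i\<close> and some free coordinate with \<open>j\<close>, they would be the
  same coordinate by \<open>flat_if_fixes_pair\<close>, and any other free coordinate would interact
  with nothing. Hence \<open>i\<close> or \<open>j\<close> is the centre of a star.\<close>

lemma star_if_fixes_pair:
  assumes ij: "i \<in> I" "j \<in> I" "i \<noteq> j" and fixed: "fixes_F {i, j} x" and n: "card I \<ge> 4"
  shows "\<exists>c\<in>I. \<forall>k\<in>I - {c}. \<forall>l\<in>I - {c}. flat k l"
proof -
  have indep: "flat k l" if "k \<in> I - {i, j}" "l \<in> I - {i, j}" for k l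
    using fixes_F_flat[OF _ fixed that] ij by auto
  have spread_i: "flat k j" if "l \<in> I - {i, j}" "\<not> flat l i" "k \<in> I - {i, j}" "k \<noteq> l" for k l
    by (rule flat_if_fixes_pair[OF ij fixed that])
  have spread_j: "flat k i" if "l \<in> I - {i, j}" "\<not> flat l j" "k \<in> I - {i, j}" "k \<noteq> l" for k l
    using flat_if_fixes_pair[of j i x l k] ij fixed that by (simp add: insert_commute)
  have one_side: "\<not> (\<not> flat l i \<and> \<not> flat m j)" if l: "l \<in> I - {i, j}" and m: "m \<in> I - {i, j}" for l m
  proof
    assume neg: "\<not> flat l i \<and> \<not> flat m j"
    have "m = l" using spread_i[of l m] neg l m by blast
    \<comment> \<open>\<open>card I \<ge> 4\<close> provides a free coordinate other than
      \<open>l\<close>, and this one contradicts \<open>ess\<close>.\<close>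
    have card2: "card (I - {i, j}) \<ge> 2" using ij n finI by (simp add: card_Diff_subset)
    have "I - {i, j} \<noteq> {l}"
    proof
      assume "I - {i, j} = {l}"
      then have "card (I - {i, j}) = 1" by (simp only: card.empty card.insert finite.emptyI empty_iff) simp
      then show False using card2 by linarith
    qed
    then obtain k where k: "k \<in> I - {i, j}" "k \<noteq> l" using l by blast
    have "flat k j" "flat k i" using spread_i[of l k] spread_j[of l k] k l neg \<open>m = l\<close> by auto
    moreover have "flat k m" if "m \<in> I - {i, j}" for m using indep k that by auto
    ultimately have "flat k m" if "m \<in> I" for m using that by blast
    then show False using ess[of k] k unfolding flat_def by auto
  qed
  show ?thesis
  proof (cases "\<exists>l\<in>I - {i, j}. \<not> flat l i")
    case True
    then have "flat m j" if "m \<in> I - {i, j}" for m using one_side that by blast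
    then have "flat k l" if "k \<in> I - {i}" "l \<in> I - {i}" for k l
      using indep[of k l] that flat_sym flat_refl by (cases "k = j"; cases "l = j") auto
    then show ?thesis using ij by blast
  next
    case False
    then have "flat k l" if "k \<in> I - {j}" "l \<in> I - {j}" for k l
      using indep[of k l] that flat_sym flat_refl by (cases "k = i"; cases "l = i") auto
    then show ?thesis using ij by blast
  qed
qed

text \<open>
  When the letter at \<open>i\<close> changes from \<open>a\<close> to \<open>b\<close>, the indicator drops from \<open>1\<close> to \<open>0\<close> on \<open>U \<times> V\<close> and rises from \<open>0\<close> to \<open>1\<close> on the
  product of the complements.
\<close>

definition split :: "'i \<Rightarrow> 'a \<Rightarrow> 'a \<Rightarrow> 'i \<Rightarrow> 'i \<Rightarrow> 'a set \<Rightarrow> 'a set \<Rightarrow> bool" where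
  "split i a b j k U V \<longleftrightarrow> i \<in> I \<and> j \<in> I \<and> k \<in> I \<and> i \<noteq> j \<and> i \<noteq> k \<and> j \<noteq> k \<and> a \<in> A \<and> b \<in> A \<and>
     U \<subseteq> A \<and> V \<subseteq> A \<and> U \<noteq> {} \<and> V \<noteq> {} \<and> U \<noteq> A \<and> V \<noteq> A \<and> card U + card V = card A \<and>
     (\<forall>t\<in>A. f i j a t - f i j b t = centered A U t) \<and>
     (\<forall>t\<in>A. f i k a t - f i k b t = centered A V t) \<and>
     (\<forall>l\<in>I - {i, j, k}. \<forall>t\<in>A. f i l a t = f i l b t)"

section \<open>Consequences of a split\<close>

lemma split_swap: "split i a b j k U V \<Longrightarrow> split i a b k j V U"
  unfolding split_def by (auto simp: insert_commute)

text \<open>A letter change involves none, one or two further coordinates. If it involves just one,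
  it reaches the value 1 at some letter \<open>s\<close> there, so \<open>F\<close> is 1 whenever
  \<open>i\<close> carries \<open>a\<close> and \<open>j\<close> carries \<open>s\<close>: a pair
  that fixes \<open>F\<close>.\<close>

lemma letter_pair_cases:
  assumes i: "i \<in> I" and ab: "a \<in> A" "b \<in> A"
  obtains (same) "\<forall>j\<in>I. \<forall>t\<in>A. f i j a t = f i j b t"
  | (pair) j x where "j \<in> I" "i \<noteq> j" "fixes_F {i, j} x"
  | (split) j k U V where "split i a b j k U V"
proof -
  define g where "g j t = f i j a t - f i j b t" for j t
  have zero_g: "sum (g j) A = 0" if "j \<in> I - {i}" for j
    using zero[OF i _ ab(1)] zero[OF i _ ab(2)] that by (simp add: g_def sum_subtractf)
  have F_g: "F (x(i := a)) - F (x(i := b)) = (\<Sum>j\<in>I - {i}. g j (x j))" if "x \<in> cube I A" for x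
    using F_diff[OF that i ab] by (simp add: g_def)
  have vals: "(\<Sum>j\<in>I - {i}. g j (x j)) \<in> {-1, 0, 1}" if x: "x \<in> cube (I - {i}) A" for x
  proof -
    have y: "x(i := a) \<in> cube I A" "x(i := b) \<in> cube I A" using x ab by (auto simp: cube_def)
    have "F (x(i := a)) - F (x(i := b)) = (\<Sum>j\<in>I - {i}. g j ((x(i := a)) j))"
      using F_g[OF y(1)] by simp
    also have "\<dots> = (\<Sum>j\<in>I - {i}. g j (x j))" by (intro sum.cong) auto
    finally show ?thesis using F01[OF y(1)] F01[OF y(2)] by auto
  qed
  have finJ: "finite (I - {i})" using finI by simp
  show thesis
  proof (rule bounded_univariate_sum_cases[OF finJ finA A_ne zero_g vals])
    assume "\<forall>j\<in>I - {i}. \<forall>t\<in>A. g j t = 0"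
    then show thesis using same diag by (metis (no_types, lifting) DiffI g_def eq_iff_diff_eq_0 singletonD)
  next
    fix j s t
    assume j: "j \<in> I - {i}" and others: "\<forall>k\<in>I - {i} - {j}. \<forall>t\<in>A. g k t = 0"
      and s: "s \<in> A" "g j s = 1"
    define x where "x = (\<lambda>_. a)(j := s)"
    have x: "x \<in> cube I A" using ab s by (auto simp: x_def cube_def)
    have "F y = 1" if y: "y \<in> cube I A" "y i = a" "y j = s" for y
    proof -
      have "(\<Sum>k\<in>I - {i}. g k (y k)) = g j (y j) + (\<Sum>k\<in>I - {i} - {j}. g k (y k))"
        using finJ j by (simp add: sum.remove)
      also have "(\<Sum>k\<in>I - {i} - {j}. g k (y k)) = 0"
        using others y by (intro sum.neutral) (auto simp: cube_def)
      finally have "F (y(i := a)) - F (y(i := b)) = 1" using F_g[OF y(1)] y s by simp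
      moreover have "y(i := a) = y" using y by auto
      ultimately show ?thesis using F01[OF y(1)] F01[OF cube_upd[OF y(1) ab(2)], of i] by auto
    qed
    then have "fixes_F {i, j} x"
      using x j by (auto simp: fixes_F_def x_def)
    then show thesis using pair[of j x] j by auto
  next
    fix j k U V
    assume "j \<in> I - {i}" "k \<in> I - {i}" "j \<noteq> k" "\<forall>l\<in>I - {i} - {j, k}. \<forall>t\<in>A. g l t = 0"
      "U \<subseteq> A" "V \<subseteq> A" "U \<noteq> {}" "V \<noteq> {}" "U \<noteq> A" "V \<noteq> A" "card U + card V = card A"
      "\<forall>t\<in>A. g j t = centered A U t" "\<forall>t\<in>A. g k t = centered A V t"
    then show thesis using i ab by (intro split[of j k U V]) (auto simp: split_def g_def)
  qed
qed

text \<open>With both letters inside \<open>U\<close> and \<open>V\<close>, or both outside,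
  \<open>card U + card V = card A\<close> makes the centred terms add up to 1 or -1. A Boolean
  function that changes by 1 or -1 has known values at both ends.\<close>

lemma split_fixes_F:
  assumes sp: "split i a b j k U V" and x: "x \<in> cube I A" "x i = a" and UV: "x j \<in> U \<longleftrightarrow> x k \<in> V"
  shows "fixes_F {i, j, k} x"
proof -
  note sp' = sp[unfolded split_def]
  have eq: "F y - F (y(i := b)) = 2 * of_bool (x j \<in> U) - 1"
    if y: "y \<in> cube I A" "y i = a" "y j = x j" "y k = x k" for y
  proof -
    have y_eq: "y(i := a) = y" using y by auto
    have A: "y j \<in> A" "y k \<in> A" using y sp' by (auto simp: cube_def)
    have "F y - F (y(i := b)) = (\<Sum>l\<in>I - {i}. f i l a (y l) - f i l b (y l))"
      using F_diff[of y i a b] y(1) sp' unfolding y_eq by blast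
    also have "\<dots> = (\<Sum>l\<in>{j, k}. f i l a (y l) - f i l b (y l))"
      using finI sp' y by (intro sum.mono_neutral_right) (auto simp: cube_def)
    also have "\<dots> = centered A U (y j) + centered A V (y k)" using sp' A by simp
    also have "\<dots> = 2 * of_bool (x j \<in> U) - (real (card U) + real (card V)) / real (card A)"
      using UV y by (simp add: centered_def add_divide_distrib)
    also have "real (card U) + real (card V) = real (card A)" using sp' by linarith
    also have "real (card A) / real (card A) = 1" using finA A_ne by simp
    finally show ?thesis .
  qed
  have b: "b \<in> A" using sp' by blast
  have "F y = of_bool (x j \<in> U)" if y: "y \<in> cube I A" "y i = a" "y j = x j" "y k = x k" for y
    using eq[OF y] F01[OF y(1)] F01[OF cube_upd[OF y(1) b], of i] by (auto split: if_splits)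
  then show ?thesis using x by (simp add: fixes_F_def)
qed

lemma split_flat:
  assumes sp: "split i a b j k U V" and lm: "l \<in> I - {i, j, k}" "m \<in> I - {i, j, k}"
  shows "flat l m"
proof -
  note sp' = sp[unfolded split_def]
  obtain u v where uv: "u \<in> U" "v \<in> V" using sp' by blast
  define x where "x = (\<lambda>_. a)(j := u, k := v)"
  have "x \<in> cube I A" using uv sp' by (auto simp: x_def cube_def)
  then have "fixes_F {i, j, k} x"
    using split_fixes_F[OF sp] uv sp' by (simp add: x_def)
  then show ?thesis using fixes_F_flat[OF _ _ lm] sp' by blast
qed

lemma split_not_flat:
  assumes sp: "split i a b j k U V"
  shows "\<not> flat i j" "\<not> flat i k"
proof -
  have *: "\<not> flat i j" if "split i a b j k U V" for j k U V
  proof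
    note sp' = that[unfolded split_def]
    assume "flat i j"
    then have "centered A U t = 0" if "t \<in> A" for t
      using sp' that by (metis flat_def diff_zero)
    moreover obtain u d where u: "u \<in> U" "u \<in> A" and d: "d \<in> A" "d \<notin> U" using sp' by blast
    moreover have "centered A U u - centered A U d = 1" using u d by (simp add: centered_def)
    ultimately show False by simp
  qed
  show "\<not> flat i j" "\<not> flat i k" using *[OF sp] *[OF split_swap[OF sp]] by auto
qed

text \<open>A nonzero interaction has zero column sums, so it distinguishes two letters at
  \<open>i\<close>. For these two letters the first case of \<open>letter_pair_cases\<close> fails,
  and the second one is excluded by \<open>no_pair\<close>.\<close>

lemma obtain_split:
  assumes no_pair: "\<nexists>i j x. i \<in> I \<and> j \<in> I \<and> i \<noteq> j \<and> fixes_F {i, j} x" and i: "i \<in> I"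
  obtains a b j k U V where "split i a b j k U V"
proof -
  obtain j s t where j: "j \<in> I" "s \<in> A" "t \<in> A" "f i j s t \<noteq> 0" using ess[OF i] by blast
  have "\<exists>s'\<in>A. f i j s' t \<noteq> f i j s t"
    using zero_sum_const[OF finA A_ne, of "\<lambda>s'. f i j s' t" "f i j s t"] zero'[OF i j(1) j(3)] j by blast
  then obtain s' where s': "s' \<in> A" "f i j s' t \<noteq> f i j s t" by blast
  show thesis
    by (rule letter_pair_cases[OF i s'(1) j(2)]) (use no_pair that s' j i in blast)+
qed

text \<open>For each choice of letters at the hubs \<open>m\<close>, \<open>m'\<close> at most one
  of the at least three leaves is active. If \<open>l\<close> distinguishes the letters
  \<open>r\<close>, \<open>r'\<close> at \<open>m'\<close>, then for every letter at
  \<open>m\<close> it is active with \<open>r\<close> or with \<open>r'\<close>. A second leaf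
  \<open>k\<close> that does not distinguish \<open>r\<close> from \<open>r'\<close> is hence
  inactive with one of them, which forces its interaction with \<open>m\<close> to be constant and
  so zero.\<close>

lemma no_two_hubs:
  assumes mm: "m \<in> I" "m' \<in> I" "m \<noteq> m'" and n: "card I \<ge> 5"
    and indep: "\<And>k l. k \<in> I - {m, m'} \<Longrightarrow> l \<in> I - {m, m'} \<Longrightarrow> flat k l"
    and adj: "\<And>l. l \<in> I - {m, m'} \<Longrightarrow> \<not> flat l m" "\<And>l. l \<in> I - {m, m'} \<Longrightarrow> \<not> flat l m'"
  shows False
proof -
  define E where "E s s' l \<longleftrightarrow> (\<forall>t\<in>A. f l m t s + f l m' t s' = 0)" for s s' l
  have active: "E s s' k \<or> E s s' l"
    if "k \<in> I - {m, m'}" "l \<in> I - {m, m'}" "k \<noteq> l" "s \<in> A" "s' \<in> A" for k l s s'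
  proof -
    have "(\<lambda>_. s)(m' := s') \<in> cube I A" using that by (auto simp: cube_def)
    from at_most_one_active[OF _ this indep that(1,2,3)]
    show ?thesis using mm by (simp add: E_def)
  qed
  have "card (I - {m, m'}) = card I - 2" using mm finI by (simp add: card_Diff_subset)
  then have "3 \<le> card (I - {m, m'})" using n by linarith
  then obtain L where "L \<subseteq> I - {m, m'}" "card L = 3" by (meson obtain_subset_with_card_n)
  then obtain l k1 k2 where l: "l \<in> I - {m, m'}" and k1: "k1 \<in> I - {m, m'}" and k2: "k2 \<in> I - {m, m'}"
    and ne: "l \<noteq> k1" "l \<noteq> k2" "k1 \<noteq> k2"
    by (auto simp: card_3_iff)
  define same where "same s s' k \<longleftrightarrow> (\<forall>t\<in>A. f k m' t s = f k m' t s')" for s s' k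
  have "\<exists>s\<in>A. \<exists>s'\<in>A. \<not> same s s' l"
  proof (rule ccontr)
    assume "\<not> ?thesis"
    then have "flat m' l"
      using flat_if_const[of m' l] mm l sym[of l m'] unfolding same_def by (metis Diff_iff)
    then show False using adj(2)[OF l] flat_sym by blast
  qed
  then obtain r r' where r: "r \<in> A" "r' \<in> A" "\<not> same r r' l" by blast
  have differ: "\<not> E s r k \<or> \<not> E s r' k" if "\<not> same r r' k" for s k
    using that unfolding E_def same_def by (metis add_left_cancel)
  obtain a where a: "a \<in> A" using A_ne by blast
  obtain k where k: "k \<in> I - {m, m'}" "k \<noteq> l" "same r r' k"
  proof (cases "same r r' k1")
    case True
    then show thesis using that k1 ne by blast
  next
    case False
    \<comment> \<open>If \<open>l\<close>, \<open>k1\<close> and \<open>k2\<close> all distinguished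
      \<open>r\<close> from \<open>r'\<close>, each would be active at \<open>(a, r)\<close> or at
      \<open>(a, r')\<close>, but each of these two positions admits only one active leaf.\<close>
    have "same r r' k2"
      using differ[OF False, of a] differ[OF r(3), of a] differ[of k2 a] active[of _ _ a r] active[of _ _ a r']
        l k1 k2 ne a r by metis
    then show thesis using that k2 ne by blast
  qed
  have const: "f k m t s = - f k m' t r" if "s \<in> A" "t \<in> A" for s t
  proof -
    have "E s r k \<or> E s r' k"
      using differ[OF r(3), of s] active[OF k(1) l k(2) that(1) r(1)] active[OF k(1) l k(2) that(1) r(2)] by blast
    then show ?thesis using k(3) that by (auto simp: E_def same_def add_eq_0_iff2)
  qed
  have "flat m k"
    using flat_if_const[of m k] mm k(1) sym[of k m] const by (metis Diff_iff)
  then show False using adj(1)[OF k(1)] flat_sym by blast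
qed

text \<open>Each coordinate has two neighbours in the interaction graph such that the coordinates
  outside this triple are independent. Comparing the triples of two coordinates \<open>l\<close>,
  \<open>l'\<close> outside a first one yields two hubs with no interactions off them, and each
  further coordinate interacts with both: the configuration excluded by
  \<open>no_two_hubs\<close>.\<close>

lemma card_le_4_if_no_pair:
  assumes no_pair: "\<nexists>i j x. i \<in> I \<and> j \<in> I \<and> i \<noteq> j \<and> fixes_F {i, j} x"
  shows "card I \<le> 4"
proof (rule ccontr)
  assume "\<not> ?thesis"
  then have n: "card I \<ge> 5" by simp
  then have "I \<noteq> {}" by auto
  then obtain i where i: "i \<in> I" by blast
  have nbs: "\<exists>j k. j \<in> I - {i} \<and> k \<in> I - {i} \<and> j \<noteq> k \<and> \<not> flat i j \<and> \<not> flat i k \<and>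
      (\<forall>l\<in>I - {i, j, k}. \<forall>m\<in>I - {i, j, k}. flat l m)" if i: "i \<in> I" for i
  proof -
    obtain a b j k U V where sp: "split i a b j k U V" using obtain_split[OF no_pair i] .
    show ?thesis
      using split_flat[OF sp] split_not_flat[OF sp] sp[unfolded split_def]
      by (intro exI[of _ j] exI[of _ k]) auto
  qed
  obtain j k where jk: "j \<in> I" "k \<in> I" "distinct [i, j, k]"
    and jk_flat: "\<forall>l\<in>I - {i, j, k}. \<forall>m\<in>I - {i, j, k}. flat l m"
    using nbs[OF i] by auto
  have "card (I - {i, j, k}) = card I - 3" using i jk finI by (simp add: card_Diff_subset)
  then have "2 \<le> card (I - {i, j, k})" using n by linarith
  then obtain L where "L \<subseteq> I - {i, j, k}" "card L = 2" by (meson obtain_subset_with_card_n)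
  then obtain l l' where l: "l \<in> I - {i, j, k}" and l': "l' \<in> I - {i, j, k}" and ll: "l \<noteq> l'"
    by (auto simp: card_2_iff)
  obtain m m' where m: "m \<in> I - {l}" "m' \<in> I - {l}" "m \<noteq> m'" "\<not> flat l m" "\<not> flat l m'"
    and m_flat: "\<forall>p\<in>I - {l, m, m'}. \<forall>r\<in>I - {l, m, m'}. flat p r"
    using nbs[of l] l by blast
  have mm: "m \<in> {i, j, k}" "m' \<in> {i, j, k}" using m jk_flat l by blast+
  have flat_outside: "flat p r" if p: "p \<in> I - {m, m'}" and r: "r \<in> I - {m, m'}" for p r
  proof -
    have l_flat: "flat l p" if p: "p \<in> I - {m, m'}" for p
    proof (cases "p \<in> {i, j, k}")
      case True
      \<comment> \<open>The independent set left by \<open>l\<close>, \<open>m\<close>,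
        \<open>m'\<close> contains \<open>l'\<close> and \<open>p\<close>, so the two neighbours of
        \<open>l'\<close> differ from \<open>p\<close>. The independent set that they leave together
        with \<open>l'\<close> contains both \<open>l\<close> and \<open>p\<close>.\<close>
      obtain c d where cd: "c \<in> I - {l'}" "d \<in> I - {l'}" "c \<noteq> d" "\<not> flat l' c" "\<not> flat l' d"
        and cd_flat: "\<forall>p\<in>I - {l', c, d}. \<forall>r\<in>I - {l', c, d}. flat p r"
        using nbs[of l'] l' by blast
      have cd': "c \<in> {i, j, k}" "d \<in> {i, j, k}" using cd jk_flat l' by blast+
      have "flat l' p" using m_flat l' ll p True mm l by blast
      then have "p \<notin> {l', c, d}" using cd True l' by auto
      moreover have "l \<notin> {l', c, d}" using cd' l ll by blast
      ultimately show ?thesis using cd_flat l p by blast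
    next
      case False
      then show ?thesis using jk_flat l p by blast
    qed
    show ?thesis
      using l_flat[OF p] l_flat[OF r] m_flat p r flat_sym by (cases "p = l"; cases "r = l") auto
  qed
  have adj: "\<not> flat p m \<and> \<not> flat p m'" if p: "p \<in> I - {m, m'}" for p
  proof -
    obtain c d where cd: "c \<in> I - {p}" "d \<in> I - {p}" "c \<noteq> d" "\<not> flat p c" "\<not> flat p d"
      using nbs[of p] p by blast
    then have "{c, d} = {m, m'}" using flat_outside[OF p] by blast
    then show ?thesis using cd by (metis doubleton_eq_iff)
  qed
  show False using no_two_hubs[OF _ _ m(3) n flat_outside] m adj by blast
qed

end

section \<open>Four coordinates and no fixing pair\<close>

lemma sum_two_valued:
  fixes g :: "'a \<Rightarrow> real"
  assumes "finite A" "U \<subseteq> A" "\<And>t. t \<in> U \<Longrightarrow> g t = c" "\<And>t. t \<in> A - U \<Longrightarrow> g t = d"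
  shows "sum g A = real (card U) * c + (real (card A) - real (card U)) * d"
proof -
  have finU: "finite U" using assms finite_subset by blast
  have "sum g A = sum g U + sum g (A - U)"
    using assms by (metis add.commute sum.subset_diff)
  also have "sum g U = real (card U) * c" using assms by simp
  also have "sum g (A - U) = real (card (A - U)) * d" using assms by simp
  also have "real (card (A - U)) = real (card A) - real (card U)"
    using assms finU by (simp add: card_Diff_subset card_mono of_nat_diff)
  finally show ?thesis .
qed

context boolean_degree_two
begin

text \<open>
  The indicator is constant whenever the letter at \<open>i\<close> is \<open>a\<close> and the letters at \<open>j\<close>, \<open>k\<close> lie in
  \<open>U\<close>, \<open>V\<close> or in their complements. So the interaction of \<open>l\<close> with \<open>j\<close> only depends on membership in
  \<open>U\<close>, and that with \<open>k\<close> on membership in \<open>V\<close>; vanishing row sums fix the weights.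
\<close>

lemma split_tensor:
  assumes no_pair: "\<nexists>i j x. i \<in> I \<and> j \<in> I \<and> i \<noteq> j \<and> fixes_F {i, j} x"
    and sp: "split i a b j k U V" and I: "I = {i, j, k, l}" and l: "l \<notin> {i, j, k}"
  obtains \<delta> where "flat j k"
    and "\<And>y u. y \<in> A \<Longrightarrow> u \<in> A \<Longrightarrow> f l j y u = centered A U u * \<delta> y"
    and "\<And>y v. y \<in> A \<Longrightarrow> v \<in> A \<Longrightarrow> f l k y v = - centered A V v * \<delta> y"
    and "\<And>y. y \<in> A \<Longrightarrow> f l i y a = (2 * real (card U) / real (card A) - 1) * \<delta> y"
    and "\<exists>y\<in>A. \<delta> y \<noteq> 0"
    and "\<And>u d. u \<in> U \<Longrightarrow> d \<in> A - U \<Longrightarrow> \<exists>X W. split j u d i l X W"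
proof -
  note sp' = sp[unfolded split_def]
  obtain u0 d0 v0 e0 where m0: "u0 \<in> U" "d0 \<in> A - U" "v0 \<in> V" "e0 \<in> A - V" using sp' by blast
  then have mA: "u0 \<in> A" "v0 \<in> A" using sp' by auto
  define q where "q = real (card A)"
  define \<alpha> where "\<alpha> = real (card U)"
  have q: "q > 0" using finA A_ne by (simp add: q_def card_gt_0_iff)
  have V: "real (card V) = q - \<alpha>" using sp' by (simp add: q_def \<alpha>_def)
  \<comment> \<open>The jump of the interaction with \<open>j\<close> at the boundary of
    \<open>U\<close>. By \<open>cancel\<close>, the interaction with \<open>k\<close> has the
    opposite jump at the boundary of \<open>V\<close>.\<close>
  define \<delta> where "\<delta> y = f l j y u0 - f l j y d0" for y
  have cancel: "f l i y a + f l j y u + f l k y v = 0"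
    if "u \<in> A" "v \<in> A" "u \<in> U \<longleftrightarrow> v \<in> V" "y \<in> A" for u v y
  proof -
    define x where "x = (\<lambda>_. a)(j := u, k := v)"
    have x: "x \<in> cube I A" using that sp' by (auto simp: x_def cube_def)
    have "fixes_F {i, j, k} x"
      using split_fixes_F[OF sp x] that sp' by (simp add: x_def)
    then have "(\<Sum>z\<in>{i, j, k}. f l z y (x z)) = 0"
      using l that sp' I by (intro fixes_F_cancel) auto
    then show ?thesis using sp' by (simp add: x_def)
  qed
  have Q: "f l j y u0 = (1 - \<alpha> / q) * \<delta> y" "f l j y d0 = - \<alpha> / q * \<delta> y"
     "f l k y v0 = - \<alpha> / q * \<delta> y" "f l k y e0 = (1 - \<alpha> / q) * \<delta> y"
     "f l i y a = (2 * \<alpha> / q - 1) * \<delta> y"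
     "\<And>u. u \<in> U \<Longrightarrow> f l j y u = f l j y u0" "\<And>d. d \<in> A - U \<Longrightarrow> f l j y d = f l j y d0"
     "\<And>v. v \<in> V \<Longrightarrow> f l k y v = f l k y v0" "\<And>e. e \<in> A - V \<Longrightarrow> f l k y e = f l k y e0"
     if y: "y \<in> A" for y
  proof -
    have c: "f l i y a + f l j y u0 + f l k y v0 = 0" "f l i y a + f l j y d0 + f l k y e0 = 0"
      using cancel[of u0 v0 y] cancel[of d0 e0 y] m0 mA y by auto
    show U1: "f l j y u = f l j y u0" if "u \<in> U" for u
      using cancel[of u v0 y] c m0 mA y that sp' by auto
    show U2: "f l j y d = f l j y d0" if "d \<in> A - U" for d
      using cancel[of d e0 y] c m0 mA y that sp' by auto
    show V1: "f l k y v = f l k y v0" if "v \<in> V" for v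
      using cancel[of u0 v y] c m0 mA y that sp' by auto
    show V2: "f l k y e = f l k y e0" if "e \<in> A - V" for e
      using cancel[of d0 e y] c m0 mA y that sp' by auto
    have "\<alpha> * f l j y u0 + (q - \<alpha>) * f l j y d0 = 0"
      using sum_two_valued[OF finA, of U "f l j y", OF _ U1 U2] zero[of l j y] sp' I y by (simp add: q_def \<alpha>_def)
    moreover have "(q - \<alpha>) * f l k y v0 + \<alpha> * f l k y e0 = 0"
      using sum_two_valued[OF finA, of V "f l k y", OF _ V1 V2] zero[of l k y] sp' I y V by (simp add: q_def)
    moreover have e: "f l k y e0 = f l k y v0 + \<delta> y" using c by (simp add: \<delta>_def)
    moreover have u: "f l j y u0 = f l j y d0 + \<delta> y" by (simp add: \<delta>_def)
    ultimately have d: "q * f l j y d0 = - \<alpha> * \<delta> y" and v: "q * f l k y v0 = - \<alpha> * \<delta> y"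
      by (simp_all add: algebra_simps)
    show "f l j y d0 = - \<alpha> / q * \<delta> y" "f l k y v0 = - \<alpha> / q * \<delta> y"
      using d v q by (simp_all add: field_simps)
    then show "f l j y u0 = (1 - \<alpha> / q) * \<delta> y" "f l k y e0 = (1 - \<alpha> / q) * \<delta> y"
      "f l i y a = (2 * \<alpha> / q - 1) * \<delta> y"
      using c u e by (simp_all add: algebra_simps)
  qed
  have A1: "f l j y u = centered A U u * \<delta> y" if "y \<in> A" "u \<in> A" for y u
    using Q[OF that(1)] that by (cases "u \<in> U") (auto simp: centered_def q_def \<alpha>_def)
  have A2: "f l k y v = - centered A V v * \<delta> y" if "y \<in> A" "v \<in> A" for y v
  proof -
    have "centered A V v = of_bool (v \<in> V) - (1 - \<alpha> / q)"
      using V q by (simp add: centered_def q_def[symmetric] diff_divide_distrib)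
    then show ?thesis using Q[OF that(1)] that by (cases "v \<in> V") auto
  qed
  \<comment> \<open>If \<delta> vanished, \<open>l\<close> could interact with \<open>i\<close>
    only, but a split at \<open>l\<close> needs two partners that are not flat.\<close>
  have ne: "\<exists>y\<in>A. \<delta> y \<noteq> 0"
  proof (rule ccontr)
    assume "\<not> ?thesis"
    then have fl: "flat l j" "flat l k" using A1 A2 by (auto simp: flat_def)
    obtain c d m n X W where s: "split l c d m n X W" using obtain_split[OF no_pair, of l] I by blast
    then have "m \<in> {i, j, k}" "n \<in> {i, j, k}" "m \<noteq> n" using I unfolding split_def by auto
    then have "flat l m \<or> flat l n" using fl by auto
    then show False using split_not_flat[OF s] by blast
  qed
  then obtain y0 where y0: "y0 \<in> A" "\<delta> y0 \<noteq> 0" by blast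
  \<comment> \<open>Exchanging a letter of \<open>U\<close> for one outside changes the interaction
    of \<open>j\<close> with \<open>l\<close> by a nonzero \<delta>, and that with \<open>i\<close>
    by the given split. So \<open>i\<close> and \<open>l\<close> are the two partners in the split
    at \<open>j\<close>.\<close>
  have A3: "\<exists>X W. split j u d i l X W" if u: "u \<in> U" and d: "d \<in> A - U" for u d
  proof -
    have uA: "u \<in> A" using u sp' by blast
    have dl: "f j l u y0 \<noteq> f j l d y0"
      using Q(6)[OF y0(1) u] Q(7)[OF y0(1) d] y0(2) unfolding \<delta>_def sym[of j l] by auto
    have "(f i j a u - f i j b u) - (f i j a d - f i j b d) = 1"
      using sp' u d uA by (simp add: centered_def)
    then have di: "\<not> (\<forall>t\<in>A. f j i u t = f j i d t)"
      using sp' unfolding sym[of j i] by auto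
    have j: "j \<in> I" using I by simp
    show ?thesis
    proof (rule letter_pair_cases[OF j uA, of d])
      show "d \<in> A" using d by simp
    next
      assume "\<forall>m\<in>I. \<forall>t\<in>A. f j m u t = f j m d t"
      then show ?thesis using dl y0(1) I by auto
    next
      fix m x assume "m \<in> I" "j \<noteq> m" "fixes_F {j, m} x"
      then show ?thesis using no_pair j by blast
    next
      fix m n X W assume s: "split j u d m n X W"
      have "l \<in> {m, n}"
      proof (rule ccontr)
        assume "l \<notin> {m, n}"
        then have "l \<in> I - {j, m, n}" using l I by auto
        then show False using s dl y0(1) unfolding split_def by blast
      qed
      moreover have "i \<in> {m, n}"
      proof (rule ccontr)
        assume "i \<notin> {m, n}"
        then have "i \<in> I - {j, m, n}" using sp' I by auto
        then show False using s di unfolding split_def by blast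
      qed
      moreover have "i \<noteq> l" using l by auto
      ultimately have "m = i \<and> n = l \<or> m = l \<and> n = i" by auto
      then show ?thesis using s split_swap[OF s] by auto
    qed
  qed
  have jk: "flat j k"
  proof (rule flat_if_const)
    show "j \<in> I" "k \<in> I" using I by auto
    \<comment> \<open>\<open>k\<close> is left out of the split at \<open>j\<close>, so its
      interaction ignores this exchange; chaining through \<open>u0\<close> and \<open>d0\<close>
      covers all pairs of letters.\<close>
    have *: "f j k u t = f j k d t" if ud: "u \<in> U" "d \<in> A - U" and t: "t \<in> A" for u d t
    proof -
      obtain X W where "split j u d i l X W" using A3[OF ud] by blast
      moreover have "k \<in> I - {j, i, l}" using I l sp' by auto
      ultimately show ?thesis using t unfolding split_def by blast
    qed
    have d0: "f j k s t = f j k d0 t" if "s \<in> A" "t \<in> A" for s t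
    proof (cases "s \<in> U")
      case True
      then show ?thesis using *[OF _ m0(2) that(2)] by blast
    next
      case False
      then have "f j k u0 t = f j k s t" using *[OF m0(1) _ that(2)] that by blast
      then show ?thesis using *[OF m0(1,2) that(2)] by simp
    qed
    show "f j k s t = f j k s' t" if "s \<in> A" "s' \<in> A" "t \<in> A" for s s' t
      using d0[OF that(1,3)] d0[OF that(2,3)] by simp
  qed
  show thesis
    using that[of \<delta>, OF jk A1 A2 _ ne A3] Q(5) by (simp add: q_def \<alpha>_def)
qed

text \<open>\<open>split_tensor\<close> is applied to a split at \<open>i\<close> and then to the
  resulting split at \<open>j\<close>, which leaves interactions only along the cycle i, j, l, k.
  Since \<open>i\<close> and \<open>l\<close> do not interact while \<delta> is not zero, the factor
  \<open>2 * card U / card A - 1\<close> must vanish, so \<open>U\<close> and likewise the other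
  sets are halves of the alphabet.\<close>

lemma four_coordinates_form:
  assumes no_pair: "\<nexists>i j x. i \<in> I \<and> j \<in> I \<and> i \<noteq> j \<and> fixes_F {i, j} x" and n: "card I = 4"
  obtains i j k l X U V W where "I = {i, j, k, l}" "distinct [i, j, k, l]"
    and "X \<subseteq> A" "U \<subseteq> A" "V \<subseteq> A" "W \<subseteq> A"
    and "2 * card X = card A" "2 * card U = card A" "2 * card V = card A" "2 * card W = card A"
    and "\<And>x. x \<in> cube I A \<Longrightarrow> F x = 1 / 2 + centered A X (x i) * centered A U (x j)
        + centered A X (x i) * centered A V (x k) + centered A U (x j) * centered A W (x l)
        - centered A V (x k) * centered A W (x l)"
proof -
  have "I \<noteq> {}" using n by auto
  then obtain i where i: "i \<in> I" by blast
  obtain a b j k U V where sp: "split i a b j k U V" using obtain_split[OF no_pair i] .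
  note sp' = sp[unfolded split_def]
  have "card (I - {i, j, k}) = 1" using n sp' finI by (simp add: card_Diff_subset)
  then obtain l where l: "I - {i, j, k} = {l}" by (auto simp: card_1_singleton_iff)
  then have I: "I = {i, j, k, l}" "l \<notin> {i, j, k}" using sp' by auto
  obtain \<delta> where jk: "flat j k"
    and lj: "\<And>y u. y \<in> A \<Longrightarrow> u \<in> A \<Longrightarrow> f l j y u = centered A U u * \<delta> y"
    and lk: "\<And>y v. y \<in> A \<Longrightarrow> v \<in> A \<Longrightarrow> f l k y v = - centered A V v * \<delta> y"
    and li: "\<And>y. y \<in> A \<Longrightarrow> f l i y a = (2 * real (card U) / real (card A) - 1) * \<delta> y"
    and \<delta>: "\<exists>y\<in>A. \<delta> y \<noteq> 0"
    and spl: "\<And>u d. u \<in> U \<Longrightarrow> d \<in> A - U \<Longrightarrow> \<exists>X W. split j u d i l X W"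
    by (rule split_tensor[OF no_pair sp I]) (rule that)
  obtain u0 d0 where ud: "u0 \<in> U" "d0 \<in> A - U" using sp' by blast
  then have udA: "u0 \<in> A" "d0 \<in> A" using sp' by auto
  obtain X W where sp2: "split j u0 d0 i l X W" using spl[OF ud] by blast
  note sp2' = sp2[unfolded split_def]
  have I2: "I = {j, i, l, k}" "k \<notin> {j, i, l}" using I sp' by auto
  obtain \<delta>' where il: "flat i l"
    and ki: "\<And>y s. y \<in> A \<Longrightarrow> s \<in> A \<Longrightarrow> f k i y s = centered A X s * \<delta>' y"
    and kl: "\<And>y w. y \<in> A \<Longrightarrow> w \<in> A \<Longrightarrow> f k l y w = - centered A W w * \<delta>' y"
    and kj: "\<And>y. y \<in> A \<Longrightarrow> f k j y u0 = (2 * real (card X) / real (card A) - 1) * \<delta>' y"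
    and \<delta>': "\<exists>y\<in>A. \<delta>' y \<noteq> 0"
    by (rule split_tensor[OF no_pair sp2 I2]) (rule that)
  have q: "card A > 0" using finA A_ne by (simp add: card_gt_0_iff)
  have half: "2 * m = card A" if "2 * real m / real (card A) - 1 = 0" for m
  proof -
    have "2 * real m = real (card A)" using that q by (simp add: field_simps)
    then show ?thesis by linarith
  qed
  have U: "2 * card U = card A"
    using \<delta> li flat_sym[OF il] sp' by (intro half) (auto simp: flat_def)
  have X: "2 * card X = card A"
    using \<delta>' kj flat_sym[OF jk] udA by (intro half) (auto simp: flat_def)
  have V: "2 * card V = card A" and W: "2 * card W = card A" using U X sp' sp2' by linarith+
  \<comment> \<open>Both splits describe the same jump of the interaction between \<open>j\<close>
    and \<open>l\<close> at the boundary of \<open>U\<close>.\<close>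
  have \<delta>_eq: "\<delta> y = centered A W y" if "y \<in> A" for y
  proof -
    have "centered A W y = f j l u0 y - f j l d0 y" using sp2' that by auto
    also have "\<dots> = (centered A U u0 - centered A U d0) * \<delta> y"
      using lj[OF that udA(1)] lj[OF that udA(2)] by (simp add: sym[of j l] left_diff_distrib)
    finally show ?thesis using ud by (simp add: centered_def)
  qed
  have val: "centered A B t = (if t \<in> B then 1 / 2 else - 1 / 2)" if "2 * card B = card A" for B t
  proof -
    have "real (card A) = 2 * real (card B)" "real (card B) > 0" using that q by linarith+
    then show ?thesis by (simp add: centered_def)
  qed
  obtain w w' where w: "w \<in> W" "w \<in> A" "w' \<in> A" "w' \<notin> W" using sp2' by blast
  obtain v v' where v: "v \<in> V" "v \<in> A" "v' \<in> A" "v' \<notin> V" using sp' by blast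
  \<comment> \<open>Two descriptions of the interaction of \<open>k\<close> and \<open>l\<close> are
    compared at a letter of \<open>W\<close>, where \<open>centered A W\<close> is 1/2.\<close>
  have \<delta>'_eq: "\<delta>' v = centered A V v" if "v \<in> A" for v
    using lk[OF w(2) that] kl[OF that w(2)] \<delta>_eq[OF w(2)] w(1) val[OF W, of w]
    by (simp add: sym[of l k])
  define G where "G x = \<rho> + f i j (x i) (x j) + centered A X (x i) * centered A V (x k)
    + centered A U (x j) * centered A W (x l) - centered A V (x k) * centered A W (x l)" for x
  have G: "F x = G x" if x: "x \<in> cube I A" for x
  proof -
    have xA: "x i \<in> A" "x j \<in> A" "x k \<in> A" "x l \<in> A" using x I by (auto simp: cube_def)
    have d: "i \<notin> {j, k, l}" "j \<notin> {k, l}" "k \<notin> {l}" using I sp' by auto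
    have "F x = \<rho> + (\<Sum>m\<in>insert i {j, k, l}. \<Sum>n\<in>insert i {j, k, l}. f m n (x m) (x n)) / 2"
      using F_eq[OF x] I by simp
    also have "\<dots> = \<rho> + (\<Sum>m\<in>{j, k, l}. f i m (x i) (x m)) + (\<Sum>m\<in>{k, l}. f j m (x j) (x m))
        + f k l (x k) (x l)"
      using quadratic_form_insert[OF _ d(1), of x] quadratic_form_insert[OF _ d(2), of x]
        quadratic_form_insert[OF _ d(3), of x] diag by simp
    also have "\<dots> = \<rho> + f i j (x i) (x j) + f i k (x i) (x k) + f i l (x i) (x l)
        + f j k (x j) (x k) + f j l (x j) (x l) + f k l (x k) (x l)"
      using d by simp
    also have "f i l (x i) (x l) = 0" using il xA by (simp add: flat_def)
    also have "f j k (x j) (x k) = 0" using jk xA by (simp add: flat_def)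
    also have "f i k (x i) (x k) = centered A X (x i) * centered A V (x k)"
      using ki[OF xA(3,1)] \<delta>'_eq xA by (simp add: sym[of i k])
    also have "f j l (x j) (x l) = centered A U (x j) * centered A W (x l)"
      using lj[OF xA(4,2)] \<delta>_eq xA by (simp add: sym[of j l])
    also have "f k l (x k) (x l) = - centered A V (x k) * centered A W (x l)"
      using kl[OF xA(3,4)] \<delta>'_eq xA by simp
    finally show ?thesis by (simp add: G_def)
  qed
  \<comment> \<open>For fixed \<open>s\<close>, \<open>t\<close> the three known products together
    take two values at distance 1 as \<open>v\<close>, \<open>w\<close> run through both sides of
    \<open>V\<close> and \<open>W\<close>. Values in \<open>{0, 1}\<close> therefore pin down the
    remaining term.\<close>
  have ij: "\<rho> + f i j s t = 1 / 2 + centered A X s * centered A U t" if "s \<in> A" "t \<in> A" for s t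
  proof -
    have *: "\<rho> + f i j s t + centered A X s * centered A V v + centered A U t * centered A W w
        - centered A V v * centered A W w \<in> {0, 1}" if "v \<in> A" "w \<in> A" for v w
    proof -
      define x where "x = (\<lambda>_. s)(j := t, k := v, l := w)"
      have x: "x \<in> cube I A" using that \<open>s \<in> A\<close> \<open>t \<in> A\<close> by (auto simp: x_def cube_def)
      have "x i = s" "x j = t" "x k = v" "x l = w" using I sp' by (auto simp: x_def)
      then show ?thesis using F01[OF x] unfolding G[OF x] G_def by simp
    qed
    show ?thesis
      using *[OF v(2) w(2)] *[OF v(2) w(3)] *[OF v(3) w(2)] *[OF v(3) w(3)] v w
      by (auto simp: val[OF X] val[OF U] val[OF V] val[OF W] split: if_splits)
  qed
  show thesis
  proof (rule that[of i j k l X U V W])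
    show "F x = 1 / 2 + centered A X (x i) * centered A U (x j)
        + centered A X (x i) * centered A V (x k) + centered A U (x j) * centered A W (x l)
        - centered A V (x k) * centered A W (x l)" if x: "x \<in> cube I A" for x
      using G[OF x] ij[of "x i" "x j"] x I by (simp add: G_def cube_def)
  qed (use I sp' sp2' X U V W in auto)
qed

end

section \<open>Equitable partitions and eigenfunctions\<close>

text \<open>Restricting first extends the indicator from words to all functions, ignoring letters
  outside \<open>{1..n}\<close>.\<close>

definition word_indicator :: "nat \<Rightarrow> (nat \<Rightarrow> 'a) set \<Rightarrow> (nat \<Rightarrow> 'a) \<Rightarrow> real" where
  "word_indicator n C x = of_bool (restrict x {1..n} \<in> C)"

section \<open>Words and neighbour counts\<close>

lemma words_iff: "x \<in> words n A \<longleftrightarrow> x \<in> cube {1..n} A \<and> x \<in> extensional {1..n}"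
  by (auto simp: words_def cube_def PiE_def)

lemma restrict_words: "x \<in> cube {1..n} A \<Longrightarrow> restrict x {1..n} \<in> words n A"
  by (auto simp: words_def cube_def)

lemma restrict_word: "x \<in> words n A \<Longrightarrow> restrict x {1..n} = x"
  by (simp add: words_def PiE_restrict)

lemma words_upd: "x \<in> words n A \<Longrightarrow> i \<in> {1..n} \<Longrightarrow> a \<in> A \<Longrightarrow> x(i := a) \<in> words n A"
  by (auto simp: words_def PiE_iff extensional_def)

lemma words_eqI:
  "x \<in> words n A \<Longrightarrow> y \<in> words n A \<Longrightarrow> (\<And>i. i \<in> {1..n} \<Longrightarrow> x i = y i) \<Longrightarrow> x = y"
  unfolding words_def by (rule PiE_ext)

lemma finite_words: "finite A \<Longrightarrow> finite (words n A)"
  unfolding words_def by (intro finite_PiE) auto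

lemma hamming_adj_sym: "hamming_adj n x y \<longleftrightarrow> hamming_adj n y x"
proof -
  have "{i \<in> {1..n}. x i \<noteq> y i} = {i \<in> {1..n}. y i \<noteq> x i}" by auto
  then show ?thesis by (simp only: hamming_adj_def)
qed

lemma differ_singleton_iff:
  assumes "x \<in> words n A" "y \<in> words n A"
  shows "{j \<in> {1..n}. x j \<noteq> y j} = {i} \<longleftrightarrow> i \<in> {1..n} \<and> y i \<noteq> x i \<and> y = x(i := y i)"
proof
  assume *: "{j \<in> {1..n}. x j \<noteq> y j} = {i}"
  have "i \<in> {j \<in> {1..n}. x j \<noteq> y j}" unfolding * by simp
  then have i: "i \<in> {1..n}" "y i \<noteq> x i" by auto
  have "y = x(i := y i)"
  proof (rule words_eqI[OF assms(2)])
    show "x(i := y i) \<in> words n A"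
      using assms i(1) by (intro words_upd) (auto simp: words_def)
    show "y j = (x(i := y i)) j" if "j \<in> {1..n}" for j
    proof (cases "j = i")
      case False
      then have "j \<notin> {j \<in> {1..n}. x j \<noteq> y j}" unfolding * by simp
      then show ?thesis using that False by auto
    qed simp
  qed
  then show "i \<in> {1..n} \<and> y i \<noteq> x i \<and> y = x(i := y i)" using i by blast
next
  assume i: "i \<in> {1..n} \<and> y i \<noteq> x i \<and> y = x(i := y i)"
  then have eq: "y j = x j" if "j \<noteq> i" for j using that by (metis fun_upd_other)
  have i': "i \<in> {1..n}" "y i \<noteq> x i" using i by blast+
  show "{j \<in> {1..n}. x j \<noteq> y j} = {i}"
    unfolding set_eq_iff
  proof
    show "j \<in> {j \<in> {1..n}. x j \<noteq> y j} \<longleftrightarrow> j \<in> {i}" for j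
      using eq[of j] i' by (cases "j = i") auto
  qed
qed

lemma hamming_adj_iff:
  assumes "x \<in> words n A" "y \<in> words n A"
  shows "hamming_adj n x y \<longleftrightarrow> (\<exists>i\<in>{1..n}. y i \<noteq> x i \<and> y = x(i := y i))"
proof -
  have "hamming_adj n x y \<longleftrightarrow> (\<exists>i. {j \<in> {1..n}. x j \<noteq> y j} = {i})"
    by (simp only: hamming_adj_def One_nat_def card_1_singleton_iff)
  also have "\<dots> \<longleftrightarrow> (\<exists>i\<in>{1..n}. y i \<noteq> x i \<and> y = x(i := y i))"
    unfolding Bex_def by (intro arg_cong[where f = Ex] ext differ_singleton_iff[OF assms])
  finally show ?thesis .
qed

text \<open>Coordinate sums count the words of \<open>D\<close> obtained by overwriting one letter.
  If \<open>x\<close> lies in \<open>D\<close>, it is itself counted once per coordinate, hence the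
  correction.\<close>

lemma card_neighbours:
  assumes A: "finite A" and D: "D \<subseteq> words n A" and x: "x \<in> words n A"
  shows "real (card {y \<in> D. hamming_adj n x y})
    = (\<Sum>i\<in>{1..n}. coord_sum A i (word_indicator n D) x) - real n * of_bool (x \<in> D)"
proof -
  define B where "B i = {a \<in> A - {x i}. x(i := a) \<in> D}" for i
  have "bij_betw (\<lambda>(i, a). x(i := a)) (SIGMA i:{1..n}. B i) {y \<in> D. hamming_adj n x y}"
    unfolding bij_betw_def
  proof
    show "inj_on (\<lambda>(i, a). x(i := a)) (SIGMA i:{1..n}. B i)"
    proof (rule inj_onI, clarify)
      fix i a j b
      assume ij: "a \<in> B i" "b \<in> B j" and eq: "x(i := a) = x(j := b)"
      have "i = j"
      proof (rule ccontr)
        assume "i \<noteq> j"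
        then have "a = x i" using fun_cong[OF eq, of i] by simp
        then show False using ij by (simp add: B_def)
      qed
      then show "i = j \<and> a = b" using fun_cong[OF eq, of i] by simp
    qed
    show "(\<lambda>(i, a). x(i := a)) ` (SIGMA i:{1..n}. B i) = {y \<in> D. hamming_adj n x y}"
    proof (intro equalityI subsetI)
      fix y assume "y \<in> (\<lambda>(i, a). x(i := a)) ` (SIGMA i:{1..n}. B i)"
      then obtain i a where i: "i \<in> {1..n}" "a \<in> B i" "y = x(i := a)" by auto
      then have "y \<in> words n A" using x by (auto simp: B_def words_upd)
      then have "hamming_adj n x y"
        using i by (auto simp: hamming_adj_iff[OF x] B_def)
      then show "y \<in> {y \<in> D. hamming_adj n x y}" using i by (auto simp: B_def)
    next
      fix y assume "y \<in> {y \<in> D. hamming_adj n x y}"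
      then have y: "y \<in> D" "hamming_adj n x y" "y \<in> words n A" using D by auto
      then obtain i where i: "i \<in> {1..n}" "y i \<noteq> x i" "y = x(i := y i)"
        using hamming_adj_iff[OF x] by blast
      then have "y i \<in> B i" using y by (auto simp: B_def words_def)
      then show "y \<in> (\<lambda>(i, a). x(i := a)) ` (SIGMA i:{1..n}. B i)"
        using i by (intro image_eqI[of _ _ "(i, y i)"]) (simp_all only: prod.case mem_Sigma_iff)
    qed
  qed
  then have "card {y \<in> D. hamming_adj n x y} = card (SIGMA i:{1..n}. B i)"
    by (simp add: bij_betw_same_card)
  also have "\<dots> = (\<Sum>i\<in>{1..n}. card (B i))" using A by (simp add: B_def)
  finally have "real (card {y \<in> D. hamming_adj n x y}) = (\<Sum>i\<in>{1..n}. real (card (B i)))" by simp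
  also have "\<dots> = (\<Sum>i\<in>{1..n}. coord_sum A i (word_indicator n D) x - of_bool (x \<in> D))"
  proof (rule sum.cong)
    fix i assume i: "i \<in> {1..n}"
    have xi: "x i \<in> A" using x i by (auto simp: words_def)
    have "coord_sum A i (word_indicator n D) x = (\<Sum>a\<in>A. of_bool (x(i := a) \<in> D))"
      unfolding coord_sum_def word_indicator_def
      using restrict_word[OF words_upd[OF x i]] by (intro sum.cong) auto
    also have "\<dots> = of_bool (x \<in> D) + (\<Sum>a\<in>A - {x i}. of_bool (x(i := a) \<in> D))"
      by (rule trans[OF sum.remove[OF A xi]]) simp
    also have "(\<Sum>a\<in>A - {x i}. of_bool (x(i := a) \<in> D)) = real (card (B i))"
      using A by (simp add: B_def Int_def)
    finally show "real (card (B i)) = coord_sum A i (word_indicator n D) x - of_bool (x \<in> D)" by simp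
  qed simp
  finally show ?thesis by (simp add: sum_subtractf)
qed

lemma hamming_degree:
  assumes A: "finite A" and x: "x \<in> words n A"
  shows "real (card {y \<in> words n A. hamming_adj n x y}) = real n * (real (card A) - 1)"
proof -
  have "coord_sum A i (word_indicator n (words n A)) x = real (card A)" if "i \<in> {1..n}" for i
  proof -
    have "coord_sum A i (word_indicator n (words n A)) x = (\<Sum>a\<in>A. 1)"
      unfolding coord_sum_def word_indicator_def
      using restrict_word[OF words_upd[OF x that]] words_upd[OF x that] by (intro sum.cong) auto
    then show ?thesis by simp
  qed
  then show ?thesis using card_neighbours[OF A subset_refl x] x by (simp add: algebra_simps)
qed

lemma card_neighbours_compl:
  assumes A: "finite A" and C: "C \<subseteq> words n A" and x: "x \<in> words n A"
  shows "real (card {y \<in> C. hamming_adj n x y}) + real (card {y \<in> words n A - C. hamming_adj n x y})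
    = real n * (real (card A) - 1)"
proof -
  have "{y \<in> words n A. hamming_adj n x y}
      = {y \<in> C. hamming_adj n x y} \<union> {y \<in> words n A - C. hamming_adj n x y}"
    using C by auto
  moreover have "finite {y \<in> C. hamming_adj n x y}" "finite {y \<in> words n A - C. hamming_adj n x y}"
    using finite_words[OF A, of n] C by (auto intro: finite_subset)
  ultimately have "card {y \<in> words n A. hamming_adj n x y}
      = card {y \<in> C. hamming_adj n x y} + card {y \<in> words n A - C. hamming_adj n x y}"
    by (simp add: card_Un_disjoint disjoint_iff)
  then show ?thesis using hamming_degree[OF A x] by simp
qed

text \<open>Constants are multiplied by \<open>n * card A\<close> instead of
  \<open>(n - 2) * card A\<close>; the discrepancy is the term
  \<open>2 * card A * \<rho>\<close>.\<close>

lemma second_eigenfunction_indicator_iff: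
  assumes A: "finite A" and C: "C \<subseteq> words n A"
  shows "second_eigenfunction {1..n} A (\<lambda>x. word_indicator n C x - \<rho>) \<longleftrightarrow>
    (\<forall>x\<in>words n A. real (card {y \<in> C. hamming_adj n x y})
      = hamming_eigenvalue 2 n (card A) * of_bool (x \<in> C) + 2 * real (card A) * \<rho>)"
proof -
  let ?f = "\<lambda>x. word_indicator n C x - \<rho>"
  let ?E = "\<lambda>x. (\<Sum>i\<in>{1..n}. coord_sum A i ?f x) = real (card A) * (real n - 2) * ?f x"
  have f: "coord_sum A i ?f x = coord_sum A i (word_indicator n C) x - real (card A) * \<rho>" for i x
    by (simp add: coord_sum_def sum_subtractf)
  have 1: "?E x \<longleftrightarrow> real (card {y \<in> C. hamming_adj n x y})
      = hamming_eigenvalue 2 n (card A) * of_bool (x \<in> C) + 2 * real (card A) * \<rho>"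
    if x: "x \<in> words n A" for x
  proof -
    have "(\<Sum>i\<in>{1..n}. coord_sum A i ?f x) = real (card {y \<in> C. hamming_adj n x y})
        + real n * of_bool (x \<in> C) - real n * (real (card A) * \<rho>)"
      using card_neighbours[OF A C x] by (simp add: f sum_subtractf)
    moreover have "word_indicator n C x = of_bool (x \<in> C)"
      using restrict_word[OF x] by (simp add: word_indicator_def)
    ultimately show ?thesis by (auto simp: hamming_eigenvalue_def algebra_simps)
  qed
  have 2: "?E x \<longleftrightarrow> ?E (restrict x {1..n})" for x
  proof -
    have "(\<Sum>i\<in>{1..n}. coord_sum A i ?f x) = (\<Sum>i\<in>{1..n}. coord_sum A i ?f (restrict x {1..n}))"
    proof (rule sum.cong)
      fix i assume "i \<in> {1..n}"
      then have "restrict (x(i := a)) {1..n} = restrict ((restrict x {1..n})(i := a)) {1..n}" for a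
        by (auto simp: restrict_def)
      then show "coord_sum A i ?f x = coord_sum A i ?f (restrict x {1..n})"
        by (simp add: coord_sum_def word_indicator_def)
    qed simp
    then show ?thesis by (simp add: word_indicator_def)
  qed
  have "second_eigenfunction {1..n} A ?f \<longleftrightarrow> (\<forall>x\<in>cube {1..n} A. ?E x)"
    by (simp add: second_eigenfunction_def)
  also have "\<dots> \<longleftrightarrow> (\<forall>x\<in>words n A. ?E x)"
    using 2 restrict_words words_iff by blast
  finally show ?thesis using 1 by blast
qed

lemma equitable_neighbours:
  assumes eq: "equitable_2_partition (words n A) (hamming_adj n) C S" and A: "finite A"
  shows "\<And>x. x \<in> C \<Longrightarrow> real (card {y \<in> C. hamming_adj n x y}) = S $$ (0, 0)"
    and "\<And>x. x \<in> words n A - C \<Longrightarrow> real (card {y \<in> C. hamming_adj n x y}) = S $$ (1, 0)"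
    and "S $$ (0, 0) + S $$ (0, 1) = real n * (real (card A) - 1)"
    and "S $$ (1, 0) + S $$ (1, 1) = real n * (real (card A) - 1)"
proof -
  have cells: "real (card {y \<in> cell (words n A) C j. hamming_adj n x y}) = S $$ (i, j)"
    if "i < 2" "j < 2" "x \<in> cell (words n A) C i" for i j x
    using eq that unfolding equitable_2_partition_def by blast
  have C: "C \<subseteq> words n A" "C \<noteq> {}" "words n A - C \<noteq> {}"
    using eq by (auto simp: equitable_2_partition_def two_partition_def)
  show 00: "real (card {y \<in> C. hamming_adj n x y}) = S $$ (0, 0)" if "x \<in> C" for x
    using cells[of 0 0 x] that by (simp add: cell_def)
  have 01: "real (card {y \<in> words n A - C. hamming_adj n x y}) = S $$ (0, 1)" if "x \<in> C" for x
    using cells[of 0 1 x] that by (simp add: cell_def)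
  show 10: "real (card {y \<in> C. hamming_adj n x y}) = S $$ (1, 0)" if "x \<in> words n A - C" for x
    using cells[of 1 0 x] that by (simp add: cell_def)
  have 11: "real (card {y \<in> words n A - C. hamming_adj n x y}) = S $$ (1, 1)"
    if "x \<in> words n A - C" for x
    using cells[of 1 1 x] that by (simp add: cell_def)
  note split = card_neighbours_compl[OF A C(1)]
  obtain x where x: "x \<in> C" using C by blast
  show "S $$ (0, 0) + S $$ (0, 1) = real n * (real (card A) - 1)"
    using split[of x] 00[OF x] 01[OF x] x C by auto
  obtain x where x: "x \<in> words n A - C" using C by blast
  show "S $$ (1, 0) + S $$ (1, 1) = real n * (real (card A) - 1)"
    using split[of x] 10[OF x] 11[OF x] x by auto
qed

text \<open>A constant vector belongs to the common row sum of the quotient matrix, which exceeds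
  the eigenvalue by \<open>2 * card A\<close>. So the eigenvector is not constant, and subtracting
  the two rows of its equation gives \<open>S $$ (0, 0) - S $$ (1, 0)\<close> as the
  eigenvalue.\<close>

lemma second_eigenfunction_if_equitable:
  assumes eq: "equitable_2_partition_with_eigenvalue (words n A) (hamming_adj n) C
      (hamming_eigenvalue 2 n (card A))"
    and A: "finite A" "A \<noteq> {}"
  obtains \<rho> where "second_eigenfunction {1..n} A (\<lambda>x. word_indicator n C x - \<rho>)"
proof -
  let ?\<theta> = "hamming_eigenvalue 2 n (card A)"
  obtain S where S: "equitable_2_partition (words n A) (hamming_adj n) C S" "eigenvalue S ?\<theta>"
    using eq by (auto simp: equitable_2_partition_with_eigenvalue_def)
  have carr: "S \<in> carrier_mat 2 2" and C: "C \<subseteq> words n A"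
    using S by (auto simp: equitable_2_partition_def two_partition_def)
  note nb = equitable_neighbours[OF S(1) A(1)]
  obtain v where v: "v \<in> carrier_vec 2" "v \<noteq> 0\<^sub>v 2" "S *\<^sub>v v = ?\<theta> \<cdot>\<^sub>v v"
    using S(2) carr by (auto simp: eigenvalue_def eigenvector_def)
  have "(S *\<^sub>v v) $ i = ?\<theta> * v $ i" if "i < 2" for i
    using v that by simp
  moreover have "(S *\<^sub>v v) $ i = S $$ (i, 0) * v $ 0 + S $$ (i, 1) * v $ 1" if "i < 2" for i
    using v(1) carr that by (simp add: scalar_prod_def numeral_2_eq_2)
  ultimately have v01: "S $$ (0, 0) * v $ 0 + S $$ (0, 1) * v $ 1 = ?\<theta> * v $ 0"
    "S $$ (1, 0) * v $ 0 + S $$ (1, 1) * v $ 1 = ?\<theta> * v $ 1"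
    by (metis zero_less_numeral, metis one_less_numeral_iff semiring_norm(76))
  have k: "real n * (real (card A) - 1) = ?\<theta> + 2 * real (card A)"
    by (simp add: hamming_eigenvalue_def algebra_simps)
  have q: "real (card A) > 0" using A by (simp add: card_gt_0_iff)
  have "v $ 0 \<noteq> v $ 1"
  proof
    assume eq: "v $ 0 = v $ 1"
    have "(S $$ (0, 0) + S $$ (0, 1)) * v $ 0 = ?\<theta> * v $ 0" using v01(1) eq by (simp add: algebra_simps)
    then have "v $ 0 = 0" using nb(3) k q by simp
    then have "v = 0\<^sub>v 2" using v(1) eq by (auto simp: less_2_cases_iff)
    then show False using v(2) by blast
  qed
  moreover have "(S $$ (0, 0) - S $$ (1, 0)) * (v $ 0 - v $ 1) = ?\<theta> * (v $ 0 - v $ 1)"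
  proof -
    have e: "S $$ (0, 1) = S $$ (1, 0) + S $$ (1, 1) - S $$ (0, 0)" using nb(3,4) by simp
    have "(S $$ (0, 0) - S $$ (1, 0)) * (v $ 0 - v $ 1)
        = (S $$ (0, 0) * v $ 0 + S $$ (0, 1) * v $ 1) - (S $$ (1, 0) * v $ 0 + S $$ (1, 1) * v $ 1)"
      unfolding e by (simp add: algebra_simps)
    then show ?thesis unfolding v01 by (simp add: right_diff_distrib)
  qed
  ultimately have \<theta>: "S $$ (0, 0) - S $$ (1, 0) = ?\<theta>" by simp
  \<comment> \<open>The shift is chosen so that \<open>2 * card A\<close> times it is the neighbour
    count \<open>S $$ (1, 0)\<close> outside \<open>C\<close>.\<close>
  have "second_eigenfunction {1..n} A (\<lambda>x. word_indicator n C x - S $$ (1, 0) / (2 * real (card A)))"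
    unfolding second_eigenfunction_indicator_iff[OF A(1) C]
    using nb(1,2) \<theta> q by auto
  then show thesis by (rule that)
qed

lemma equitable_if_neighbours:
  assumes A: "finite A" "A \<noteq> {}" and C: "two_partition (words n A) C"
    and inC: "\<And>x. x \<in> C \<Longrightarrow> real (card {y \<in> C. hamming_adj n x y}) = c + hamming_eigenvalue 2 n (card A)"
    and outC: "\<And>x. x \<in> words n A - C \<Longrightarrow> real (card {y \<in> C. hamming_adj n x y}) = c"
  shows "equitable_2_partition_with_eigenvalue (words n A) (hamming_adj n) C
      (hamming_eigenvalue 2 n (card A))"
proof -
  let ?\<theta> = "hamming_eigenvalue 2 n (card A)"
  define k where "k = real n * (real (card A) - 1)"
  define S where "S = mat 2 2 (\<lambda>(i, j). let d = (if i = 0 then c + ?\<theta> else c) in if j = 0 then d else k - d)"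
  have C': "C \<subseteq> words n A" using C by (simp add: two_partition_def)
  have split: "real (card {y \<in> words n A - C. hamming_adj n x y}) = k - real (card {y \<in> C. hamming_adj n x y})"
    if "x \<in> words n A" for x
    using card_neighbours_compl[OF A(1) C' that] by (simp add: k_def)
  have "equitable_2_partition (words n A) (hamming_adj n) C S"
    unfolding equitable_2_partition_def
  proof (intro conjI allI impI ballI)
    show "real (card {y \<in> cell (words n A) C j. hamming_adj n x y}) = S $$ (i, j)"
      if "i < 2" "j < 2" "x \<in> cell (words n A) C i" for i j x
      using that inC[of x] outC[of x] split[of x] C'
      by (auto simp: S_def cell_def less_2_cases_iff split: if_splits)
  qed (simp_all add: C S_def)
  moreover have "eigenvalue S ?\<theta>"
  proof -
    \<comment> \<open>The off-diagonal entries of \<open>S\<close>, the second one negated: an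
      eigenvector for \<open>S $$ (0, 0) - S $$ (1, 0)\<close> whenever the row sums agree. It is
      nonzero because \<open>k\<close> exceeds the eigenvalue.\<close>
    define v where "v = vec 2 (\<lambda>i. if i = 0 then k - c - ?\<theta> else - c)"
    have k: "k = ?\<theta> + 2 * real (card A)"
      by (simp add: k_def hamming_eigenvalue_def algebra_simps)
    have q: "real (card A) > 0" using A by (simp add: card_gt_0_iff)
    have "v \<noteq> 0\<^sub>v 2"
    proof
      assume "v = 0\<^sub>v 2"
      then have "v $ 0 = 0" "v $ 1 = 0" by simp_all
      then show False using k q by (simp add: v_def)
    qed
    moreover have "S *\<^sub>v v = ?\<theta> \<cdot>\<^sub>v v"
    proof (rule eq_vecI)
      fix i assume "i < dim_vec (?\<theta> \<cdot>\<^sub>v v)"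
      then have "i = 0 \<or> i = 1" by (auto simp: v_def)
      then show "(S *\<^sub>v v) $ i = (?\<theta> \<cdot>\<^sub>v v) $ i"
        by (auto simp: S_def v_def scalar_prod_def numeral_2_eq_2 algebra_simps)
    qed (simp add: S_def v_def)
    ultimately show ?thesis
      unfolding eigenvalue_def eigenvector_def by (intro exI[of _ v]) (simp add: S_def v_def)
  qed
  ultimately show ?thesis by (auto simp: equitable_2_partition_with_eigenvalue_def)
qed

section \<open>Transport along automorphisms\<close>

lemma equitable_2_partition_image_iff:
  assumes bij: "bij_betw \<phi> V V" and adj: "\<And>x y. x \<in> V \<Longrightarrow> y \<in> V \<Longrightarrow> adj (\<phi> x) (\<phi> y) \<longleftrightarrow> adj x y"
    and C: "C \<subseteq> V"
  shows "equitable_2_partition V adj (\<phi> ` C) S \<longleftrightarrow> equitable_2_partition V adj C S"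
proof -
  have inj: "inj_on \<phi> V" and img: "\<phi> ` V = V" using bij by (auto simp: bij_betw_def)
  have compl: "V - \<phi> ` C = \<phi> ` (V - C)"
    using inj_on_image_set_diff[OF inj, of V C] C img by simp
  have part: "two_partition V (\<phi> ` C) \<longleftrightarrow> two_partition V C"
    unfolding two_partition_def compl using C img by auto
  have cells: "cell V (\<phi> ` C) i = \<phi> ` cell V C i" "cell V C i \<subseteq> V" for i
    using compl C by (auto simp: cell_def)
  have card: "card {y \<in> cell V (\<phi> ` C) j. adj (\<phi> x) y} = card {y \<in> cell V C j. adj x y}"
    if x: "x \<in> V" for x j
  proof -
    have "{y \<in> cell V (\<phi> ` C) j. adj (\<phi> x) y} = \<phi> ` {y \<in> cell V C j. adj x y}"
      using adj[OF x] cells(2)[of j] unfolding cells(1) by blast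
    moreover have "inj_on \<phi> {y \<in> cell V C j. adj x y}"
      using inj cells(2)[of j] by (auto intro: inj_on_subset)
    ultimately show ?thesis by (simp add: card_image)
  qed
  have "(\<forall>x\<in>cell V (\<phi> ` C) i. real (card {y \<in> cell V (\<phi> ` C) j. adj x y}) = S $$ (i, j))
      \<longleftrightarrow> (\<forall>x\<in>cell V C i. real (card {y \<in> cell V C j. adj x y}) = S $$ (i, j))" for i j
  proof -
    have "(\<forall>x\<in>cell V (\<phi> ` C) i. real (card {y \<in> cell V (\<phi> ` C) j. adj x y}) = S $$ (i, j))
        \<longleftrightarrow> (\<forall>x\<in>cell V C i. real (card {y \<in> cell V (\<phi> ` C) j. adj (\<phi> x) y}) = S $$ (i, j))"
      unfolding cells(1) by blast
    also have "\<dots> \<longleftrightarrow> (\<forall>x\<in>cell V C i. real (card {y \<in> cell V C j. adj x y}) = S $$ (i, j))"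
    proof (rule ball_cong)
      fix x assume "x \<in> cell V C i"
      then have "x \<in> V" using cells(2) by blast
      then show "real (card {y \<in> cell V (\<phi> ` C) j. adj (\<phi> x) y}) = S $$ (i, j)
          \<longleftrightarrow> real (card {y \<in> cell V C j. adj x y}) = S $$ (i, j)"
        by (simp only: card)
    qed simp
    finally show ?thesis .
  qed
  then show ?thesis unfolding equitable_2_partition_def part by simp
qed

text \<open>\<open>permute_word\<close> reads coordinate \<open>\<sigma> i\<close> at position
  \<open>i\<close>, so disagreements move by the inverse of \<sigma>. Tracking the whole
  disagreement set serves both adjacency, through its size, and essential coordinates.\<close>

lemma hamming_automorphism:
  assumes A: "finite A" and \<sigma>: "\<sigma> permutes {1..n}" and \<tau>: "\<And>i. i \<in> {1..n} \<Longrightarrow> bij_betw (\<tau> i) A A"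
    and \<phi>_def: "\<phi> = (\<lambda>x. \<lambda>i\<in>{1..n}. \<tau> i (permute_word n \<sigma> x i))"
  shows "bij_betw \<phi> (words n A) (words n A)"
    and "\<And>x y. x \<in> words n A \<Longrightarrow> y \<in> words n A \<Longrightarrow>
      {j \<in> {1..n}. \<phi> x j \<noteq> \<phi> y j} = inv_into UNIV \<sigma> ` {j \<in> {1..n}. x j \<noteq> y j}"
proof -
  have \<phi>: "\<phi> x i = \<tau> i (x (\<sigma> i))" if "i \<in> {1..n}" for x i
    using that by (simp add: \<phi>_def permute_word_def)
  have \<sigma>i: "\<sigma> i \<in> {1..n} \<longleftrightarrow> i \<in> {1..n}" for i by (rule permutes_in_image[OF \<sigma>])
  have ne: "\<phi> x j \<noteq> \<phi> y j \<longleftrightarrow> x (\<sigma> j) \<noteq> y (\<sigma> j)"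
    if "x \<in> words n A" "y \<in> words n A" "j \<in> {1..n}" for x y j
  proof -
    have "\<sigma> j \<in> {1..n}" using \<sigma>i that by blast
    then have "x (\<sigma> j) \<in> A" "y (\<sigma> j) \<in> A" using that unfolding words_def by blast+
    then have "\<tau> j (x (\<sigma> j)) = \<tau> j (y (\<sigma> j)) \<longleftrightarrow> x (\<sigma> j) = y (\<sigma> j)"
      by (rule inj_on_eq_iff[OF bij_betw_imp_inj_on[OF \<tau>[OF that(3)]]])
    then show ?thesis using \<phi>[OF that(3)] by simp
  qed
  have mem: "\<phi> x \<in> words n A" if x: "x \<in> words n A" for x
    unfolding words_def
  proof (rule PiE_I)
    fix j assume j: "j \<in> {1..n}"
    then have "\<sigma> j \<in> {1..n}" using \<sigma>i by blast
    then have "x (\<sigma> j) \<in> A" using x unfolding words_def by blast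
    then show "\<phi> x j \<in> A" using \<phi>[OF j] \<tau>[OF j] by (auto simp: bij_betw_def)
  qed (auto simp: \<phi>_def)
  have inj: "inj_on \<phi> (words n A)"
  proof (rule inj_onI)
    fix x y assume x: "x \<in> words n A" and y: "y \<in> words n A" and eq: "\<phi> x = \<phi> y"
    show "x = y"
    proof (rule words_eqI[OF x y])
      fix i assume "i \<in> {1..n}"
      then have "inv_into UNIV \<sigma> i \<in> {1..n}" using permutes_in_image[OF permutes_inv[OF \<sigma>]] by blast
      then show "x i = y i" using ne[OF x y, of "inv_into UNIV \<sigma> i"] eq permutes_inverses(1)[OF \<sigma>] by simp
    qed
  qed
  show "bij_betw \<phi> (words n A) (words n A)"
    unfolding bij_betw_def using inj mem endo_inj_surj[OF finite_words[OF A] _ inj] by blast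
  show "{j \<in> {1..n}. \<phi> x j \<noteq> \<phi> y j} = inv_into UNIV \<sigma> ` {j \<in> {1..n}. x j \<noteq> y j}"
    if "x \<in> words n A" "y \<in> words n A" for x y
  proof -
    have "{j \<in> {1..n}. \<phi> x j \<noteq> \<phi> y j} = {j. \<sigma> j \<in> {j \<in> {1..n}. x j \<noteq> y j}}"
      using ne[OF that] \<sigma>i by blast
    also have "\<dots> = inv_into UNIV \<sigma> ` {j \<in> {1..n}. x j \<noteq> y j}"
      using bij_vimage_eq_inv_image[OF permutes_bij[OF \<sigma>]] by (simp only: vimage_def)
    finally show ?thesis .
  qed
qed

lemma hamming_equivalent_transfer:
  assumes A: "finite A" and eq: "hamming_equivalent n A C D" and C: "C \<subseteq> words n A"
  shows "equitable_2_partition (words n A) (hamming_adj n) D S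
      \<longleftrightarrow> equitable_2_partition (words n A) (hamming_adj n) C S"
    and "reduced n A C \<Longrightarrow> reduced n A D"
proof -
  obtain \<sigma> \<tau> where \<sigma>: "\<sigma> permutes {1..n}" and \<tau>: "\<And>i. i \<in> {1..n} \<Longrightarrow> bij_betw (\<tau> i) A A"
    and D': "D = (\<lambda>x. \<lambda>i\<in>{1..n}. \<tau> i (permute_word n \<sigma> x i)) ` C"
    using eq unfolding hamming_equivalent_def by blast
  define \<phi> where "\<phi> = (\<lambda>x. \<lambda>i\<in>{1..n}. \<tau> i (permute_word n \<sigma> x i))"
  have D: "D = \<phi> ` C" unfolding D' \<phi>_def ..
  have bij: "bij_betw \<phi> (words n A) (words n A)"
    and diff: "\<And>x y. x \<in> words n A \<Longrightarrow> y \<in> words n A \<Longrightarrow>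
      {j \<in> {1..n}. \<phi> x j \<noteq> \<phi> y j} = inv_into UNIV \<sigma> ` {j \<in> {1..n}. x j \<noteq> y j}"
    using hamming_automorphism[OF A \<sigma> \<tau> \<phi>_def] by blast+
  have inj\<sigma>: "inj (inv_into UNIV \<sigma>)" using permutes_inv[OF \<sigma>] by (rule permutes_inj)
  have "hamming_adj n (\<phi> x) (\<phi> y) \<longleftrightarrow> hamming_adj n x y" if "x \<in> words n A" "y \<in> words n A" for x y
    unfolding hamming_adj_def diff[OF that]
    by (simp add: card_image inj_on_subset[OF inj\<sigma>])
  then show "equitable_2_partition (words n A) (hamming_adj n) D S
      \<longleftrightarrow> equitable_2_partition (words n A) (hamming_adj n) C S"
    unfolding D by (intro equitable_2_partition_image_iff bij C)
  show "reduced n A D" if red: "reduced n A C"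
    unfolding reduced_def
  proof
    fix i assume "i \<in> {1..n}"
    then have "\<sigma> i \<in> {1..n}" using permutes_in_image[OF \<sigma>] by blast
    then obtain x y where xy: "x \<in> words n A" "y \<in> words n A"
      "{j \<in> {1..n}. x j \<noteq> y j} = {\<sigma> i}" "(x \<in> C) \<noteq> (y \<in> C)"
      using red unfolding reduced_def essential_def by blast
    have "{j \<in> {1..n}. \<phi> x j \<noteq> \<phi> y j} = {i}"
      unfolding diff[OF xy(1,2)] xy(3) using permutes_inverses(2)[OF \<sigma>] by simp
    moreover have "\<phi> x \<in> words n A" "\<phi> y \<in> words n A" using xy bij by (auto simp: bij_betw_def)
    moreover have "\<phi> x \<in> D \<longleftrightarrow> x \<in> C" if "x \<in> words n A" for x
      unfolding D by (rule inj_on_image_mem_iff[OF bij_betw_imp_inj_on[OF bij] that C])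
    ultimately show "essential n A D i"
      unfolding essential_def using xy by blast
  qed
qed

section \<open>Permutation switching\<close>

definition pair_word :: "'a \<Rightarrow> 'a \<Rightarrow> nat \<Rightarrow> 'a" where
  "pair_word s t = (\<lambda>i\<in>{1..2}. if i = 1 then s else t)"

section \<open>Maximal cliques in a union of rows\<close>

lemma atLeastAtMost_1_2: "{1..2::nat} = {1, 2}"
  by auto

lemma pair_word_simps [simp]: "pair_word s t (Suc 0) = s" "pair_word s t 2 = t"
  by (simp_all add: pair_word_def)

lemma pair_word_eq_iff: "pair_word s t = pair_word s' t' \<longleftrightarrow> s = s' \<and> t = t'"
proof
  assume "pair_word s t = pair_word s' t'"
  then have "pair_word s t (Suc 0) = pair_word s' t' (Suc 0)" "pair_word s t 2 = pair_word s' t' 2" by auto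
  then show "s = s' \<and> t = t'" by simp
qed simp

lemma pair_word_in_words: "pair_word s t \<in> words 2 A \<longleftrightarrow> s \<in> A \<and> t \<in> A"
  unfolding words_def atLeastAtMost_1_2 PiE_iff pair_word_def by auto

lemma words_2_cases:
  assumes "x \<in> words 2 A"
  obtains s t where "x = pair_word s t" "s \<in> A" "t \<in> A"
proof -
  have A: "x 1 \<in> A" "x 2 \<in> A" using assms unfolding words_def atLeastAtMost_1_2 PiE_iff by auto
  have "x = pair_word (x 1) (x 2)"
  proof (rule words_eqI[OF assms])
    show "pair_word (x 1) (x 2) \<in> words 2 A" using A by (simp add: pair_word_in_words)
    show "x i = pair_word (x 1) (x 2) i" if "i \<in> {1..2}" for i
      using that unfolding atLeastAtMost_1_2 by auto
  qed
  then show thesis using that A by blast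
qed

lemma hamming_adj_pair_word:
  "hamming_adj 2 (pair_word s t) (pair_word s' t') \<longleftrightarrow> (s = s') \<noteq> (t = t')"
proof -
  have "{i \<in> {1..2::nat}. pair_word s t i \<noteq> pair_word s' t' i}
      = (if s = s' then {} else {1}) \<union> (if t = t' then {} else {2})"
    unfolding atLeastAtMost_1_2 by auto
  then show ?thesis unfolding hamming_adj_def by auto
qed

text \<open>A vertex off the row has at most one neighbour in it, so a row with two vertices cannot
  be extended.\<close>

lemma maximal_clique_row:
  assumes "B \<subseteq> A" "s \<in> B" "t \<in> A" "t' \<in> A" "t \<noteq> t'"
  shows "maximal_clique_in (hamming_adj 2) {x \<in> words 2 A. x 1 \<in> B} (pair_word s ` A)"
  unfolding maximal_clique_in_def
proof (intro conjI allI impI)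
  show "pair_word s ` A \<subseteq> {x \<in> words 2 A. x 1 \<in> B}"
    using assms by (auto simp: pair_word_in_words)
  show "clique (hamming_adj 2) (pair_word s ` A)"
    by (auto simp: clique_def hamming_adj_pair_word pair_word_eq_iff)
  fix L assume L: "pair_word s ` A \<subseteq> L \<and> L \<subseteq> {x \<in> words 2 A. x 1 \<in> B} \<and> clique (hamming_adj 2) L"
  have "x \<in> pair_word s ` A" if x: "x \<in> L" for x
  proof -
    have "x \<in> words 2 A" using L x by blast
    then obtain a b where ab: "x = pair_word a b" "a \<in> A" "b \<in> A" by (rule words_2_cases)
    obtain u where u: "u \<in> A" "u \<noteq> b" using assms by metis
    have u_L: "pair_word s u \<in> L" using L u by blast
    have "x \<noteq> pair_word s u" using ab u by (simp add: pair_word_eq_iff)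
    then have "hamming_adj 2 x (pair_word s u)"
      using L x u_L unfolding clique_def by blast
    then have "a = s" using ab u by (auto simp: hamming_adj_pair_word)
    then show ?thesis using ab by blast
  qed
  then show "L = pair_word s ` A" using L by blast
qed

text \<open>Here two letters in \<open>B\<close> are required: over a singleton \<open>B\<close> the
  column is a single vertex of a row.\<close>

lemma maximal_clique_column:
  assumes "B \<subseteq> A" "t \<in> A" "s \<in> B" "s' \<in> B" "s \<noteq> s'"
  shows "maximal_clique_in (hamming_adj 2) {x \<in> words 2 A. x 1 \<in> B} ((\<lambda>s. pair_word s t) ` B)"
  unfolding maximal_clique_in_def
proof (intro conjI allI impI)
  show "(\<lambda>s. pair_word s t) ` B \<subseteq> {x \<in> words 2 A. x 1 \<in> B}"
    using assms by (auto simp: pair_word_in_words)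
  show "clique (hamming_adj 2) ((\<lambda>s. pair_word s t) ` B)"
    by (auto simp: clique_def hamming_adj_pair_word pair_word_eq_iff)
  fix L assume L: "(\<lambda>s. pair_word s t) ` B \<subseteq> L \<and> L \<subseteq> {x \<in> words 2 A. x 1 \<in> B} \<and> clique (hamming_adj 2) L"
  have "x \<in> (\<lambda>s. pair_word s t) ` B" if x: "x \<in> L" for x
  proof -
    have "x \<in> words 2 A" "x 1 \<in> B" using L x by blast+
    then obtain a b where ab: "x = pair_word a b" "a \<in> B" "b \<in> A"
      by (metis One_nat_def pair_word_simps(1) words_2_cases)
    obtain u where u: "u \<in> B" "u \<noteq> a" using assms by metis
    have u_L: "pair_word u t \<in> L" using L u by blast
    have "x \<noteq> pair_word u t" using ab u by (simp add: pair_word_eq_iff)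
    then have "hamming_adj 2 x (pair_word u t)"
      using L x u_L unfolding clique_def by blast
    then have "b = t" using ab u by (auto simp: hamming_adj_pair_word)
    then show ?thesis using ab by blast
  qed
  then show "L = (\<lambda>s. pair_word s t) ` B" using L by blast
qed

text \<open>Two vertices of a clique in different rows share a column, and no vertex off that column
  is adjacent to both; so a clique lies in a row or in a column.\<close>

lemma maximal_clique_cases:
  assumes K: "maximal_clique_in (hamming_adj 2) {x \<in> words 2 A. x 1 \<in> B} K"
    and B: "B \<subseteq> A" "B \<noteq> {}"
  obtains (row) s where "s \<in> B" "K = pair_word s ` A"
  | (column) t where "t \<in> A" "K = (\<lambda>s. pair_word s t) ` B"
proof -
  let ?W = "{x \<in> words 2 A. x 1 \<in> B}"
  have KW: "K \<subseteq> ?W" and cl: "clique (hamming_adj 2) K"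
    and max: "\<And>L. K \<subseteq> L \<Longrightarrow> L \<subseteq> ?W \<Longrightarrow> clique (hamming_adj 2) L \<Longrightarrow> L = K"
    using K unfolding maximal_clique_in_def by auto
  have elem: "\<exists>s\<in>B. \<exists>t\<in>A. x = pair_word s t" if "x \<in> K" for x
    using KW that by (metis (no_types, lifting) One_nat_def mem_Collect_eq pair_word_simps(1) subset_iff words_2_cases)
  have row_max: "K = pair_word s ` A" if s: "s \<in> B" "K \<subseteq> pair_word s ` A" for s
  proof (rule sym, rule max[OF s(2)])
    show "pair_word s ` A \<subseteq> ?W" using s B by (auto simp: pair_word_in_words)
    show "clique (hamming_adj 2) (pair_word s ` A)"
      by (auto simp: clique_def hamming_adj_pair_word pair_word_eq_iff)
  qed
  have col_max: "K = (\<lambda>s. pair_word s t) ` B" if t: "t \<in> A" "K \<subseteq> (\<lambda>s. pair_word s t) ` B" for t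
  proof (rule sym, rule max[OF t(2)])
    show "(\<lambda>s. pair_word s t) ` B \<subseteq> ?W" using t B by (auto simp: pair_word_in_words)
    show "clique (hamming_adj 2) ((\<lambda>s. pair_word s t) ` B)"
      by (auto simp: clique_def hamming_adj_pair_word pair_word_eq_iff)
  qed
  show thesis
  proof (cases "K = {}")
    case True
    obtain s where "s \<in> B" using B by blast
    then show thesis using row row_max True by blast
  next
    case False
    then obtain s t where st: "pair_word s t \<in> K" "s \<in> B" "t \<in> A" using elem by blast
    have adj: "(a = c) \<noteq> (b = d) \<or> a = c \<and> b = d"
      if "pair_word a b \<in> K" "pair_word c d \<in> K" for a b c d
    proof -
      have "pair_word a b = pair_word c d \<or> hamming_adj 2 (pair_word a b) (pair_word c d)"
        using cl that unfolding clique_def by blast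
      then show ?thesis by (auto simp: hamming_adj_pair_word pair_word_eq_iff)
    qed
    show thesis
    proof (cases "K \<subseteq> pair_word s ` A")
      case True
      then show thesis using row row_max st by blast
    next
      case False
      then obtain s' t' where s': "pair_word s' t' \<in> K" "s' \<noteq> s" "s' \<in> B" using elem by blast
      have "t' = t" using adj[OF st(1) s'(1)] s'(2) by blast
      have "K \<subseteq> (\<lambda>s. pair_word s t) ` B"
      proof
        fix x assume x: "x \<in> K"
        then obtain a b where ab: "x = pair_word a b" "a \<in> B" using elem by blast
        have "b = t" using adj[of a b s t] adj[of a b s' t] x ab st s' \<open>t' = t\<close> by blast
        then show "x \<in> (\<lambda>s. pair_word s t) ` B" using ab by blast
      qed
      then show thesis using column col_max st by blast
    qed
  qed
qed

text \<open>Closed form of the union of permuted cylinders: the first letter selects a class, and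
  the class \<open>i\<close> selects the coordinate \<open>i + 1\<close> that is read in place of
  the second one.\<close>

definition switching_set ::
    "nat \<Rightarrow> 'a set \<Rightarrow> (nat \<Rightarrow> 'a set) \<Rightarrow> (nat \<Rightarrow> 'a) set \<Rightarrow> (nat \<Rightarrow> 'a) set" where
  "switching_set n A P C
    = {z \<in> words n A. \<exists>i\<in>{1..n - 1}. z 1 \<in> P i \<and> pair_word (z 1) (z (i + 1)) \<in> C}"

section \<open>Switched sets\<close>

lemma permute_word_in_words:
  assumes "\<sigma> permutes {1..n}" "x \<in> words n A"
  shows "permute_word n \<sigma> x \<in> words n A"
  using assms permutes_in_image[OF assms(1)] unfolding words_def permute_word_def by fastforce

lemma permute_word_transpose_twice:
  assumes "a \<in> {1..n}" "b \<in> {1..n}" "x \<in> words n A"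
  shows "permute_word n (Transposition.transpose a b) (permute_word n (Transposition.transpose a b) x) = x"
proof -
  have p: "Transposition.transpose a b permutes {1..n}" using assms by (simp add: permutes_swap_id)
  show ?thesis
  proof (rule words_eqI[OF permute_word_in_words[OF p permute_word_in_words[OF p assms(3)]] assms(3)])
    fix i assume i: "i \<in> {1..n}"
    then have "Transposition.transpose a b i \<in> {1..n}" using permutes_in_image[OF p] by blast
    then show "permute_word n (Transposition.transpose a b) (permute_word n (Transposition.transpose a b) x) i = x i"
      using i by (simp add: permute_word_def)
  qed
qed

lemma switching_set_eq:
  assumes n: "2 \<le> n"
  shows "(\<Union>i\<in>{1..n - 1}. permute_word n (switching_perm i) `
      ({x \<in> words n A. x 1 \<in> P i} \<inter> cylinder n A C)) = switching_set n A P C"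
proof -
  \<comment> \<open>For \<open>i = 1\<close> this transposes 2 with itself, so the separate identity
    case disappears.\<close>
  have perm: "switching_perm i = Transposition.transpose 2 (i + 1)" for i
    by (cases "i = 1") (simp_all add: switching_perm_def numeral_2_eq_2)
  have "permute_word n (switching_perm i) ` ({x \<in> words n A. x 1 \<in> P i} \<inter> cylinder n A C)
      = {z \<in> words n A. z 1 \<in> P i \<and> pair_word (z 1) (z (i + 1)) \<in> C}" if i: "i \<in> {1..n - 1}" for i
  proof -
    have i': "2 \<in> {1..n}" "i + 1 \<in> {1..n}" "(1::nat) \<in> {1..n}" "Transposition.transpose 2 (i + 1) 1 = 1"
      using i n by (auto simp: Transposition.transpose_def)
    have p: "Transposition.transpose 2 (i + 1) permutes {1..n}" using i' by (simp add: permutes_swap_id)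
    let ?\<phi> = "permute_word n (switching_perm i)"
    have mem: "?\<phi> x \<in> words n A" if "x \<in> words n A" for x
      unfolding perm using permute_word_in_words[OF p that] .
    have val: "?\<phi> x 1 = x 1" "?\<phi> x (i + 1) = x 2" "?\<phi> x 2 = x (i + 1)" for x :: "nat \<Rightarrow> 'a"
      using i' by (auto simp: permute_word_def perm)
    have twice: "?\<phi> (?\<phi> x) = x" if "x \<in> words n A" for x
      unfolding perm using permute_word_transpose_twice[OF i'(1,2) that] .
    have restr: "restrict x {1, 2} = pair_word (x 1) (x 2)" for x :: "nat \<Rightarrow> 'a"
      unfolding pair_word_def atLeastAtMost_1_2 by (auto simp: restrict_def)
    show ?thesis
    proof (intro equalityI subsetI)
      fix z assume "z \<in> ?\<phi> ` ({x \<in> words n A. x 1 \<in> P i} \<inter> cylinder n A C)"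
      then obtain x where x: "x \<in> words n A" "x 1 \<in> P i" "pair_word (x 1) (x 2) \<in> C" "z = ?\<phi> x"
        unfolding cylinder_def restr by blast
      then show "z \<in> {z \<in> words n A. z 1 \<in> P i \<and> pair_word (z 1) (z (i + 1)) \<in> C}"
        using mem[OF x(1)] val[of x] by simp
    next
      fix z assume z: "z \<in> {z \<in> words n A. z 1 \<in> P i \<and> pair_word (z 1) (z (i + 1)) \<in> C}"
      then have "?\<phi> z \<in> {x \<in> words n A. x 1 \<in> P i} \<inter> cylinder n A C"
        using mem[of z] val[of z] by (simp add: cylinder_def restr del: One_nat_def)
      then show "z \<in> ?\<phi> ` ({x \<in> words n A. x 1 \<in> P i} \<inter> cylinder n A C)"
        using twice[of z] z by (metis (no_types, lifting) imageI mem_Collect_eq)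
    qed
  qed
  then show ?thesis by (auto simp: switching_set_def)
qed

lemma permutation_switching_iff:
  "permutation_switching n A M \<longleftrightarrow> 2 \<le> n \<and>
     (\<exists>P C \<rho>. (\<Union>i\<in>{1..n - 1}. P i) = A \<and> disjoint_family_on P {1..n - 1} \<and>
        (\<forall>i\<in>{1..n - 1}. P i \<noteq> {}) \<and> two_partition (words 2 A) C \<and>
        (\<forall>i\<in>{1..n - 1}. \<forall>K. maximal_clique_in (hamming_adj 2) {x \<in> words 2 A. x 1 \<in> P i} K \<longrightarrow>
           real (card (C \<inter> K)) / real (card K) = \<rho>) \<and>
        M = switching_set n A P C)"
proof (cases "2 \<le> n")
  case True
  show ?thesis unfolding permutation_switching_def switching_set_eq[OF True] by (simp only: ex_simps)
next
  case False
  then show ?thesis by (simp only: permutation_switching_def simp_thms)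
qed

text \<open>Every row of \<open>C\<close> has density \<rho>, but columns are controlled only over
  classes with two letters. Equitability of \<open>M\<close> excludes singleton classes; after that
  every vertex outside \<open>M\<close> has \<open>2 * q * \<rho>\<close> neighbours in
  \<open>M\<close>, and a vertex of \<open>M\<close> has the eigenvalue more.\<close>

lemma switching_second_eigenvalue:
  assumes A: "finite A" and sw: "permutation_switching n A M"
    and eq: "equitable_2_partition (words n A) (hamming_adj n) M S"
  shows "reduced n A M"
    and "equitable_2_partition_with_eigenvalue (words n A) (hamming_adj n) M
      (hamming_eigenvalue 2 n (card A))"
proof -
  obtain P C \<rho> where n: "2 \<le> n" and P_un: "(\<Union>i\<in>{1..n - 1}. P i) = A"
    and P_disj: "disjoint_family_on P {1..n - 1}" and P_ne': "\<forall>i\<in>{1..n - 1}. P i \<noteq> {}"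
    and C: "two_partition (words 2 A) C"
    and clq': "\<forall>i\<in>{1..n - 1}. \<forall>K. maximal_clique_in (hamming_adj 2) {x \<in> words 2 A. x 1 \<in> P i} K \<longrightarrow>
           real (card (C \<inter> K)) / real (card K) = \<rho>"
    and M: "M = switching_set n A P C"
    using sw unfolding permutation_switching_iff by (elim conjE exE) (rule that)
  note P_ne = P_ne'[rule_format] and clq = clq'[rule_format]
  define q where "q = real (card A)"
  obtain x1 where x1: "x1 \<in> C" "x1 \<in> words 2 A" using C by (auto simp: two_partition_def)
  obtain s1 t1 where st1: "s1 \<in> A" "t1 \<in> A" "pair_word s1 t1 \<in> C"
    using words_2_cases[OF x1(2)] x1(1) by blast
  obtain x2 where x2: "x2 \<notin> C" "x2 \<in> words 2 A" using C by (auto simp: two_partition_def)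
  obtain s2 t2 where st2: "s2 \<in> A" "t2 \<in> A" "pair_word s2 t2 \<notin> C"
    using words_2_cases[OF x2(2)] x2(1) by blast
  have two: "\<exists>t\<in>A. \<exists>t'\<in>A. t \<noteq> t'" using st1 st2 by metis
  have A_ne: "A \<noteq> {}" using st1 by blast
  have q: "q > 0" using A A_ne by (simp add: q_def card_gt_0_iff)
  have PA: "P i \<subseteq> A" if "i \<in> {1..n - 1}" for i using P_un that by blast
  have "\<exists>i\<in>{1..n - 1}. s \<in> P i" if "s \<in> A" for s using P_un that by blast
  then obtain \<kappa> where \<kappa>: "\<And>s. s \<in> A \<Longrightarrow> \<kappa> s \<in> {1..n - 1} \<and> s \<in> P (\<kappa> s)" by metis
  have \<kappa>_eq: "i = \<kappa> s" if "i \<in> {1..n - 1}" "s \<in> P i" for i s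
  proof (rule ccontr)
    assume ne: "i \<noteq> \<kappa> s"
    have "s \<in> A" using PA that by blast
    then have "P i \<inter> P (\<kappa> s) = {}" "s \<in> P (\<kappa> s)"
      using disjoint_family_onD[OF P_disj that(1) _ ne] \<kappa> by blast+
    then show False using that by blast
  qed
  define g where "g s t = (of_bool (pair_word s t \<in> C) :: real)" for s t
  have row: "(\<Sum>t\<in>A. g s t) = q * \<rho>" if s: "s \<in> A" for s
  proof -
    obtain t t' where "t \<in> A" "t' \<in> A" "t \<noteq> t'" using two by blast
    then have "maximal_clique_in (hamming_adj 2) {x \<in> words 2 A. x 1 \<in> P (\<kappa> s)} (pair_word s ` A)"
      using \<kappa>[OF s] PA by (intro maximal_clique_row) auto
    then have "real (card (C \<inter> pair_word s ` A)) / real (card (pair_word s ` A)) = \<rho>"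
      using clq \<kappa>[OF s] by blast
    moreover have "card (pair_word s ` A) = card A"
      by (intro card_image inj_onI) (simp add: pair_word_eq_iff)
    moreover have "C \<inter> pair_word s ` A = pair_word s ` {t \<in> A. pair_word s t \<in> C}" by auto
    moreover have "card (pair_word s ` {t \<in> A. pair_word s t \<in> C}) = card {t \<in> A. pair_word s t \<in> C}"
      by (intro card_image inj_onI) (simp add: pair_word_eq_iff)
    moreover have "real (card {t \<in> A. pair_word s t \<in> C}) = (\<Sum>t\<in>A. g s t)"
      using A by (simp add: g_def Int_def)
    ultimately show ?thesis using q by (simp add: q_def field_simps)
  qed
  have column: "(\<Sum>s\<in>P i. g s t) = real (card (P i)) * \<rho>"
    if i: "i \<in> {1..n - 1}" and t: "t \<in> A" and ss: "s \<in> P i" "s' \<in> P i" "s \<noteq> s'" for i t s s'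
  proof -
    have finP: "finite (P i)" using PA[OF i] A finite_subset by blast
    have "maximal_clique_in (hamming_adj 2) {x \<in> words 2 A. x 1 \<in> P i} ((\<lambda>s. pair_word s t) ` P i)"
      using PA[OF i] t ss by (intro maximal_clique_column) auto
    then have "real (card (C \<inter> (\<lambda>s. pair_word s t) ` P i)) / real (card ((\<lambda>s. pair_word s t) ` P i)) = \<rho>"
      using clq i by blast
    moreover have "card ((\<lambda>s. pair_word s t) ` P i) = card (P i)"
      by (intro card_image inj_onI) (simp add: pair_word_eq_iff)
    moreover have "C \<inter> (\<lambda>s. pair_word s t) ` P i = (\<lambda>s. pair_word s t) ` {s \<in> P i. pair_word s t \<in> C}" by auto
    moreover have "card ((\<lambda>s. pair_word s t) ` {s \<in> P i. pair_word s t \<in> C}) = card {s \<in> P i. pair_word s t \<in> C}"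
      by (intro card_image inj_onI) (simp add: pair_word_eq_iff)
    moreover have "real (card {s \<in> P i. pair_word s t \<in> C}) = (\<Sum>s\<in>P i. g s t)"
      using finP by (simp add: g_def Int_def)
    moreover have "real (card (P i)) > 0" using finP ss by (auto simp: card_gt_0_iff)
    ultimately show ?thesis by (simp add: field_simps)
  qed
  \<comment> \<open>One pair inside \<open>C\<close> and one outside put the common row density
    strictly between 0 and 1.\<close>
  have "0 < (\<Sum>t\<in>A. g s1 t)"
    using A st1 by (intro sum_pos2[of A t1]) (auto simp: g_def)
  then have \<rho>0: "\<rho> > 0" using row[OF st1(1)] q by (simp add: zero_less_mult_iff)
  have "(\<Sum>t\<in>A. g s2 t) < (\<Sum>t\<in>A. 1)"
    using A st2 by (intro sum_strict_mono_ex1) (auto simp: g_def)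
  then have \<rho>1: "\<rho> < 1" using row[OF st2(1)] q by (simp add: q_def)
  have mixed_row: "\<exists>t\<in>A. \<exists>t'\<in>A. pair_word s t \<in> C \<and> pair_word s t' \<notin> C" if s: "s \<in> A" for s
  proof (rule ccontr)
    assume "\<not> ?thesis"
    then have "(\<forall>t\<in>A. g s t = 0) \<or> (\<forall>t\<in>A. g s t = 1)" by (auto simp: g_def)
    then have "(\<Sum>t\<in>A. g s t) = 0 \<or> (\<Sum>t\<in>A. g s t) = q" by (auto simp: q_def)
    then show False using row[OF s] \<rho>0 \<rho>1 q by auto
  qed
  have M_iff: "x \<in> M \<longleftrightarrow> pair_word (x 1) (x (\<kappa> (x 1) + 1)) \<in> C" if x: "x \<in> words n A" for x
  proof -
    have "x 1 \<in> A" using x n by (auto simp: words_def)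
    then show ?thesis using \<kappa>[of "x 1"] \<kappa>_eq x unfolding M switching_set_def by blast
  qed
  define N where "N x = (\<Sum>s\<in>A. g s (x (\<kappa> s + 1)))" for x :: "nat \<Rightarrow> 'a"
  have MW: "M \<subseteq> words n A" by (auto simp: M switching_set_def)
  \<comment> \<open>Coordinate 1 contributes \<open>N x\<close>, the coordinate read for the letter
    \<open>x 1\<close> contributes a full row, and each of the other \<open>n - 2\<close>
    coordinates leaves membership unchanged.\<close>
  have deg: "real (card {y \<in> M. hamming_adj n x y})
      = N x + q * \<rho> + hamming_eigenvalue 2 n (card A) * of_bool (x \<in> M)"
    if x: "x \<in> words n A" for x
  proof -
    have x1: "x 1 \<in> A" using x n by (auto simp: words_def)
    define k where "k = \<kappa> (x 1) + 1"
    have k: "k \<in> {1..n}" "k \<noteq> 1" using \<kappa>[OF x1] by (auto simp: k_def)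
    have ind: "word_indicator n M (x(i := a)) = of_bool (x(i := a) \<in> M)" if "i \<in> {1..n}" "a \<in> A" for i a
      using restrict_word[OF words_upd[OF x that]] by (simp add: word_indicator_def)
    have c1: "coord_sum A 1 (word_indicator n M) x = N x"
      unfolding coord_sum_def N_def
    proof (rule sum.cong)
      fix a assume a: "a \<in> A"
      have "x(1 := a) \<in> words n A" using words_upd[OF x _ a] n by simp
      then have "x(1 := a) \<in> M \<longleftrightarrow> pair_word a (x (\<kappa> a + 1)) \<in> C"
        using M_iff[of "x(1 := a)"] \<kappa>[OF a] by simp
      then show "word_indicator n M (x(1 := a)) = g a (x (\<kappa> a + 1))"
        using ind[of 1 a] n a by (simp add: g_def)
    qed simp
    have ck: "coord_sum A k (word_indicator n M) x = q * \<rho>"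
    proof -
      have "coord_sum A k (word_indicator n M) x = (\<Sum>a\<in>A. g (x 1) a)"
        unfolding coord_sum_def
      proof (rule sum.cong)
        fix a assume a: "a \<in> A"
        have "x(k := a) \<in> words n A" using words_upd[OF x k(1) a] .
        then have "x(k := a) \<in> M \<longleftrightarrow> pair_word (x 1) a \<in> C"
          using M_iff[of "x(k := a)"] k by (simp add: k_def)
        then show "word_indicator n M (x(k := a)) = g (x 1) a"
          using ind[OF k(1) a] by (simp add: g_def)
      qed simp
      then show ?thesis using row[OF x1] by simp
    qed
    have ci: "coord_sum A i (word_indicator n M) x = q * of_bool (x \<in> M)" if i: "i \<in> {1..n} - {1, k}" for i
    proof -
      have "coord_sum A i (word_indicator n M) x = (\<Sum>a\<in>A. of_bool (x \<in> M))"
        unfolding coord_sum_def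
      proof (rule sum.cong)
        fix a assume a: "a \<in> A"
        have "x(i := a) \<in> words n A" using words_upd[OF x _ a] i by simp
        then have "x(i := a) \<in> M \<longleftrightarrow> x \<in> M"
          using M_iff[of "x(i := a)"] M_iff[OF x] i by (simp add: k_def)
        then show "word_indicator n M (x(i := a)) = of_bool (x \<in> M)"
          using ind[of i a] a i by simp
      qed simp
      then show ?thesis by (simp add: q_def)
    qed
    have "(\<Sum>i\<in>{1..n}. coord_sum A i (word_indicator n M) x)
        = (\<Sum>i\<in>{1..n} - {1, k}. coord_sum A i (word_indicator n M) x)
          + (\<Sum>i\<in>{1, k}. coord_sum A i (word_indicator n M) x)"
      using k n by (intro sum.subset_diff) auto
    also have "(\<Sum>i\<in>{1, k}. coord_sum A i (word_indicator n M) x) = N x + q * \<rho>"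
      using k c1 ck by simp
    also have "(\<Sum>i\<in>{1..n} - {1, k}. coord_sum A i (word_indicator n M) x)
        = (real n - 2) * (q * of_bool (x \<in> M))"
    proof -
      have "card ({1..n} - {1, k}) = n - 2" using k n by (simp add: card_Diff_subset)
      then have "real (card ({1..n} - {1, k})) = real n - 2" using n by simp
      then show ?thesis by (simp add: ci)
    qed
    finally show ?thesis
      using card_neighbours[OF A MW x] by (simp add: hamming_eigenvalue_def q_def algebra_simps)
  qed
  have nonsingle: "\<exists>s'\<in>P i. s' \<noteq> s" if i: "i \<in> {1..n - 1}" and s: "s \<in> P i" for i s
  proof (rule ccontr)
    assume "\<not> ?thesis"
    then have single: "s'' = s" if "s'' \<in> P i" for s'' using that by blast
    have sA: "s \<in> A" using PA i s by blast
    obtain s' where s': "s' \<in> A" "s' \<noteq> s" using two by metis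
    then have \<kappa>s': "\<kappa> s' \<noteq> i" using single \<kappa>[OF s'(1)] by blast
    obtain t t' where t: "t \<in> A" "t' \<in> A" "pair_word s t \<in> C" "pair_word s t' \<notin> C"
      using mixed_row[OF sA] by blast
    \<comment> \<open>The first letter avoids the singleton class, so changing coordinate
      \<open>i + 1\<close> keeps membership. Yet it changes \<open>N\<close> by 1 through the letter
      \<open>s\<close>: two vertices in the same part with different neighbour counts.\<close>
    define x where "x = (\<lambda>k\<in>{1..n}. if k = 1 then s' else t)"
    define y where "y = x(i + 1 := t')"
    have x: "x \<in> words n A" using s' t by (auto simp: x_def words_def)
    have y: "y \<in> words n A" unfolding y_def using i by (intro words_upd[OF x] t) auto
    have x1: "x 1 = s'" "y 1 = s'" using n i by (auto simp: x_def y_def)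
    have xM: "x \<in> M \<longleftrightarrow> y \<in> M"
      unfolding M_iff[OF x] M_iff[OF y] x1 using \<kappa>s' by (simp add: y_def)
    have "N x - N y = (\<Sum>a\<in>A. g a (x (\<kappa> a + 1)) - g a (y (\<kappa> a + 1)))"
      by (simp add: N_def sum_subtractf)
    also have "\<dots> = (\<Sum>a\<in>{s}. g a (x (\<kappa> a + 1)) - g a (y (\<kappa> a + 1)))"
    proof (rule sum.mono_neutral_right[OF A])
      show "\<forall>a\<in>A - {s}. g a (x (\<kappa> a + 1)) - g a (y (\<kappa> a + 1)) = 0"
      proof
        fix a assume a: "a \<in> A - {s}"
        then have "\<kappa> a \<noteq> i" using single \<kappa>[of a] by blast
        then show "g a (x (\<kappa> a + 1)) - g a (y (\<kappa> a + 1)) = 0" by (simp add: y_def)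
      qed
    qed (use sA in auto)
    also have "\<dots> = g s t - g s t'"
    proof -
      have "x (i + 1) = t" "y (i + 1) = t'" using i n by (auto simp: x_def y_def)
      then show ?thesis by (simp add: \<kappa>_eq[OF i s, symmetric])
    qed
    also have "\<dots> = 1" using t by (simp add: g_def)
    finally have "N x \<noteq> N y" by simp
    moreover have "real (card {z \<in> M. hamming_adj n x z}) = real (card {z \<in> M. hamming_adj n y z})"
      using equitable_neighbours(1,2)[OF eq A] xM x y by (cases "x \<in> M") auto
    ultimately show False using deg[OF x] deg[OF y] xM by simp
  qed
  have col: "(\<Sum>s\<in>P i. g s t) = real (card (P i)) * \<rho>" if i: "i \<in> {1..n - 1}" and t: "t \<in> A" for i t
    using column[OF i t] nonsingle[OF i] P_ne[OF i] by blast
  have N: "N x = q * \<rho>" if x: "x \<in> words n A" for x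
  proof -
    have disj: "\<forall>i\<in>{1..n - 1}. \<forall>j\<in>{1..n - 1}. i \<noteq> j \<longrightarrow> P i \<inter> P j = {}"
      using P_disj by (auto simp: disjoint_family_on_def)
    have fin: "\<forall>i\<in>{1..n - 1}. finite (P i)" using PA A finite_subset by blast
    have "N x = (\<Sum>s\<in>(\<Union>i\<in>{1..n - 1}. P i). g s (x (\<kappa> s + 1)))" by (simp only: N_def P_un)
    also have "\<dots> = (\<Sum>i\<in>{1..n - 1}. \<Sum>s\<in>P i. g s (x (\<kappa> s + 1)))"
      using fin disj by (intro sum.UNION_disjoint) auto
    also have "\<dots> = (\<Sum>i\<in>{1..n - 1}. real (card (P i)) * \<rho>)"
    proof (rule sum.cong)
      fix i assume i: "i \<in> {1..n - 1}"
      have "(\<Sum>s\<in>P i. g s (x (\<kappa> s + 1))) = (\<Sum>s\<in>P i. g s (x (i + 1)))"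
        using \<kappa>_eq[OF i] by (intro sum.cong) auto
      also have "x (i + 1) \<in> A" using x i by (auto simp: words_def)
      then have "(\<Sum>s\<in>P i. g s (x (i + 1))) = real (card (P i)) * \<rho>" by (rule col[OF i])
      finally show "(\<Sum>s\<in>P i. g s (x (\<kappa> s + 1))) = real (card (P i)) * \<rho>" .
    qed simp
    also have "\<dots> = real (card (\<Union>i\<in>{1..n - 1}. P i)) * \<rho>"
      using fin disj by (subst card_UN_disjoint) (auto simp: sum_distrib_right)
    finally show ?thesis by (simp only: P_un q_def)
  qed
  show "equitable_2_partition_with_eigenvalue (words n A) (hamming_adj n) M
      (hamming_eigenvalue 2 n (card A))"
  proof (rule equitable_if_neighbours[OF A A_ne])
    show "two_partition (words n A) M" using eq by (simp add: equitable_2_partition_def)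
    show "real (card {y \<in> M. hamming_adj n x y}) = 2 * q * \<rho> + hamming_eigenvalue 2 n (card A)" if "x \<in> M" for x
      using deg[of x] N[of x] that MW by auto
    show "real (card {y \<in> M. hamming_adj n x y}) = 2 * q * \<rho>" if "x \<in> words n A - M" for x
      using deg[of x] N[of x] that by auto
  qed
  show "reduced n A M"
    unfolding reduced_def
  proof
    fix j assume j: "j \<in> {1..n}"
    define w where "w s t = (\<lambda>k\<in>{1..n}. if k = 1 then s else t)" for s t :: 'a
    have W: "w s t \<in> words n A" if "s \<in> A" "t \<in> A" for s t
      using that by (auto simp: words_def w_def)
    have w1: "w s t 1 = s" for s t using n by (simp add: w_def)
    have wi: "w s t (i + 1) = t" if "i \<in> {1..n - 1}" for s t i using that by (auto simp: w_def)
    show "essential n A M j"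
    proof (cases "j = 1")
      case True
      obtain t t' where t: "t \<in> A" "pair_word s1 t \<in> C" using mixed_row[OF st1(1)] by blast
      define i where "i = \<kappa> s1"
      have i: "i \<in> {1..n - 1}" "s1 \<in> P i" using \<kappa>[OF st1(1)] by (auto simp: i_def)
      have fin: "finite (P i)" using PA[OF i(1)] A finite_subset by blast
      \<comment> \<open>Within one class the coordinate that is read stays the same, so coordinate 1
        is essential once a column of density below 1 leaves \<open>C\<close>.\<close>
      have "\<exists>s'\<in>P i. pair_word s' t \<notin> C"
      proof (rule ccontr)
        assume "\<not> ?thesis"
        then have "(\<Sum>s\<in>P i. g s t) = real (card (P i))" by (simp add: g_def)
        then have "real (card (P i)) * (1 - \<rho>) = 0" using col[OF i(1) t(1)] by (simp add: algebra_simps)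
        then show False using \<rho>1 fin i(2) by auto
      qed
      then obtain s' where s': "s' \<in> P i" "pair_word s' t \<notin> C" by blast
      have s'A: "s' \<in> A" "\<kappa> s' = i" using PA[OF i(1)] s' \<kappa>_eq[OF i(1) s'(1)] by auto
      let ?x = "w s1 t" and ?y = "w s' t"
      have x: "?x \<in> words n A" and y: "?y \<in> words n A" using W st1 t s'A by auto
      have "?x \<in> M" using M_iff[OF x] t unfolding w1 i_def[symmetric] wi[OF i(1)] by blast
      moreover have "?y \<notin> M" using M_iff[OF y] s' unfolding w1 s'A(2) wi[OF i(1)] by blast
      moreover have "s1 \<noteq> s'" using s' t by blast
      then have "{k \<in> {1..n}. ?x k \<noteq> ?y k} = {j}" using True n by (auto simp: w_def)
      ultimately show ?thesis unfolding essential_def using x y by blast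
    next
      case False
      define i where "i = j - 1"
      have i: "i \<in> {1..n - 1}" "j = i + 1" using False j by (auto simp: i_def)
      obtain s where s: "s \<in> P i" using P_ne[OF i(1)] by blast
      have sA: "s \<in> A" "\<kappa> s = i" using PA[OF i(1)] s \<kappa>_eq[OF i(1) s] by auto
      obtain t t' where t: "t \<in> A" "t' \<in> A" "pair_word s t \<in> C" "pair_word s t' \<notin> C"
        using mixed_row[OF sA(1)] by blast
      let ?x = "w s t"
      have x: "?x \<in> words n A" using W sA t by auto
      have y: "?x(j := t') \<in> words n A" using words_upd[OF x j t(2)] .
      have "?x \<in> M" using M_iff[OF x] t unfolding w1 sA(2) wi[OF i(1)] by blast
      moreover have "?x(j := t') \<notin> M"
      proof -
        have "(?x(j := t')) 1 = s" "(?x(j := t')) (i + 1) = t'" using False w1 i by auto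
        then show ?thesis using M_iff[OF y] t sA(2) by simp
      qed
      moreover have "{k \<in> {1..n}. ?x k \<noteq> (?x(j := t')) k} = {j}" using t j False by (auto simp: w_def)
      ultimately show ?thesis unfolding essential_def using x y by blast
    qed
  qed
qed

text \<open>For a fixed letter at the hub \<open>c\<close> at most one other coordinate is active,
  and by \<open>0 < \<rho> < 1\<close> exactly one. The active coordinate sorts the hub letters into
  the classes of a switching, and the indicator as a function of the hub letter and the active
  letter is the base set. A transposition brings the hub to position 1.\<close>

lemma switching_if_star:
  fixes A :: "'a set" and C :: "(nat \<Rightarrow> 'a) set"
  assumes deg: "boolean_degree_two {1..n} A f \<rho> (word_indicator n C)"
    and CW: "C \<subseteq> words n A" and c: "c \<in> {1..n}"
    and star: "\<And>k l. k \<in> {1..n} - {c} \<Longrightarrow> l \<in> {1..n} - {c} \<Longrightarrow> boolean_degree_two.flat A f k l"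
  shows "\<exists>M. permutation_switching n A M \<and> hamming_equivalent n A M C"
proof -
  interpret boolean_degree_two "{1..n}" A f \<rho> "word_indicator n C" by (rule deg)
  define q where "q = real (card A)"
  have q: "q > 0" using finA A_ne by (simp add: q_def card_gt_0_iff)
  let ?I = "{1..n}"
  have F: "word_indicator n C x = \<rho> + (\<Sum>j\<in>?I - {c}. f c j (x c) (x j))" if x: "x \<in> cube ?I A" for x
  proof -
    have "(\<Sum>k\<in>?I - {c}. \<Sum>l\<in>?I - {c}. f k l (x k) (x l)) = 0"
      using star x by (intro sum.neutral ballI) (auto simp: flat_def cube_def)
    then show ?thesis using F_expand[OF x c] by simp
  qed
  have unique: "j = k"
    if "j \<in> ?I - {c}" "k \<in> ?I - {c}" "s \<in> A" "t \<in> A" "t' \<in> A" "f c j s t \<noteq> 0" "f c k s t' \<noteq> 0" for j k s t t'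
  proof (rule ccontr)
    assume "j \<noteq> k"
    have "(\<lambda>_. s) \<in> cube ?I A" using that by (simp add: cube_def)
    from at_most_one_active[OF _ this star that(1,2) \<open>j \<noteq> k\<close>] c
    have "(\<forall>t\<in>A. f j c t s = 0) \<or> (\<forall>t\<in>A. f k c t s = 0)" by simp
    then show False using that sym[of j c] sym[of k c] by metis
  qed
  have F_row: "\<rho> + f c j s t \<in> {0, 1}"
    if "j \<in> ?I - {c}" "s \<in> A" "t \<in> A" "t' \<in> A" "f c j s t' \<noteq> 0" for j s t t'
  proof -
    define x where "x = (\<lambda>_. s)(j := t)"
    have x: "x \<in> cube ?I A" using that by (auto simp: x_def cube_def)
    have "f c k s s = 0" if "k \<in> ?I - {c} - {j}" for k
      using unique[of j k s t' s] that \<open>j \<in> _\<close> \<open>s \<in> A\<close> \<open>t' \<in> A\<close> \<open>f c j s t' \<noteq> 0\<close> by auto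
    then have "(\<Sum>k\<in>?I - {c} - {j}. f c k (x c) (x k)) = 0"
      using that by (intro sum.neutral) (auto simp: x_def)
    then have "word_indicator n C x = \<rho> + f c j s t"
      using F[OF x] that sum.remove[of "?I - {c}" j "\<lambda>k. f c k (x c) (x k)"] by (auto simp: x_def)
    then show ?thesis using F01[OF x] by simp
  qed
  \<comment> \<open>A nonzero row takes both signs, and adding \<rho> must give 1 at its positive
    and 0 at its negative values.\<close>
  have \<rho>: "0 < \<rho>" "\<rho> < 1"
  proof -
    obtain j s t where j: "j \<in> ?I" "s \<in> A" "t \<in> A" "f c j s t \<noteq> 0" using ess[OF c] by blast
    then have jc: "j \<in> ?I - {c}" using diag by auto
    obtain u v where "u \<in> A" "f c j s u > 0" "v \<in> A" "f c j s v < 0"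
      using zero_sum_signs[OF finA zero[OF c j(1,2)] j(3,4)] by metis
    then show "0 < \<rho>" "\<rho> < 1"
      using F_row[OF jc j(2) _ j(3,4), of u] F_row[OF jc j(2) _ j(3,4), of v] by auto
  qed
  define \<sigma> where "\<sigma> = Transposition.transpose c (1::nat)"
  have one: "1 \<in> ?I" using c by auto
  have \<sigma>_perm: "\<sigma> permutes ?I" unfolding \<sigma>_def using c one by (rule permutes_swap_id)
  have \<sigma>_twice: "\<sigma> (\<sigma> i) = i" for i by (simp add: \<sigma>_def)
  have \<sigma>_I: "\<sigma> i \<in> ?I \<longleftrightarrow> i \<in> ?I" for i by (rule permutes_in_image[OF \<sigma>_perm])
  have \<sigma>_1: "\<sigma> 1 = c" "\<sigma> c = 1" by (simp_all add: \<sigma>_def)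
  have \<sigma>_Suc: "\<sigma> (m + 1) \<in> ?I - {c}" if "m \<in> {1..n - 1}" for m
  proof -
    have "m + 1 \<in> ?I" "m + 1 \<noteq> 1" using that by auto
    then show ?thesis using \<sigma>_I \<sigma>_twice \<sigma>_1 by (metis Diff_iff singletonD)
  qed
  have \<sigma>_inj: "m = m'" if "\<sigma> (m + 1) = \<sigma> (m' + 1)" for m m'
    using \<sigma>_twice that by (metis add_right_cancel)
  have \<sigma>_surj: "\<exists>m\<in>{1..n - 1}. j = \<sigma> (m + 1)" if "j \<in> ?I - {c}" for j
  proof -
    have "\<sigma> j \<in> ?I" "\<sigma> j \<noteq> 1" using that \<sigma>_I \<sigma>_twice \<sigma>_1 by (metis Diff_iff, metis DiffE singletonI)
    then have "\<sigma> j - 1 \<in> {1..n - 1}" "j = \<sigma> (\<sigma> j - 1 + 1)" using \<sigma>_twice by auto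
    then show ?thesis by blast
  qed
  define P where "P m = {s \<in> A. \<exists>t\<in>A. f c (\<sigma> (m + 1)) s t \<noteq> 0}" for m
  define C2 where "C2 = {pair_word s t | s t. s \<in> A \<and> t \<in> A \<and>
    (\<exists>m\<in>{1..n - 1}. s \<in> P m \<and> \<rho> + f c (\<sigma> (m + 1)) s t = 1)}"
  have disj: "m = m'" if mm: "m \<in> {1..n - 1}" "m' \<in> {1..n - 1}" "s \<in> P m" "s \<in> P m'" for m m' s
  proof -
    obtain t t' where "t \<in> A" "t' \<in> A" "f c (\<sigma> (m + 1)) s t \<noteq> 0" "f c (\<sigma> (m' + 1)) s t' \<noteq> 0" "s \<in> A"
      using mm(3,4) unfolding P_def by blast
    then show ?thesis using unique[OF \<sigma>_Suc[OF mm(1)] \<sigma>_Suc[OF mm(2)]] \<sigma>_inj by blast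
  qed
  have C2_iff: "pair_word s t \<in> C2 \<longleftrightarrow> \<rho> + f c (\<sigma> (m + 1)) s t = 1"
    if "m \<in> {1..n - 1}" "s \<in> P m" "t \<in> A" for m s t
  proof
    assume "pair_word s t \<in> C2"
    then obtain m' where "m' \<in> {1..n - 1}" "s \<in> P m'" "\<rho> + f c (\<sigma> (m' + 1)) s t = 1"
      unfolding C2_def by (auto simp: pair_word_eq_iff)
    then show "\<rho> + f c (\<sigma> (m + 1)) s t = 1" using disj[OF that(1) _ that(2)] by blast
  next
    assume "\<rho> + f c (\<sigma> (m + 1)) s t = 1"
    moreover have "s \<in> A" using that by (simp add: P_def)
    ultimately show "pair_word s t \<in> C2" using that unfolding C2_def by blast
  qed
  have C2_val: "of_bool (pair_word s t \<in> C2) = \<rho> + f c (\<sigma> (m + 1)) s t"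
    if m: "m \<in> {1..n - 1}" "s \<in> P m" and t: "t \<in> A" for m s t
  proof -
    obtain t' where "s \<in> A" "t' \<in> A" "f c (\<sigma> (m + 1)) s t' \<noteq> 0" using m(2) unfolding P_def by blast
    then show ?thesis
      using F_row[OF \<sigma>_Suc[OF m(1)] _ t] C2_iff[OF m t] by auto
  qed
  \<comment> \<open>A hub letter without active coordinate would make the indicator equal to \<rho>,
    which is neither 0 nor 1.\<close>
  have P_cover: "\<exists>m\<in>{1..n - 1}. s \<in> P m" if s: "s \<in> A" for s
  proof (rule ccontr)
    assume neg: "\<not> ?thesis"
    have "f c j s s = 0" if j: "j \<in> ?I - {c}" for j
    proof -
      obtain m where "m \<in> {1..n - 1}" "j = \<sigma> (m + 1)" using \<sigma>_surj[OF j] by blast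
      then show ?thesis using neg s unfolding P_def by blast
    qed
    moreover have x: "(\<lambda>_. s) \<in> cube ?I A" using s by (simp add: cube_def)
    ultimately have "word_indicator n C (\<lambda>_. s) = \<rho>" using F[OF x] by simp
    then show False using F01[OF x] \<rho> by auto
  qed
  have PA: "P m \<subseteq> A" for m by (auto simp: P_def)
  have row: "real (card (C2 \<inter> pair_word s ` A)) / real (card (pair_word s ` A)) = \<rho>"
    if m: "m \<in> {1..n - 1}" "s \<in> P m" for m s
  proof -
    have s: "s \<in> A" using m by (simp add: P_def)
    have "card (pair_word s ` A) = card A"
      by (intro card_image inj_onI) (simp add: pair_word_eq_iff)
    moreover have "C2 \<inter> pair_word s ` A = pair_word s ` {t \<in> A. pair_word s t \<in> C2}" by auto
    moreover have "card (pair_word s ` {t \<in> A. pair_word s t \<in> C2}) = card {t \<in> A. pair_word s t \<in> C2}"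
      by (intro card_image inj_onI) (simp add: pair_word_eq_iff)
    moreover have "real (card {t \<in> A. pair_word s t \<in> C2}) = (\<Sum>t\<in>A. of_bool (pair_word s t \<in> C2))"
      using finA by (simp add: Int_def)
    moreover have "\<dots> = (\<Sum>t\<in>A. \<rho> + f c (\<sigma> (m + 1)) s t)"
      by (intro sum.cong refl C2_val m)
    moreover have "\<dots> = q * \<rho>"
      using zero[OF c _ s, of "\<sigma> (m + 1)"] \<sigma>_Suc[OF m(1)] by (simp add: sum.distrib q_def)
    ultimately show ?thesis using q by (simp add: q_def)
  qed
  have column: "real (card (C2 \<inter> (\<lambda>s. pair_word s t) ` P m)) / real (card ((\<lambda>s. pair_word s t) ` P m)) = \<rho>"
    if m: "m \<in> {1..n - 1}" "P m \<noteq> {}" and t: "t \<in> A" for m t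
  proof -
    have finP: "finite (P m)" using PA finA finite_subset by blast
    have "card ((\<lambda>s. pair_word s t) ` P m) = card (P m)"
      by (intro card_image inj_onI) (simp add: pair_word_eq_iff)
    moreover have "C2 \<inter> (\<lambda>s. pair_word s t) ` P m = (\<lambda>s. pair_word s t) ` {s \<in> P m. pair_word s t \<in> C2}" by auto
    moreover have "card ((\<lambda>s. pair_word s t) ` {s \<in> P m. pair_word s t \<in> C2}) = card {s \<in> P m. pair_word s t \<in> C2}"
      by (intro card_image inj_onI) (simp add: pair_word_eq_iff)
    moreover have "real (card {s \<in> P m. pair_word s t \<in> C2}) = (\<Sum>s\<in>P m. of_bool (pair_word s t \<in> C2))"
      using finP by (simp add: Int_def)
    moreover have "\<dots> = (\<Sum>s\<in>P m. \<rho> + f c (\<sigma> (m + 1)) s t)"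
      by (intro sum.cong refl C2_val m t)
    \<comment> \<open>Hub letters outside \<open>P m\<close> do not interact with this coordinate,
      so the column sum over the class is the full one, which is zero.\<close>
    moreover have "(\<Sum>s\<in>P m. f c (\<sigma> (m + 1)) s t) = (\<Sum>s\<in>A. f c (\<sigma> (m + 1)) s t)"
      using t by (intro sum.mono_neutral_left finA PA) (auto simp: P_def)
    moreover have "\<dots> = 0" using zero'[OF c _ t, of "\<sigma> (m + 1)"] \<sigma>_Suc[OF m(1)] by simp
    moreover have "real (card (P m)) > 0" using finP m by (simp add: card_gt_0_iff)
    ultimately show ?thesis by (simp add: sum.distrib)
  qed
  \<comment> \<open>\<open>ess\<close> gives this coordinate a partner, which in a star can only be
    the hub.\<close>
  have P_ne: "P m \<noteq> {}" if m: "m \<in> {1..n - 1}" for m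
  proof -
    let ?j = "\<sigma> (m + 1)"
    have j: "?j \<in> ?I - {c}" using \<sigma>_Suc[OF m] .
    then obtain k s t where k: "k \<in> ?I" "s \<in> A" "t \<in> A" "f ?j k s t \<noteq> 0" using ess[of ?j] by blast
    have "k = c" using star[OF j, of k] k unfolding flat_def by blast
    then have "t \<in> P m" using k sym[of ?j c s t] by (auto simp: P_def)
    then show ?thesis by blast
  qed
  have n: "2 \<le> n"
  proof -
    obtain s where "s \<in> A" using A_ne by blast
    then show ?thesis using P_cover[of s] by fastforce
  qed
  have part: "two_partition (words 2 A) C2"
  proof -
    obtain s where s: "s \<in> A" using A_ne by blast
    obtain m where m: "m \<in> {1..n - 1}" "s \<in> P m" using P_cover[OF s] by blast
    have r: "real (card (C2 \<inter> pair_word s ` A)) / real (card (pair_word s ` A)) = \<rho>" by (rule row[OF m])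
    have "C2 \<inter> pair_word s ` A \<noteq> {}"
    proof
      assume "C2 \<inter> pair_word s ` A = {}"
      then show False using r \<rho> by simp
    qed
    moreover have "\<not> pair_word s ` A \<subseteq> C2"
    proof
      assume "pair_word s ` A \<subseteq> C2"
      then have "C2 \<inter> pair_word s ` A = pair_word s ` A" by blast
      moreover have "card (pair_word s ` A) > 0" using finA A_ne by (simp add: card_gt_0_iff)
      ultimately show False using r \<rho> by simp
    qed
    moreover have "pair_word s ` A \<subseteq> words 2 A" using s by (auto simp: pair_word_in_words)
    moreover have "C2 \<subseteq> words 2 A" by (auto simp: C2_def pair_word_in_words)
    ultimately show ?thesis unfolding two_partition_def by blast
  qed
  define M where "M = switching_set n A P C2"
  have "permutation_switching n A M"
    unfolding permutation_switching_iff
  proof (intro conjI exI ballI allI impI)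
    show "2 \<le> n" by (rule n)
    show "(\<Union>i\<in>{1..n - 1}. P i) = A" using P_cover PA by blast
    show "disjoint_family_on P {1..n - 1}" unfolding disjoint_family_on_def using disj by blast
    show "two_partition (words 2 A) C2" by (rule part)
    show "M = switching_set n A P C2" by (rule M_def)
    fix m assume m: "m \<in> {1..n - 1}"
    show "P m \<noteq> {}" by (rule P_ne[OF m])
    fix K assume K: "maximal_clique_in (hamming_adj 2) {x \<in> words 2 A. x 1 \<in> P m} K"
    show "real (card (C2 \<inter> K)) / real (card K) = \<rho>"
      by (rule maximal_clique_cases[OF K PA P_ne[OF m]]) (use row[OF m] column[OF m P_ne[OF m]] in simp_all)
  qed
  moreover have "hamming_equivalent n A M C"
  proof -
    let ?\<phi> = "permute_word n \<sigma>"
    have mem: "?\<phi> z \<in> words n A" if "z \<in> words n A" for z by (rule permute_word_in_words[OF \<sigma>_perm that])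
    have twice: "?\<phi> (?\<phi> z) = z" if "z \<in> words n A" for z
      unfolding \<sigma>_def by (rule permute_word_transpose_twice[OF c one that])
    have M_iff: "z \<in> M \<longleftrightarrow> ?\<phi> z \<in> C" if z: "z \<in> words n A" for z
    proof -
      have z1: "z 1 \<in> A" using z one by (auto simp: words_def)
      obtain m where m: "m \<in> {1..n - 1}" "z 1 \<in> P m" using P_cover[OF z1] by blast
      have zm: "z (m + 1) \<in> A" using z m by (auto simp: words_def)
      have "z \<in> M \<longleftrightarrow> pair_word (z 1) (z (m + 1)) \<in> C2"
        unfolding M_def switching_set_def using z m disj by blast
      also have "\<dots> \<longleftrightarrow> \<rho> + f c (\<sigma> (m + 1)) (z 1) (z (m + 1)) = 1" by (rule C2_iff[OF m zm])
      also have "\<rho> + f c (\<sigma> (m + 1)) (z 1) (z (m + 1)) = word_indicator n C (?\<phi> z)"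
      proof -
        let ?j = "\<sigma> (m + 1)"
        have j: "?j \<in> ?I - {c}" by (rule \<sigma>_Suc[OF m(1)])
        have w: "?\<phi> z \<in> cube ?I A" using mem[OF z] by (simp add: words_iff)
        have wc: "?\<phi> z c = z 1" using c \<sigma>_1 by (simp add: permute_word_def)
        have wj: "?\<phi> z ?j = z (m + 1)" using j \<sigma>_twice by (simp add: permute_word_def)
        obtain t' where t': "t' \<in> A" "f c ?j (z 1) t' \<noteq> 0" using m(2) by (auto simp: P_def)
        have "f c k (z 1) (?\<phi> z k) = 0" if "k \<in> ?I - {c} - {?j}" for k
        proof -
          have "?\<phi> z k \<in> A" using w that by (auto simp: cube_def)
          then show ?thesis using unique[OF j _ z1 t'(1) _ t'(2), of k] that by auto
        qed
        then have "(\<Sum>k\<in>?I - {c} - {?j}. f c k (?\<phi> z c) (?\<phi> z k)) = 0"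
          unfolding wc by (intro sum.neutral) auto
        moreover have "(\<Sum>k\<in>?I - {c}. f c k (?\<phi> z c) (?\<phi> z k)) = f c ?j (?\<phi> z c) (?\<phi> z ?j)
            + (\<Sum>k\<in>?I - {c} - {?j}. f c k (?\<phi> z c) (?\<phi> z k))"
          using j by (intro sum.remove) auto
        ultimately show ?thesis using F[OF w] unfolding wc wj by simp
      qed
      also have "\<dots> = 1 \<longleftrightarrow> ?\<phi> z \<in> C"
        using restrict_word[OF mem[OF z]] by (simp add: word_indicator_def)
      finally show ?thesis .
    qed
    have MW: "M \<subseteq> words n A" by (auto simp: M_def switching_set_def)
    have "C = ?\<phi> ` M"
    proof (intro equalityI subsetI)
      fix w assume w: "w \<in> C"
      then have wW: "w \<in> words n A" using CW by blast
      then have "?\<phi> w \<in> M" using M_iff[OF mem[OF wW]] twice[OF wW] w by simp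
      then show "w \<in> ?\<phi> ` M" using twice[OF wW] by (metis imageI)
    next
      fix w assume "w \<in> ?\<phi> ` M"
      then show "w \<in> C" using M_iff MW by blast
    qed
    also have "\<dots> = (\<lambda>x. \<lambda>i\<in>?I. permute_word n \<sigma> x i) ` M"
      by (intro image_cong refl) (simp add: permute_word_def restrict_def fun_eq_iff)
    finally show ?thesis
      unfolding hamming_equivalent_def
      by (intro exI[of _ \<sigma>] exI[of _ "\<lambda>_ a. a"]) (use \<sigma>_perm in \<open>simp add: bij_betw_def\<close>)
  qed
  ultimately show ?thesis by blast
qed

section \<open>Lifted 8-cycles\<close>

lemma all_less_8_iff:
  "(\<forall>i<8. R i) \<longleftrightarrow> R 0 \<and> R 1 \<and> R 2 \<and> R 3 \<and> R 4 \<and> R 5 \<and> R 6 \<and> R (7::nat)"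
proof -
  have "{..<8::nat} = {0, 1, 2, 3, 4, 5, 6, 7}" by auto
  moreover have "(\<forall>i<8. R i) \<longleftrightarrow> (\<forall>i\<in>{..<8}. R i)" by (simp only: lessThan_iff Ball_def)
  ultimately show ?thesis by (simp only: ball_simps simp_thms)
qed

text \<open>Adding 7 is the predecessor modulo 8 without subtraction on \<open>nat\<close>; the
  proof is a finite check of all index pairs.\<close>

lemma cyclic_neighbours_8:
  assumes "i < 8" "j < (8::nat)"
  shows "(j = (i + 1) mod 8 \<or> i = (j + 1) mod 8) \<longleftrightarrow> j = (i + 1) mod 8 \<or> j = (i + 7) mod 8"
proof -
  have "\<forall>i<8. \<forall>j<8. (j = (i + 1) mod 8 \<or> i = (j + 1) mod 8)
      \<longleftrightarrow> j = (i + 1) mod 8 \<or> j = (i + 7) mod (8::nat)"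
    unfolding all_less_8_iff by simp
  then show ?thesis using assms by blast
qed

text \<open>Index form of the absence of squares in an 8-cycle: \<open>k\<close> would be a second
  common neighbour of the two neighbours of \<open>i\<close>.\<close>

lemma no_common_cyclic_neighbours_8:
  assumes "i < 8" "k < (8::nat)" "i \<noteq> k"
    and "k = ((i + 1) mod 8 + 1) mod 8 \<or> k = ((i + 1) mod 8 + 7) mod 8"
    and "k = ((i + 7) mod 8 + 1) mod 8 \<or> k = ((i + 7) mod 8 + 7) mod 8"
  shows False
proof -
  have "\<forall>i<8. \<forall>k<8. i \<noteq> k \<longrightarrow> \<not> ((k = ((i + 1) mod 8 + 1) mod 8 \<or> k = ((i + 1) mod 8 + 7) mod 8)
      \<and> (k = ((i + 7) mod 8 + 1) mod 8 \<or> k = ((i + 7) mod 8 + 7) mod (8::nat)))"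
    unfolding all_less_8_iff by simp
  then show ?thesis using assms by blast
qed

lemma induces_cycle_nonempty: "induces_cycle adj W m \<Longrightarrow> W \<noteq> {}"
  unfolding induces_cycle_def bij_betw_def by (metis image_is_empty lessThan_empty_iff not_numeral_le_zero bot_nat_def)

lemma induces_cycle_8_degree:
  assumes "induces_cycle adj W 8" "x \<in> W"
  shows "card {y \<in> W. adj x y} = 2"
proof -
  obtain c where c: "bij_betw c {..<8} W"
    and adj: "\<And>i j. i < (8::nat) \<Longrightarrow> j < (8::nat) \<Longrightarrow> adj (c i) (c j) \<longleftrightarrow> j = (i + 1) mod 8 \<or> i = (j + 1) mod 8"
    using assms(1) unfolding induces_cycle_def by blast
  obtain i where i: "i < 8" "x = c i" using c assms(2) by (auto simp: bij_betw_def)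
  have "{y \<in> W. adj x y} = c ` {j. j < 8 \<and> adj x (c j)}"
    using c by (auto simp: bij_betw_def)
  also have "{j. j < 8 \<and> adj x (c j)} = {j. j < 8 \<and> (j = (i + 1) mod 8 \<or> i = (j + 1) mod 8)}"
    using adj[OF i(1)] i(2) by blast
  also have "\<dots> = {(i + 1) mod 8, (i + 7) mod 8}"
  proof -
    have "j < 8 \<and> (j = (i + 1) mod 8 \<or> i = (j + 1) mod 8) \<longleftrightarrow> j \<in> {(i + 1) mod 8, (i + 7) mod 8}" for j
      using cyclic_neighbours_8[OF i(1), of j] by (cases "j < 8") auto
    then show ?thesis by blast
  qed
  finally have "{y \<in> W. adj x y} = c ` {(i + 1) mod 8, (i + 7) mod 8}" .
  moreover have "inj_on c {(i + 1) mod 8, (i + 7) mod 8}"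
    by (rule inj_on_subset[OF bij_betw_imp_inj_on[OF c]]) auto
  moreover have "\<forall>i<8. (i + 1) mod 8 \<noteq> (i + 7) mod (8::nat)"
    unfolding all_less_8_iff by simp
  then have "(i + 1) mod 8 \<noteq> (i + 7) mod 8" using i(1) by blast
  ultimately show ?thesis by (simp add: card_image)
qed

text \<open>Serves reducedness of the liftings: a bit that never mattered would produce a square
  inside the cycle.\<close>

lemma induces_cycle_8_no_square:
  assumes "induces_cycle adj W 8" and W: "a \<in> W" "b \<in> W" "c \<in> W" "d \<in> W"
    and "adj a b" "adj b c" "adj c d" "adj d a" and "a \<noteq> c" "b \<noteq> d"
  shows False
proof -
  obtain v where v: "bij_betw v {..<8} W"
    and adj: "\<And>i j. i < (8::nat) \<Longrightarrow> j < (8::nat) \<Longrightarrow> adj (v i) (v j) \<longleftrightarrow> j = (i + 1) mod 8 \<or> i = (j + 1) mod 8"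
    using assms(1) unfolding induces_cycle_def by blast
  have "\<exists>i<8. x = v i" if "x \<in> W" for x using v that by (auto simp: bij_betw_def)
  then obtain i j k l where ijkl: "i < 8" "j < 8" "k < 8" "l < 8" "a = v i" "b = v j" "c = v k" "d = v l"
    using W by metis
  have "j = (i + 1) mod 8 \<or> j = (i + 7) mod 8" "l = (i + 1) mod 8 \<or> l = (i + 7) mod 8"
    "k = (j + 1) mod 8 \<or> k = (j + 7) mod 8" "k = (l + 1) mod 8 \<or> k = (l + 7) mod 8"
    using assms(6-9) unfolding ijkl(5-8)
    by (simp_all only: adj ijkl(1-4) disj_commute cyclic_neighbours_8[symmetric])
  moreover have "i \<noteq> k" "j \<noteq> l" using assms(10,11) ijkl by auto
  ultimately show False using no_common_cyclic_neighbours_8[OF ijkl(1,3)] by blast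
qed

section \<open>Two complementary 8-cycles in the binary 4-cube\<close>

lemma atLeastAtMost_1_4: "{1..4::nat} = {1, 2, 3, 4}"
  by auto

definition word4 :: "nat \<Rightarrow> nat \<Rightarrow> nat \<Rightarrow> nat \<Rightarrow> nat \<Rightarrow> nat" where
  "word4 a b c d = (\<lambda>i\<in>{1..4}. if i = 1 then a else if i = 2 then b else if i = 3 then c else d)"

lemma word4_simps [simp]:
  "word4 a b c d (Suc 0) = a" "word4 a b c d 2 = b" "word4 a b c d 3 = c" "word4 a b c d 4 = d"
  by (simp_all add: word4_def)

lemma word4_eq_iff: "word4 a b c d = word4 a' b' c' d' \<longleftrightarrow> a = a' \<and> b = b' \<and> c = c' \<and> d = d'"
  using word4_simps by metis

lemma word4_in_words: "word4 a b c d \<in> words 4 B \<longleftrightarrow> a \<in> B \<and> b \<in> B \<and> c \<in> B \<and> d \<in> B"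
  unfolding words_def atLeastAtMost_1_4 PiE_iff word4_def by auto

lemma words_4_cases:
  assumes "x \<in> words 4 B"
  obtains a b c d where "x = word4 a b c d" "a \<in> B" "b \<in> B" "c \<in> B" "d \<in> B"
proof -
  have B: "x 1 \<in> B" "x 2 \<in> B" "x 3 \<in> B" "x 4 \<in> B"
    using assms unfolding words_def atLeastAtMost_1_4 PiE_iff by auto
  have "x = word4 (x 1) (x 2) (x 3) (x 4)"
  proof (rule words_eqI[OF assms])
    show "word4 (x 1) (x 2) (x 3) (x 4) \<in> words 4 B" using B by (simp add: word4_in_words)
    show "x i = word4 (x 1) (x 2) (x 3) (x 4) i" if "i \<in> {1..4}" for i
      using that unfolding atLeastAtMost_1_4 by auto
  qed
  then show thesis using that B by blast
qed

lemma hamming_adj_word4: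
  "hamming_adj 4 (word4 a b c d) (word4 a' b' c' d') \<longleftrightarrow>
    of_bool (a \<noteq> a') + of_bool (b \<noteq> b') + of_bool (c \<noteq> c') + of_bool (d \<noteq> d') = (1::nat)"
proof -
  have "card {i \<in> {1..4}. word4 a b c d i \<noteq> word4 a' b' c' d' i}
      = (\<Sum>i\<in>{1..4}. of_bool (word4 a b c d i \<noteq> word4 a' b' c' d' i))"
    by (simp add: Int_def)
  also have "\<dots> = of_bool (a \<noteq> a') + of_bool (b \<noteq> b') + of_bool (c \<noteq> c') + of_bool (d \<noteq> d')"
    unfolding atLeastAtMost_1_4 by simp
  finally show ?thesis by (simp only: hamming_adj_def)
qed

lemma induces_cycle_set:
  assumes "distinct xs" "length xs = m" "3 \<le> m"
    and "\<forall>i<m. \<forall>j<m. adj (xs ! i) (xs ! j) \<longleftrightarrow> j = (i + 1) mod m \<or> i = (j + 1) mod m"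
  shows "induces_cycle adj (set xs) m"
  unfolding induces_cycle_def
  using assms bij_betw_nth[OF assms(1) refl refl] by (intro conjI exI[of _ "(!) xs"]) auto

text \<open>With the bits 0 and 1 read as -1/2 and 1/2, these are the words \<open>abcd\<close> with
  \<open>1/2 + ab + ac + bd - cd = 1\<close>, the sign pattern of
  \<open>four_coordinates_form\<close>. If \<open>b = c\<close> the left-hand side is
  \<open>1/2 + 2ab\<close>, otherwise \<open>1/2 + 2bd\<close>.\<close>

definition base_cycle :: "(nat \<Rightarrow> nat) set" where
  "base_cycle = {x \<in> words 4 {0, 1}. if x 2 = x 3 then x 1 = x 2 else x 4 = x 2}"

lemma word4_in_base_cycle:
  "word4 a b c d \<in> base_cycle \<longleftrightarrow> {a, b, c, d} \<subseteq> {0, 1} \<and> (if b = c then a = b else d = b)"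
  by (simp add: base_cycle_def word4_in_words)

lemma induces_cycle_base_cycle: "induces_cycle (hamming_adj 4) base_cycle 8"
proof -
  \<comment> \<open>The list walks around the cycle, flipping one bit at a time.\<close>
  let ?xs = "[word4 0 0 0 0, word4 0 0 0 1, word4 0 1 0 1, word4 1 1 0 1,
    word4 1 1 1 1, word4 1 1 1 0, word4 1 0 1 0, word4 0 0 1 0]"
  have "induces_cycle (hamming_adj 4) (set ?xs) 8"
  proof (rule induces_cycle_set)
    show "\<forall>i<8. \<forall>j<8. hamming_adj 4 (?xs ! i) (?xs ! j) \<longleftrightarrow> j = (i + 1) mod 8 \<or> i = (j + 1) mod 8"
      unfolding all_less_8_iff by (simp add: hamming_adj_word4)
  qed (simp_all add: word4_eq_iff)
  moreover have "set ?xs = base_cycle"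
  proof (intro equalityI subsetI)
    fix x assume "x \<in> base_cycle"
    moreover from this have "x \<in> words 4 {0, 1}" by (simp add: base_cycle_def)
    then obtain a b c d where "x = word4 a b c d" by (rule words_4_cases)
    ultimately have x: "x = word4 a b c d" "word4 a b c d \<in> base_cycle" by simp_all
    then have "a = 0 \<or> a = 1" "b = 0 \<or> b = 1" "c = 0 \<or> c = 1" "d = 0 \<or> d = 1"
      by (simp_all add: word4_in_base_cycle)
    then show "x \<in> set ?xs" using x(2) unfolding x(1)
      by (elim disjE) (simp_all add: word4_in_base_cycle)
  qed (auto simp: word4_in_base_cycle)
  ultimately show ?thesis by simp
qed

lemma induces_cycle_base_cycle_compl: "induces_cycle (hamming_adj 4) (words 4 {0, 1} - base_cycle) 8"
proof -
  let ?xs = "[word4 1 0 0 0, word4 1 0 0 1, word4 1 0 1 1, word4 0 0 1 1,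
    word4 0 1 1 1, word4 0 1 1 0, word4 0 1 0 0, word4 1 1 0 0]"
  have "induces_cycle (hamming_adj 4) (set ?xs) 8"
  proof (rule induces_cycle_set)
    show "\<forall>i<8. \<forall>j<8. hamming_adj 4 (?xs ! i) (?xs ! j) \<longleftrightarrow> j = (i + 1) mod 8 \<or> i = (j + 1) mod 8"
      unfolding all_less_8_iff by (simp add: hamming_adj_word4)
  qed (simp_all add: word4_eq_iff)
  moreover have "set ?xs = words 4 {0, 1} - base_cycle"
  proof (intro equalityI subsetI)
    fix x assume "x \<in> words 4 {0, 1} - base_cycle"
    then have x: "x \<in> words 4 {0, 1}" "x \<notin> base_cycle" by simp_all
    obtain a b c d where abcd: "x = word4 a b c d" "a \<in> {0, 1}" "b \<in> {0, 1}" "c \<in> {0, 1}" "d \<in> {0, 1}"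
      using x(1) by (rule words_4_cases)
    then have "a = 0 \<or> a = 1" "b = 0 \<or> b = 1" "c = 0 \<or> c = 1" "d = 0 \<or> d = 1"
      by simp_all
    then show "x \<in> set ?xs" using x(2) unfolding abcd(1)
      by (elim disjE) (simp_all add: word4_in_base_cycle)
  qed (auto simp: word4_in_base_cycle word4_in_words)
  ultimately show ?thesis by simp
qed

section \<open>Lifting binary words to the alphabet\<close>

definition letter_class :: "'a set \<Rightarrow> 'a \<Rightarrow> nat" where
  "letter_class U a = of_bool (a \<in> U)"

definition word_class :: "'a set \<Rightarrow> (nat \<Rightarrow> 'a) \<Rightarrow> nat \<Rightarrow> nat" where
  "word_class U x = (\<lambda>i\<in>{1..4}. letter_class U (x i))"

lemma word_class_in_words: "word_class U x \<in> words 4 {0, 1}"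
  by (auto simp: words_def word_class_def letter_class_def)

text \<open>The lifting is the preimage of \<open>C\<close> under replacing each letter by its class
  bit, which allows its coordinate sums to be compared with binary ones.\<close>

lemma lifting_eq:
  assumes B: "B 0 \<union> B 1 = A" "B 0 \<inter> B 1 = {}" and C: "C \<subseteq> words 4 {0, 1}"
  shows "(\<Union>w\<in>C. \<Pi>\<^sub>E i\<in>{1..4}. B (w i)) = {x \<in> words 4 A. word_class (B 1) x \<in> C}"
proof -
  have *: "x \<in> (\<Pi>\<^sub>E i\<in>{1..4}. B (w i)) \<longleftrightarrow> x \<in> words 4 A \<and> word_class (B 1) x = w"
    if w: "w \<in> words 4 {0, 1}" for x w
  proof
    assume x: "x \<in> (\<Pi>\<^sub>E i\<in>{1..4}. B (w i))"
    have wi: "w i = 0 \<or> w i = 1" if "i \<in> {1..4}" for i using w that unfolding words_def by blast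
    have xi: "x i \<in> B (w i)" if "i \<in> {1..4}" for i using x that by blast
    have "x \<in> words 4 A"
      unfolding words_def
    proof (rule PiE_I)
      show "x i \<in> A" if "i \<in> {1..4}" for i using wi[OF that] xi[OF that] B by auto
      show "x i = undefined" if "i \<notin> {1..4}" for i using x that by (rule PiE_arb)
    qed
    moreover have "word_class (B 1) x = w"
    proof (rule words_eqI[OF word_class_in_words w])
      show "word_class (B 1) x i = w i" if "i \<in> {1..4}" for i
        using wi[OF that] xi[OF that] B that by (auto simp: word_class_def letter_class_def)
    qed
    ultimately show "x \<in> words 4 A \<and> word_class (B 1) x = w" ..
  next
    assume x: "x \<in> words 4 A \<and> word_class (B 1) x = w"
    show "x \<in> (\<Pi>\<^sub>E i\<in>{1..4}. B (w i))"
    proof (rule PiE_I)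
      fix i :: nat assume i: "i \<in> {1..4}"
      have "x i \<in> A" using x i by (auto simp: words_def)
      moreover have "w i = letter_class (B 1) (x i)" using x i by (auto simp: word_class_def)
      ultimately show "x i \<in> B (w i)" using B by (auto simp: letter_class_def)
    next
      show "x i = undefined" if "i \<notin> {1..4}" for i using x that unfolding words_def by blast
    qed
  qed
  show ?thesis
  proof (intro equalityI subsetI)
    fix x assume "x \<in> (\<Union>w\<in>C. \<Pi>\<^sub>E i\<in>{1..4}. B (w i))"
    then obtain w where w: "w \<in> C" "x \<in> (\<Pi>\<^sub>E i\<in>{1..4}. B (w i))" by (rule UN_E)
    then have "w \<in> words 4 {0, 1}" using C by blast
    from *[OF this, of x] w show "x \<in> {x \<in> words 4 A. word_class (B 1) x \<in> C}" by simp
  next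
    fix x assume x: "x \<in> {x \<in> words 4 A. word_class (B 1) x \<in> C}"
    then have "x \<in> (\<Pi>\<^sub>E i\<in>{1..4}. B (word_class (B 1) x i))"
      using *[OF word_class_in_words, of x "B 1" x] by simp
    then show "x \<in> (\<Union>w\<in>C. \<Pi>\<^sub>E i\<in>{1..4}. B (w i))" using x by (intro UN_I) auto
  qed
qed

text \<open>Each bit stands for \<open>card A / 2\<close> letters, so coordinate sums of the lifting
  are \<open>card A / 2\<close> times those of the cycle, and every vertex of the binary 4-cube has
  exactly two neighbours in \<open>C\<close>.\<close>

lemma lifting_second_eigenvalue:
  assumes A: "finite A" "A \<noteq> {}" and lift: "alphabet_lifting_8_cycles A D"
  shows "reduced 4 A D"
    and "equitable_2_partition_with_eigenvalue (words 4 A) (hamming_adj 4) D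
      (hamming_eigenvalue 2 4 (card A))"
proof -
  obtain B :: "nat \<Rightarrow> 'a set" and C where B: "B 0 \<union> B 1 = A" "B 0 \<inter> B 1 = {}" "card (B 0) = card (B 1)"
    and C: "C \<subseteq> words 4 {0, 1}" and cyc: "induces_cycle (hamming_adj 4) C 8"
      "induces_cycle (hamming_adj 4) (words 4 {0, 1} - C) 8"
    and D: "D = (\<Union>x\<in>C. (\<Pi>\<^sub>E i\<in>{1..4}. B (x i)))"
    using lift unfolding alphabet_lifting_8_cycles_def by (elim exE conjE) (rule that)
  let ?Q = "words 4 {0, 1::nat}"
  let ?p = "word_class (B 1)"
  have D_eq: "D = {x \<in> words 4 A. ?p x \<in> C}" unfolding D by (rule lifting_eq[OF B(1,2) C])
  then have DW: "D \<subseteq> words 4 A" by blast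
  have D_iff: "x \<in> D \<longleftrightarrow> ?p x \<in> C" if "x \<in> words 4 A" for x using that D_eq by blast
  have finB: "finite (B 0)" "finite (B 1)" using B A by (auto intro: finite_subset)
  have h: "card A = 2 * card (B 1)" using card_Un_disjoint[OF finB B(2)] B by simp
  have "card A > 0" using A by (simp add: card_gt_0_iff)
  then have "card (B 0) > 0" "card (B 1) > 0" using h B(3) by linarith+
  then obtain b0 b1 where b: "b0 \<in> B 0" "b1 \<in> B 1" by (metis card_gt_0_iff ex_in_conv)
  define lft where "lft w = (\<lambda>i\<in>{1..4}. if w i = 1 then b1 else b0)" for w :: "nat \<Rightarrow> nat"
  have lft_words: "lft w \<in> words 4 A" for w
    using b B by (auto simp: lft_def words_def)
  have p_lft: "?p (lft w) = w" if w: "w \<in> ?Q" for w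
  proof (rule words_eqI[OF word_class_in_words w])
    fix i :: nat assume i: "i \<in> {1..4}"
    then have "w i = 0 \<or> w i = 1" using w unfolding words_def by blast
    moreover have "b0 \<notin> B 1" using b B by blast
    ultimately show "?p (lft w) i = w i"
      using i b by (auto simp: word_class_def letter_class_def lft_def)
  qed
  have p_upd: "?p (x(i := a)) = (?p x)(i := letter_class (B 1) a)" if "i \<in> {1..4}" for x i a
    using that by (auto simp: word_class_def)
  have fin2: "finite {0, 1::nat}" by simp
  have nb: "card {y \<in> C. hamming_adj 4 w y} = 2" if w: "w \<in> ?Q" for w
  proof (cases "w \<in> C")
    case True
    then show ?thesis by (rule induces_cycle_8_degree[OF cyc(1)])
  next
    case False
    \<comment> \<open>A vertex off \<open>C\<close> has two of its four neighbours on the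
      complementary cycle, hence the other two in \<open>C\<close>.\<close>
    have "card {y \<in> ?Q - C. hamming_adj 4 w y} = 2"
      using induces_cycle_8_degree[OF cyc(2)] w False by blast
    then show ?thesis using card_neighbours_compl[OF fin2 C w] by simp
  qed
  have sum_C: "(\<Sum>i\<in>{1..4}. coord_sum {0, 1} i (word_indicator 4 C) w) = 2 + 4 * of_bool (w \<in> C)"
    if w: "w \<in> ?Q" for w
    using card_neighbours[OF fin2 C w] nb[OF w] by simp
  have deg: "real (card {y \<in> D. hamming_adj 4 x y})
      = real (card A) + hamming_eigenvalue 2 4 (card A) * of_bool (x \<in> D)" if x: "x \<in> words 4 A" for x
  proof -
    have "coord_sum A i (word_indicator 4 D) x
        = real (card (B 1)) * coord_sum {0, 1} i (word_indicator 4 C) (?p x)" if i: "i \<in> {1..4}" for i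
    proof -
      have ind: "word_indicator 4 D (x(i := a)) = word_indicator 4 C ((?p x)(i := letter_class (B 1) a))"
        if a: "a \<in> A" for a
      proof -
        have y: "x(i := a) \<in> words 4 A" using words_upd[OF x i a] .
        show ?thesis
          unfolding word_indicator_def restrict_word[OF y] p_upd[OF i, symmetric]
            restrict_word[OF word_class_in_words] D_iff[OF y] ..
      qed
      have "coord_sum A i (word_indicator 4 D) x
          = (\<Sum>a\<in>A. word_indicator 4 C ((?p x)(i := letter_class (B 1) a)))"
        unfolding coord_sum_def by (intro sum.cong refl ind)
      also have "\<dots> = (\<Sum>a\<in>B 0. word_indicator 4 C ((?p x)(i := letter_class (B 1) a)))
          + (\<Sum>a\<in>B 1. word_indicator 4 C ((?p x)(i := letter_class (B 1) a)))"
        unfolding B(1)[symmetric] by (rule sum.union_disjoint[OF finB B(2)])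
      also have "(\<Sum>a\<in>B 0. word_indicator 4 C ((?p x)(i := letter_class (B 1) a)))
          = (\<Sum>a\<in>B 0. word_indicator 4 C ((?p x)(i := 0)))"
        using B(2) by (intro sum.cong refl arg_cong[where f = "word_indicator 4 C"])
          (auto simp: letter_class_def)
      also have "(\<Sum>a\<in>B 1. word_indicator 4 C ((?p x)(i := letter_class (B 1) a)))
          = (\<Sum>a\<in>B 1. word_indicator 4 C ((?p x)(i := 1)))"
        by (intro sum.cong refl arg_cong[where f = "word_indicator 4 C"]) (auto simp: letter_class_def)
      finally show ?thesis
        unfolding coord_sum_def by (simp add: B(3) distrib_left del: fun_upd_apply)
    qed
    then have "(\<Sum>i\<in>{1..4}. coord_sum A i (word_indicator 4 D) x)
        = real (card (B 1)) * (\<Sum>i\<in>{1..4}. coord_sum {0, 1} i (word_indicator 4 C) (?p x))"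
      by (simp add: sum_distrib_left)
    also have "\<dots> = real (card (B 1)) * (2 + 4 * of_bool (x \<in> D))"
      by (simp only: sum_C[OF word_class_in_words] D_iff[OF x])
    finally show ?thesis
      using card_neighbours[OF A(1) DW x] h by (simp add: hamming_eigenvalue_def algebra_simps)
  qed
  have "C \<noteq> {}" "?Q - C \<noteq> {}" using cyc by (auto dest: induces_cycle_nonempty)
  then obtain w w' where w: "w \<in> C" "w' \<in> ?Q - C" by blast
  have "lft w \<in> D" "lft w' \<in> words 4 A - D"
    using w C p_lft lft_words D_iff by auto
  then have part: "two_partition (words 4 A) D" using DW unfolding two_partition_def by blast
  show "equitable_2_partition_with_eigenvalue (words 4 A) (hamming_adj 4) D
      (hamming_eigenvalue 2 4 (card A))"
  proof (rule equitable_if_neighbours[OF A part])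
    show "real (card {y \<in> D. hamming_adj 4 x y}) = real (card A) + hamming_eigenvalue 2 4 (card A)"
      if "x \<in> D" for x using deg[of x] that DW by auto
    show "real (card {y \<in> D. hamming_adj 4 x y}) = real (card A)" if "x \<in> words 4 A - D" for x
      using deg[of x] that by auto
  qed
  show "reduced 4 A D"
    unfolding reduced_def
  proof
    fix i :: nat assume i: "i \<in> {1..4}"
    have flip_Q: "u(i := 1 - u i) \<in> ?Q" if "u \<in> ?Q" for u
      by (rule words_upd[OF that i]) auto
    have flip_ne: "1 - u j \<noteq> u j" if "u \<in> ?Q" "j \<in> {1..4}" for u j
    proof -
      have "u j = 0 \<or> u j = 1" using that unfolding words_def by blast
      then show ?thesis by auto
    qed
    \<comment> \<open>If flipping bit \<open>i\<close> preserved \<open>C\<close>, an edge of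
      \<open>C\<close> in another direction and its flipped copy would close a square.\<close>
    have "\<exists>u\<in>C. u(i := 1 - u i) \<notin> C"
    proof (rule ccontr)
      assume "\<not> ?thesis"
      then have closed: "u(i := 1 - u i) \<in> C" if "u \<in> C" for u using that by blast
      have wQ: "w \<in> ?Q" using w C by blast
      have adj_flip: "hamming_adj 4 u (u(i := 1 - u i))" if "u \<in> ?Q" for u
        unfolding hamming_adj_iff[OF that flip_Q[OF that]]
        using i flip_ne[OF that i] by (intro bexI[of _ i]) auto
      have "card {y \<in> C. hamming_adj 4 w y} = 2" by (rule nb[OF wQ])
      then have "\<not> {y \<in> C. hamming_adj 4 w y} \<subseteq> {w(i := 1 - w i)}"
        using card_mono[of "{w(i := 1 - w i)}" "{y \<in> C. hamming_adj 4 w y}"] by auto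
      then obtain y where y: "y \<in> C" "hamming_adj 4 w y" "y \<noteq> w(i := 1 - w i)" by blast
      have yQ: "y \<in> ?Q" using y C by blast
      obtain j where j: "j \<in> {1..4}" "y j \<noteq> w j" "y = w(j := y j)"
        using y(2) hamming_adj_iff[OF wQ yQ] by blast
      have bit: "u k = 0 \<or> u k = 1" if "u \<in> ?Q" "k \<in> {1..4}" for u k
        using that unfolding words_def by blast
      have "j \<noteq> i"
      proof
        assume "j = i"
        then have "y i = 1 - w i" using bit[OF wQ i] bit[OF yQ i] j(2) by auto
        then show False using y(3) j(3) \<open>j = i\<close> by simp
      qed
      have yi: "y i = w i" using j(3) \<open>j \<noteq> i\<close> by (metis fun_upd_other)
      let ?w = "w(i := 1 - w i)" and ?y = "y(i := 1 - y i)"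
      have "?y = ?w(j := y j)"
      proof -
        have "?y = (w(j := y j))(i := 1 - w i)" using j(3) yi by simp
        then show ?thesis using \<open>j \<noteq> i\<close> by (simp add: fun_upd_twist)
      qed
      then have "hamming_adj 4 ?w ?y"
        unfolding hamming_adj_iff[OF flip_Q[OF wQ] flip_Q[OF yQ]]
        using j(1,2) \<open>j \<noteq> i\<close> by (intro bexI[of _ j]) auto
      moreover have "hamming_adj 4 ?y y" using adj_flip[OF yQ] hamming_adj_sym by blast
      moreover have "hamming_adj 4 y w" using y(2) hamming_adj_sym by blast
      moreover have "w \<noteq> ?y" using j(2) \<open>j \<noteq> i\<close> by (metis fun_upd_other)
      ultimately show False
        using induces_cycle_8_no_square[of "hamming_adj 4" C w ?w ?y y, OF cyc(1) w(1) closed[OF w(1)]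
            closed[OF y(1)] y(1) adj_flip[OF wQ]] y(3) by blast
    qed
    then obtain u where u: "u \<in> C" "u(i := 1 - u i) \<notin> C" by blast
    have uQ: "u \<in> ?Q" using u C by blast
    define x where "x = lft u"
    define b where "b = (if u i = 1 then b0 else b1)"
    have bA: "b \<in> A" using b B by (auto simp: b_def)
    have x: "x \<in> words 4 A" "x \<in> D" using lft_words p_lft[OF uQ] u D_iff by (auto simp: x_def)
    have y: "x(i := b) \<in> words 4 A" by (rule words_upd[OF x(1) i bA])
    have "u i = 0 \<or> u i = 1" using uQ i unfolding words_def by blast
    then have "letter_class (B 1) b = 1 - u i"
      using \<open>b0 \<in> B 0\<close> \<open>b1 \<in> B 1\<close> B(2) by (auto simp: b_def letter_class_def)
    then have "?p (x(i := b)) = u(i := 1 - u i)" using p_upd[OF i] p_lft[OF uQ] by (simp add: x_def)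
    then have "x(i := b) \<notin> D" using D_iff[OF y] u by simp
    moreover have "b \<noteq> x i"
      using i \<open>b0 \<in> B 0\<close> \<open>b1 \<in> B 1\<close> B(2) by (auto simp: b_def x_def lft_def)
    then have "{j \<in> {1..4}. x j \<noteq> (x(i := b)) j} = {i}" using i by auto
    ultimately show "essential 4 A D i"
      unfolding essential_def using x y by blast
  qed
qed

lemma bij_betw_matching_sets:
  assumes A: "finite A" and "U \<subseteq> A" "T \<subseteq> A" "card U = card T"
  obtains \<tau> where "bij_betw \<tau> A A" "\<And>a. a \<in> A \<Longrightarrow> \<tau> a \<in> T \<longleftrightarrow> a \<in> U"
proof -
  have fin: "finite U" "finite T" using assms finite_subset by blast+
  obtain g where g: "bij_betw g U T" using finite_same_card_bij[OF fin assms(4)] by blast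
  have "card (A - U) = card (A - T)" using assms fin by (simp add: card_Diff_subset)
  then obtain g' where g': "bij_betw g' (A - U) (A - T)"
    using finite_same_card_bij[of "A - U" "A - T"] A by auto
  define \<tau> where "\<tau> a = (if a \<in> U then g a else g' a)" for a
  have "bij_betw \<tau> U T" using g by (rule iffD1[OF bij_betw_cong, rotated]) (simp add: \<tau>_def)
  moreover have "bij_betw \<tau> (A - U) (A - T)" using g' by (rule iffD1[OF bij_betw_cong, rotated]) (simp add: \<tau>_def)
  ultimately have "bij_betw \<tau> (U \<union> (A - U)) (T \<union> (A - T))" by (rule bij_betw_combine) blast
  moreover have "U \<union> (A - U) = A" "T \<union> (A - T) = A" using assms by blast+
  ultimately have "bij_betw \<tau> A A" by simp
  moreover have "\<tau> a \<in> T \<longleftrightarrow> a \<in> U" if "a \<in> A" for a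
    using that g g' by (auto simp: \<tau>_def bij_betw_def)
  ultimately show thesis by (rule that)
qed

text \<open>The halves \<open>X\<close>, \<open>U\<close>, \<open>V\<close>, \<open>W\<close> may
  differ, whereas a lifting uses one halving for all coordinates. Letter permutations carry
  \<open>U\<close> to the half required at each coordinate, and a coordinate permutation matches
  \<open>i\<close>, \<open>j\<close>, \<open>k\<close>, \<open>l\<close> with the places 1 to 4 of
  \<open>base_cycle\<close>.\<close>

lemma lifting_if_four_coordinates:
  fixes A :: "'a set" and C :: "(nat \<Rightarrow> 'a) set"
  assumes A: "finite A" and CW: "C \<subseteq> words 4 A"
    and I: "{1..4} = {i, j, k, l}" "distinct [i, j, k, l]"
    and sets: "X \<subseteq> A" "U \<subseteq> A" "V \<subseteq> A" "W \<subseteq> A"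
    and half: "2 * card X = card A" "2 * card U = card A" "2 * card V = card A" "2 * card W = card A"
    and q: "card A > 0"
    and F: "\<And>x. x \<in> words 4 A \<Longrightarrow> of_bool (x \<in> C) = 1 / 2 + centered A X (x i) * centered A U (x j)
        + centered A X (x i) * centered A V (x k) + centered A U (x j) * centered A W (x l)
        - centered A V (x k) * centered A W (x l)"
  shows "\<exists>D. alphabet_lifting_8_cycles A D \<and> hamming_equivalent 4 A D C"
proof -
  define B where "B m = (if m = 1 then U else A - U)" for m :: nat
  have B01: "B 0 = A - U" "B 1 = U" by (simp_all add: B_def)
  have fin: "finite U" using sets A finite_subset by blast
  define D where "D = (\<Union>w\<in>base_cycle. \<Pi>\<^sub>E m\<in>{1..4}. B (w m))"
  have base: "base_cycle \<subseteq> words 4 {0, 1}" by (auto simp: base_cycle_def)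
  have B: "B 0 \<union> B 1 = A" "B 0 \<inter> B 1 = {}" "card (B 0) = card (B 1)"
    unfolding B01 using sets half fin by (auto simp: card_Diff_subset)
  have "alphabet_lifting_8_cycles A D"
    unfolding alphabet_lifting_8_cycles_def
    using B base induces_cycle_base_cycle induces_cycle_base_cycle_compl D_def by blast
  moreover have "hamming_equivalent 4 A D C"
  proof -
    define T where "T m = (if m = i then X else if m = j then U else if m = k then V else W)" for m
    have "\<exists>\<tau>. bij_betw \<tau> A A \<and> (\<forall>a\<in>A. \<tau> a \<in> T m \<longleftrightarrow> a \<in> U)" for m
    proof -
      have "T m \<subseteq> A" "card U = card (T m)" using sets half by (auto simp: T_def)
      then show ?thesis using bij_betw_matching_sets[OF A sets(2)] by metis
    qed
    then obtain \<tau> where \<tau>: "\<And>m. bij_betw (\<tau> m) A A" "\<And>m a. a \<in> A \<Longrightarrow> \<tau> m a \<in> T m \<longleftrightarrow> a \<in> U"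
      by metis
    define \<sigma> where "\<sigma> m = (if m = i then 1 else if m = j then 2 else if m = k then 3
      else if m = l then 4 else m)" for m
    have "bij_betw \<sigma> {i, j, k, l} {1, 2, 3, 4}"
      using I(2) by (auto simp: bij_betw_def inj_on_def \<sigma>_def)
    then have "bij_betw \<sigma> {1..4} {1..4}" using I(1) atLeastAtMost_1_4 by simp
    then have \<sigma>: "\<sigma> permutes {1..4}"
    proof (rule bij_imp_permutes)
      fix m assume "m \<notin> {1..4::nat}"
      then show "\<sigma> m = m" unfolding I(1) by (simp add: \<sigma>_def)
    qed
    define \<phi> where "\<phi> = (\<lambda>x. \<lambda>m\<in>{1..4}. \<tau> m (permute_word 4 \<sigma> x m))"
    have bij: "bij_betw \<phi> (words 4 A) (words 4 A)"
      by (rule hamming_automorphism(1)[OF A \<sigma> \<tau>(1) \<phi>_def])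
    have D_iff: "z \<in> D \<longleftrightarrow> \<phi> z \<in> C" if z: "z \<in> words 4 A" for z
    proof -
      have zA: "z 1 \<in> A" "z 2 \<in> A" "z 3 \<in> A" "z 4 \<in> A" using z by (auto simp: words_def)
      have ijkl: "i \<in> {1..4}" "j \<in> {1..4}" "k \<in> {1..4}" "l \<in> {1..4}" unfolding I(1) by auto
      have ph: "\<phi> z m = \<tau> m (z (\<sigma> m))" if "m \<in> {1..4}" for m
        using that by (simp add: \<phi>_def permute_word_def)
      have \<sigma>v: "\<sigma> i = 1" "\<sigma> j = 2" "\<sigma> k = 3" "\<sigma> l = 4" and Tv: "T i = X" "T j = U" "T k = V" "T l = W"
        using I(2) by (auto simp: \<sigma>_def T_def)
      have val: "centered A S t = (if t \<in> S then 1 / 2 else - 1 / 2)" if "2 * card S = card A" for S t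
      proof -
        have "real (card A) = 2 * real (card S)" "real (card S) > 0" using that q by linarith+
        then show ?thesis by (simp add: centered_def)
      qed
      have c: "centered A X (\<phi> z i) = (if z 1 \<in> U then 1 / 2 else - 1 / 2)"
        "centered A U (\<phi> z j) = (if z 2 \<in> U then 1 / 2 else - 1 / 2)"
        "centered A V (\<phi> z k) = (if z 3 \<in> U then 1 / 2 else - 1 / 2)"
        "centered A W (\<phi> z l) = (if z 4 \<in> U then 1 / 2 else - 1 / 2)"
        using \<tau>(2)[OF zA(1), of i] \<tau>(2)[OF zA(2), of j] \<tau>(2)[OF zA(3), of k] \<tau>(2)[OF zA(4), of l]
        unfolding Tv val[OF half(1)] val[OF half(2)] val[OF half(3)] val[OF half(4)]
          ph[OF ijkl(1)] ph[OF ijkl(2)] ph[OF ijkl(3)] ph[OF ijkl(4)] \<sigma>v by simp_all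
      have "\<phi> z \<in> words 4 A" using bij z by (auto simp: bij_betw_def)
      \<comment> \<open>All factors are 1/2 or -1/2, so either the first two or the last two
        products cancel, and the other two agree.\<close>
      from F[OF this] have "\<phi> z \<in> C \<longleftrightarrow>
          (if (z 2 \<in> U) = (z 3 \<in> U) then (z 1 \<in> U) = (z 2 \<in> U) else (z 4 \<in> U) = (z 2 \<in> U))"
        unfolding c by (auto split: if_splits)
      also have "\<dots> \<longleftrightarrow> word_class U z \<in> base_cycle"
        using word_class_in_words[of U z]
        by (auto simp: base_cycle_def word_class_def letter_class_def)
      also have "\<dots> \<longleftrightarrow> z \<in> D"
        unfolding D_def lifting_eq[OF B(1,2) base] B01(2) using z by simp
      finally show ?thesis by simp
    qed
    have DW: "D \<subseteq> words 4 A" unfolding D_def lifting_eq[OF B(1,2) base] by blast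
    have "C = \<phi> ` D"
    proof (intro equalityI subsetI)
      fix w assume w: "w \<in> C"
      then obtain z where "z \<in> words 4 A" "w = \<phi> z" using CW bij unfolding bij_betw_def by blast
      then show "w \<in> \<phi> ` D" using D_iff w by blast
    next
      fix w assume "w \<in> \<phi> ` D"
      then show "w \<in> C" using D_iff DW by blast
    qed
    then show ?thesis
      unfolding hamming_equivalent_def \<phi>_def using \<sigma> \<tau>(1)
      by (intro exI[of _ \<sigma>] exI[of _ \<tau>] conjI ballI)
  qed
  ultimately show ?thesis by blast
qed

section \<open>The classification\<close>

text \<open>Reducedness becomes \<open>ess\<close>: a coordinate without interactions could be
  changed without affecting the indicator.\<close>

lemma boolean_degree_two_if_second_eigenfunction:
  fixes A :: "'a set" and C :: "(nat \<Rightarrow> 'a) set"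
  assumes A: "finite A" "A \<noteq> {}" and CW: "C \<subseteq> words n A" and red: "reduced n A C"
    and eig: "second_eigenfunction {1..n} A (\<lambda>x. word_indicator n C x - \<rho>)"
  obtains f where "boolean_degree_two {1..n} A f \<rho> (word_indicator n C)"
proof -
  have dep: "word_indicator n C x - \<rho> = word_indicator n C y - \<rho>"
    if "\<And>i. i \<in> {1..n} \<Longrightarrow> x i = y i" for x y
  proof -
    have "restrict x {1..n} = restrict y {1..n}" using that by (rule restrict_ext)
    then show ?thesis by (simp add: word_indicator_def)
  qed
  obtain f :: "nat \<Rightarrow> nat \<Rightarrow> 'a \<Rightarrow> 'a \<Rightarrow> real" where sym: "\<And>i j s t. f i j s t = f j i t s" and diag: "\<And>i s t. f i i s t = 0"
    and zero: "\<And>i j s. i \<in> {1..n} \<Longrightarrow> j \<in> {1..n} \<Longrightarrow> s \<in> A \<Longrightarrow> (\<Sum>t\<in>A. f i j s t) = 0"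
    and F: "\<And>x. x \<in> cube {1..n} A \<Longrightarrow>
      word_indicator n C x - \<rho> = (\<Sum>i\<in>{1..n}. \<Sum>j\<in>{1..n}. f i j (x i) (x j)) / 2"
    by (rule second_eigenfunction_decomposition[OF finite_atLeastAtMost A eig dep]) (assumption | rule that)+
  have "boolean_degree_two {1..n} A f \<rho> (word_indicator n C)"
  proof
    show "word_indicator n C x \<in> {0, 1}" for x by (simp add: word_indicator_def)
    show "word_indicator n C x = \<rho> + (\<Sum>i\<in>{1..n}. \<Sum>j\<in>{1..n}. f i j (x i) (x j)) / 2"
      if "x \<in> cube {1..n} A" for x using F[OF that] by simp
    show "\<exists>j\<in>{1..n}. \<exists>s\<in>A. \<exists>t\<in>A. f i j s t \<noteq> 0" if i: "i \<in> {1..n}" for i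
    proof (rule ccontr)
      assume "\<not> ?thesis"
      then have z: "f i j s t = 0" "f j i t s = 0" if "j \<in> {1..n}" "s \<in> A" "t \<in> A" for j s t
        using that sym[of j i] by auto
      obtain x y where xy: "x \<in> words n A" "y \<in> words n A" "{j \<in> {1..n}. x j \<noteq> y j} = {i}"
        "(x \<in> C) \<noteq> (y \<in> C)"
        using red i unfolding reduced_def essential_def by blast
      have y: "y = x(i := y i)" using differ_singleton_iff[OF xy(1,2)] xy(3) by blast
      have cube: "x \<in> cube {1..n} A" "y \<in> cube {1..n} A" using xy by (auto simp: words_iff)
      have "f k l (x k) (x l) = f k l (y k) (y l)" if "k \<in> {1..n}" "l \<in> {1..n}" for k l
      proof (cases "k = i \<or> l = i")
        case True
        then show ?thesis using z that cube by (auto simp: cube_def)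
      next
        case False
        then have "y k = x k" "y l = x l" using fun_cong[OF y, of k] fun_cong[OF y, of l] by simp_all
        then show ?thesis by simp
      qed
      then have "word_indicator n C x = word_indicator n C y"
        using F[OF cube(1)] F[OF cube(2)] by simp
      moreover have "word_indicator n C x = of_bool (x \<in> C)" "word_indicator n C y = of_bool (y \<in> C)"
        by (simp_all only: word_indicator_def restrict_word[OF xy(1)] restrict_word[OF xy(2)])
      ultimately show False using xy(4) by (cases "y \<in> C") simp_all
    qed
  qed (use A sym diag zero in auto)
  then show thesis by (rule that)
qed

theorem theorem5:
  fixes A :: "'a set" and C :: "(nat \<Rightarrow> 'a) set" and n q :: nat
  assumes "finite A" and "card A = q" and "q > 0"
  shows "(reduced n A C \<and>
          equitable_2_partition_with_eigenvalue (words n A) (hamming_adj n) C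
            (hamming_eigenvalue 2 n q))
     \<longleftrightarrow>
         ((n = 2 \<or> n = 3) \<and> reduced n A C \<and>
          equitable_2_partition_with_eigenvalue (words n A) (hamming_adj n) C
            (hamming_eigenvalue 2 n q))
       \<or> (n = 4 \<and> even q \<and>
          (\<exists>D. alphabet_lifting_8_cycles A D \<and> hamming_equivalent n A D C))
       \<or> ((\<exists>S. equitable_2_partition (words n A) (hamming_adj n) C S) \<and>
          (\<exists>M. permutation_switching n A M \<and> hamming_equivalent n A M C))"
    (is "?L \<longleftrightarrow> ?R1 \<or> ?R2 \<or> ?R3")
proof
  have A: "finite A" "A \<noteq> {}" using assms by auto
  assume L: ?L
  then obtain S where S: "equitable_2_partition (words n A) (hamming_adj n) C S"
    unfolding equitable_2_partition_with_eigenvalue_def by blast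
  have part: "two_partition (words n A) C" using S by (simp add: equitable_2_partition_def)
  then have CW: "C \<subseteq> words n A" by (simp add: two_partition_def)
  have eq: "equitable_2_partition_with_eigenvalue (words n A) (hamming_adj n) C
      (hamming_eigenvalue 2 n (card A))" using L assms(2) by simp
  obtain \<rho> where eig: "second_eigenfunction {1..n} A (\<lambda>x. word_indicator n C x - \<rho>)"
    using second_eigenfunction_if_equitable[OF eq A] .
  obtain f where "boolean_degree_two {1..n} A f \<rho> (word_indicator n C)"
    using boolean_degree_two_if_second_eigenfunction[OF A CW conjunct1[OF L] eig] .
  then interpret boolean_degree_two "{1..n}" A f \<rho> "word_indicator n C" .
  have W01: "word_indicator n C x = of_bool (x \<in> C)" if "x \<in> words n A" for x
    using restrict_word[OF that] by (simp add: word_indicator_def)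
  \<comment> \<open>With fewer than two coordinates there are no interactions, so the indicator
    would be the constant \<rho>, although both parts are nonempty.\<close>
  have "n \<ge> 2"
  proof (rule ccontr)
    assume "\<not> ?thesis"
    then have "i = j" if "i \<in> {1..n}" "j \<in> {1..n}" for i j using that by simp
    then have "(\<Sum>i\<in>{1..n}. \<Sum>j\<in>{1..n}. f i j (x i) (x j)) = 0" for x
      using diag by (intro sum.neutral ballI) metis
    then have const: "of_bool (x \<in> C) = \<rho>" if "x \<in> words n A" for x
      using W01[OF that] F_eq[of x] that by (simp add: words_iff)
    obtain x y where "x \<in> words n A" "x \<in> C" "y \<in> words n A" "y \<notin> C"
      using part unfolding two_partition_def by blast
    then show False using const[of x] const[of y] by simp
  qed
  moreover have "?R2 \<or> ?R3" if n: "n \<ge> 4"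
  proof (cases "\<exists>i j x. i \<in> {1..n} \<and> j \<in> {1..n} \<and> i \<noteq> j \<and> fixes_F {i, j} x")
    case True
    then obtain c where c: "c \<in> {1..n}" "\<And>k l. k \<in> {1..n} - {c} \<Longrightarrow> l \<in> {1..n} - {c} \<Longrightarrow> flat k l"
      using star_if_fixes_pair n by (metis card_atLeastAtMost diff_Suc_1)
    have "\<exists>M. permutation_switching n A M \<and> hamming_equivalent n A M C"
      by (rule switching_if_star[OF boolean_degree_two_axioms CW c])
    then show ?thesis using S by blast
  next
    case False
    have "n = 4" using card_le_4_if_no_pair[OF False] n by simp
    then have card4: "card {1..n} = 4" by simp
    obtain i j k l X U V W where form: "{1..n} = {i, j, k, l}" "distinct [i, j, k, l]"
      "X \<subseteq> A" "U \<subseteq> A" "V \<subseteq> A" "W \<subseteq> A"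
      "2 * card X = card A" "2 * card U = card A" "2 * card V = card A" "2 * card W = card A"
      and F: "\<And>x. x \<in> cube {1..n} A \<Longrightarrow> word_indicator n C x = 1 / 2 + centered A X (x i) * centered A U (x j)
        + centered A X (x i) * centered A V (x k) + centered A U (x j) * centered A W (x l)
        - centered A V (x k) * centered A W (x l)"
      by (rule four_coordinates_form[OF False card4]) (assumption | rule that)+
    have "even q" using form(7) assms(2) by (metis dvd_triv_left)
    moreover have "\<exists>D. alphabet_lifting_8_cycles A D \<and> hamming_equivalent 4 A D C"
    proof (rule lifting_if_four_coordinates[OF A(1) _ _ form(2-10)])
      show "C \<subseteq> words 4 A" "{1..4} = {i, j, k, l}" "card A > 0" using CW form(1) \<open>n = 4\<close> assms by simp_all
      show "of_bool (x \<in> C) = 1 / 2 + centered A X (x i) * centered A U (x j)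
        + centered A X (x i) * centered A V (x k) + centered A U (x j) * centered A W (x l)
        - centered A V (x k) * centered A W (x l)" if "x \<in> words 4 A" for x
        using F[of x] W01[of x] that \<open>n = 4\<close> by (simp add: words_iff)
    qed
    ultimately show ?thesis using \<open>n = 4\<close> by blast
  qed
  ultimately show "?R1 \<or> ?R2 \<or> ?R3" using L by (cases "n = 2 \<or> n = 3") auto
next
  have A: "finite A" "A \<noteq> {}" using assms by auto
  have transfer: ?L if D: "D \<subseteq> words n A" "reduced n A D" "hamming_equivalent n A D C"
    "equitable_2_partition_with_eigenvalue (words n A) (hamming_adj n) D (hamming_eigenvalue 2 n (card A))" for D
    using hamming_equivalent_transfer[OF A(1) D(3,1)] D(2,4) assms(2)
    unfolding equitable_2_partition_with_eigenvalue_def by simp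
  assume "?R1 \<or> ?R2 \<or> ?R3"
  then show ?L
  proof (elim disjE)
    assume ?R1
    then show ?L by blast
  next
    assume ?R2
    then obtain D where "n = 4" and D: "alphabet_lifting_8_cycles A D" "hamming_equivalent n A D C" by blast
    note lift = lifting_second_eigenvalue[OF A D(1)]
    have "D \<subseteq> words 4 A"
      using lift(2) by (auto simp: equitable_2_partition_with_eigenvalue_def equitable_2_partition_def two_partition_def)
    then show ?L using transfer D(2) lift \<open>n = 4\<close> by blast
  next
    assume ?R3
    then obtain S M where S: "equitable_2_partition (words n A) (hamming_adj n) C S"
      and M: "permutation_switching n A M" "hamming_equivalent n A M C" by blast
    have MW: "M \<subseteq> words n A"
      using M(1) unfolding permutation_switching_iff by (auto simp: switching_set_def)
    \<comment> \<open>Equitability is given for \<open>C\<close> but needed for the switched set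
      \<open>M\<close>, where it excludes singleton classes.\<close>
    have "equitable_2_partition (words n A) (hamming_adj n) M S"
      using hamming_equivalent_transfer(1)[OF A(1) M(2) MW] S by blast
    from switching_second_eigenvalue[OF A(1) M(1) this] show ?L
      using transfer[OF MW _ M(2)] by blast
  qed
qed

end
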